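(* $n_7(4) \leq 171$; that is, there exists a graph on $171$ vertices with chromatic number $4$ and girth at least $7$.
   Context: All graphs are finite and simple. The girth of a graph is the length of its shortest cycle. For integers $g$ and $k$, $n_g(k)$ denotes the smallest order of a graph with chromatic number exactly $k$ and girth at least $g$. *)

theory Defs
  imports "Graph_Theory.Pair_Digraph" "HOL-Library.Extended_Nat"
begin

text \<open>
  Finite simple graphs are the symmetric, loop-free, finite pair digraphs of locale
  \<^locale>\<open>pair_graph\<close>; each edge is represented by its two opposite arcs.
\<close>

definition proper_colouring :: "'a pair_pre_digraph \<Rightarrow> nat \<Rightarrow> ('a \<Rightarrow> nat) \<Rightarrow> bool" where
  "proper_colouring G k c \<longleftrightarrow>
     (\<forall>v \<in> pverts G. c v < k) \<and> (\<forall>(u, v) \<in> parcs G. c u \<noteq> c v)"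

definition chromatic_number :: "'a pair_pre_digraph \<Rightarrow> nat" where
  "chromatic_number G = (LEAST k. \<exists>c. proper_colouring G k c)"

text \<open>
  The bound on the length excludes the closed walks \<open>u, v, u\<close>, which are cycles of a symmetric
  digraph but not of the undirected graph. The girth of an acyclic graph is \<open>\<infinity>\<close>.
\<close>

definition girth :: "'a pair_pre_digraph \<Rightarrow> enat" where
  "girth G = (INF p \<in> {p. pre_digraph.cycle (with_proj G) p \<and> 3 \<le> length p}. enat (length p))"

text \<open>
  Every finite graph is isomorphic to one with vertices in \<^typ>\<open>nat\<close>. The value is \<open>\<infinity>\<close> if there is
  no graph with the required properties, so that an upper bound entails existence.
\<close>

definition min_order :: "nat \<Rightarrow> nat \<Rightarrow> enat" where
  "min_order g k =
     (INF G \<in> {G :: nat pair_pre_digraph.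
                 pair_graph G \<and> chromatic_number G = k \<and> enat g \<le> girth G}.
        enat (card (pverts G)))"

end

theory Submission
  imports Defs
begin

text \<open>
  The affine maps \<open>y \<mapsto> 2 ^ i * y + x\<close> of the integers modulo 17 form a group of order 136. Its elements,
  numbered \<open>8 * x + i\<close>, are joined as in the Cayley graph of the elements \<open>(x, i) = (1, 1)\<close>, \<open>(5, 4)\<close>
  and \<open>(7, 4)\<close>, of which the last two are involutions. For every \<open>x\<close> the vertices \<open>8 * x + i\<close> are
  moreover the leaves of a double star with centres \<open>136 + 2 * x\<close> (even \<open>i\<close>) and \<open>137 + 2 * x\<close>
  (odd \<open>i\<close>). This gives a 5-regular graph on 170 vertices; vertex 170 is isolated.

  The group acts by left multiplication, with one orbit of leaves and one of centres, so short cycles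
  have to be excluded at two vertices only. In a 3-colouring we may assume that the centres 136 and 137
  have colours 0 and 1; the colouring of their leaves then amounts to the binary word that tells which
  leaves have colour 2. The automorphism \<open>turn\<close>, combined with the exchange of colours 0 and 1, rotates
  this word, so only one word from each of the 36 rotation classes has to be refuted. The case
  distinctions in these refutations were found by a computer search.
\<close>

text \<open>The formulas for leaves encode right multiplication: 2 has order 8 modulo 17, 16 is -1
  and \<open>(i + 7) mod 8\<close> is \<open>i - 1\<close>, so the third entry of a leaf belongs to
  the inverse of (1, 1). That generator, its inverse and the two involutions give four neighbours;
  the centre is the fifth. The leaves over a fixed \<open>x\<close> are a left coset of the
  stabiliser of 0, and a centre stands for a left coset of the subgroup generated by multiplication
  by 4. This is why left multiplication permutes the centres as well.

  The obstacle is to exclude 3-colourings of 170 vertices. A double star is a good place to begin: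
  its two adjacent centres use up the freedom to permute the colours and leave only two colours to
  each of eight leaves. Those leaves have 32 distinct neighbours outside the double star, each
  restricted by the colour of its leaf, so that every one of the remaining cases starts from many
  constraints.\<close>

section \<open>The graph and two generators of its symmetry group\<close>

definition nbs :: "nat \<Rightarrow> nat list" where
  "nbs v =
    (if v < 136 then
       let x = v div 8; i = v mod 8 in
       [136 + 2 * x + i mod 2,
        8 * ((x + 2 ^ i) mod 17) + (i + 1) mod 8,
        8 * ((x + 16 * 2 ^ ((i + 7) mod 8)) mod 17) + (i + 7) mod 8,
        8 * ((x + 5 * 2 ^ i) mod 17) + (i + 4) mod 8,
        8 * ((x + 7 * 2 ^ i) mod 17) + (i + 4) mod 8]
     else
       let x = (v - 136) div 2; j = v mod 2 in
       [136 + 2 * x + (1 - j), 8 * x + j, 8 * x + j + 2, 8 * x + j + 4, 8 * x + j + 6])"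

text \<open>Left multiplication by the translation \<open>y + 1\<close>: \<open>x\<close> grows by
  one modulo 17, which adds 8 to the number of a leaf and 2 to that of a centre. The term
  \<open>v - 134\<close> is the offset \<open>v - 136\<close> plus 2.\<close>

definition shift :: "nat \<Rightarrow> nat" where
  "shift v = (if v < 136 then (v + 8) mod 136 else 136 + (v - 134) mod 34)"

text \<open>Left multiplication by the map \<open>2 * y\<close>: \<open>x\<close> is doubled modulo
  17 and \<open>i\<close> grows by one modulo 8. It fixes \<open>x = 0\<close>, so the double star
  there is mapped to itself with its leaves permuted cyclically; as the parity of \<open>i\<close>
  changes, the two kinds of centres are exchanged.\<close>

definition turn :: "nat \<Rightarrow> nat" where
  "turn v =
    (if v < 136 then 8 * (2 * (v div 8) mod 17) + (v + 1) mod 8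
     else 136 + 2 * (2 * ((v - 136) div 2) mod 17) + (v + 1) mod 2)"

text \<open>Stored as rewrite rules, the adjacency lists spare the exhaustive checks all modular
  arithmetic in \<open>nbs\<close>. The argument 1 is written \<open>Suc 0\<close>, the form to
  which the simplifier brings it.\<close>

lemma nbs_table:
  "nbs 0 = [136, 9, 71, 44, 60]" "nbs (Suc 0) = [137, 18, 128, 85, 117]"
  "nbs 2 = [136, 35, 121, 30, 94]" "nbs 3 = [137, 68, 106, 55, 47]"
  "nbs 4 = [136, 133, 75, 96, 80]" "nbs 5 = [137, 126, 12, 57, 25]"
  "nbs 6 = [136, 111, 21, 114, 50]" "nbs 7 = [137, 72, 38, 91, 99]"
  "nbs 8 = [138, 17, 79, 52, 68]" "nbs 9 = [139, 26, 0, 93, 125]"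
  "nbs 10 = [138, 43, 129, 38, 102]" "nbs 11 = [139, 76, 114, 63, 55]"
  "nbs 12 = [138, 5, 83, 104, 88]" "nbs 13 = [139, 134, 20, 65, 33]"
  "nbs 14 = [138, 119, 29, 122, 58]" "nbs 15 = [139, 80, 46, 99, 107]"
  "nbs 16 = [140, 25, 87, 60, 76]" "nbs 17 = [141, 34, 8, 101, 133]"
  "nbs 18 = [140, 51, 1, 46, 110]" "nbs 19 = [141, 84, 122, 71, 63]"
  "nbs 20 = [140, 13, 91, 112, 96]" "nbs 21 = [141, 6, 28, 73, 41]"
  "nbs 22 = [140, 127, 37, 130, 66]" "nbs 23 = [141, 88, 54, 107, 115]"
  "nbs 24 = [142, 33, 95, 68, 84]" "nbs 25 = [143, 42, 16, 109, 5]"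
  "nbs 26 = [142, 59, 9, 54, 118]" "nbs 27 = [143, 92, 130, 79, 71]"
  "nbs 28 = [142, 21, 99, 120, 104]" "nbs 29 = [143, 14, 36, 81, 49]"
  "nbs 30 = [142, 135, 45, 2, 74]" "nbs 31 = [143, 96, 62, 115, 123]"
  "nbs 32 = [144, 41, 103, 76, 92]" "nbs 33 = [145, 50, 24, 117, 13]"
  "nbs 34 = [144, 67, 17, 62, 126]" "nbs 35 = [145, 100, 2, 87, 79]"
  "nbs 36 = [144, 29, 107, 128, 112]" "nbs 37 = [145, 22, 44, 89, 57]"
  "nbs 38 = [144, 7, 53, 10, 82]" "nbs 39 = [145, 104, 70, 123, 131]"
  "nbs 40 = [146, 49, 111, 84, 100]" "nbs 41 = [147, 58, 32, 125, 21]"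
  "nbs 42 = [146, 75, 25, 70, 134]" "nbs 43 = [147, 108, 10, 95, 87]"
  "nbs 44 = [146, 37, 115, 0, 120]" "nbs 45 = [147, 30, 52, 97, 65]"
  "nbs 46 = [146, 15, 61, 18, 90]" "nbs 47 = [147, 112, 78, 131, 3]"
  "nbs 48 = [148, 57, 119, 92, 108]" "nbs 49 = [149, 66, 40, 133, 29]"
  "nbs 50 = [148, 83, 33, 78, 6]" "nbs 51 = [149, 116, 18, 103, 95]"
  "nbs 52 = [148, 45, 123, 8, 128]" "nbs 53 = [149, 38, 60, 105, 73]"
  "nbs 54 = [148, 23, 69, 26, 98]" "nbs 55 = [149, 120, 86, 3, 11]"
  "nbs 56 = [150, 65, 127, 100, 116]" "nbs 57 = [151, 74, 48, 5, 37]"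
  "nbs 58 = [150, 91, 41, 86, 14]" "nbs 59 = [151, 124, 26, 111, 103]"
  "nbs 60 = [150, 53, 131, 16, 0]" "nbs 61 = [151, 46, 68, 113, 81]"
  "nbs 62 = [150, 31, 77, 34, 106]" "nbs 63 = [151, 128, 94, 11, 19]"
  "nbs 64 = [152, 73, 135, 108, 124]" "nbs 65 = [153, 82, 56, 13, 45]"
  "nbs 66 = [152, 99, 49, 94, 22]" "nbs 67 = [153, 132, 34, 119, 111]"
  "nbs 68 = [152, 61, 3, 24, 8]" "nbs 69 = [153, 54, 76, 121, 89]"
  "nbs 70 = [152, 39, 85, 42, 114]" "nbs 71 = [153, 0, 102, 19, 27]"
  "nbs 72 = [154, 81, 7, 116, 132]" "nbs 73 = [155, 90, 64, 21, 53]"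
  "nbs 74 = [154, 107, 57, 102, 30]" "nbs 75 = [155, 4, 42, 127, 119]"
  "nbs 76 = [154, 69, 11, 32, 16]" "nbs 77 = [155, 62, 84, 129, 97]"
  "nbs 78 = [154, 47, 93, 50, 122]" "nbs 79 = [155, 8, 110, 27, 35]"
  "nbs 80 = [156, 89, 15, 124, 4]" "nbs 81 = [157, 98, 72, 29, 61]"
  "nbs 82 = [156, 115, 65, 110, 38]" "nbs 83 = [157, 12, 50, 135, 127]"
  "nbs 84 = [156, 77, 19, 40, 24]" "nbs 85 = [157, 70, 92, 1, 105]"
  "nbs 86 = [156, 55, 101, 58, 130]" "nbs 87 = [157, 16, 118, 35, 43]"
  "nbs 88 = [158, 97, 23, 132, 12]" "nbs 89 = [159, 106, 80, 37, 69]"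
  "nbs 90 = [158, 123, 73, 118, 46]" "nbs 91 = [159, 20, 58, 7, 135]"
  "nbs 92 = [158, 85, 27, 48, 32]" "nbs 93 = [159, 78, 100, 9, 113]"
  "nbs 94 = [158, 63, 109, 66, 2]" "nbs 95 = [159, 24, 126, 43, 51]"
  "nbs 96 = [160, 105, 31, 4, 20]" "nbs 97 = [161, 114, 88, 45, 77]"
  "nbs 98 = [160, 131, 81, 126, 54]" "nbs 99 = [161, 28, 66, 15, 7]"
  "nbs 100 = [160, 93, 35, 56, 40]" "nbs 101 = [161, 86, 108, 17, 121]"
  "nbs 102 = [160, 71, 117, 74, 10]" "nbs 103 = [161, 32, 134, 51, 59]"
  "nbs 104 = [162, 113, 39, 12, 28]" "nbs 105 = [163, 122, 96, 53, 85]"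
  "nbs 106 = [162, 3, 89, 134, 62]" "nbs 107 = [163, 36, 74, 23, 15]"
  "nbs 108 = [162, 101, 43, 64, 48]" "nbs 109 = [163, 94, 116, 25, 129]"
  "nbs 110 = [162, 79, 125, 82, 18]" "nbs 111 = [163, 40, 6, 59, 67]"
  "nbs 112 = [164, 121, 47, 20, 36]" "nbs 113 = [165, 130, 104, 61, 93]"
  "nbs 114 = [164, 11, 97, 6, 70]" "nbs 115 = [165, 44, 82, 31, 23]"
  "nbs 116 = [164, 109, 51, 72, 56]" "nbs 117 = [165, 102, 124, 33, 1]"
  "nbs 118 = [164, 87, 133, 90, 26]" "nbs 119 = [165, 48, 14, 67, 75]"
  "nbs 120 = [166, 129, 55, 28, 44]" "nbs 121 = [167, 2, 112, 69, 101]"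
  "nbs 122 = [166, 19, 105, 14, 78]" "nbs 123 = [167, 52, 90, 39, 31]"
  "nbs 124 = [166, 117, 59, 80, 64]" "nbs 125 = [167, 110, 132, 41, 9]"
  "nbs 126 = [166, 95, 5, 98, 34]" "nbs 127 = [167, 56, 22, 75, 83]"
  "nbs 128 = [168, 1, 63, 36, 52]" "nbs 129 = [169, 10, 120, 77, 109]"
  "nbs 130 = [168, 27, 113, 22, 86]" "nbs 131 = [169, 60, 98, 47, 39]"
  "nbs 132 = [168, 125, 67, 88, 72]" "nbs 133 = [169, 118, 4, 49, 17]"
  "nbs 134 = [168, 103, 13, 106, 42]" "nbs 135 = [169, 64, 30, 83, 91]"
  "nbs 136 = [137, 0, 2, 4, 6]" "nbs 137 = [136, 1, 3, 5, 7]" "nbs 138 = [139, 8, 10, 12, 14]"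
  "nbs 139 = [138, 9, 11, 13, 15]" "nbs 140 = [141, 16, 18, 20, 22]"
  "nbs 141 = [140, 17, 19, 21, 23]" "nbs 142 = [143, 24, 26, 28, 30]"
  "nbs 143 = [142, 25, 27, 29, 31]" "nbs 144 = [145, 32, 34, 36, 38]"
  "nbs 145 = [144, 33, 35, 37, 39]" "nbs 146 = [147, 40, 42, 44, 46]"
  "nbs 147 = [146, 41, 43, 45, 47]" "nbs 148 = [149, 48, 50, 52, 54]"
  "nbs 149 = [148, 49, 51, 53, 55]" "nbs 150 = [151, 56, 58, 60, 62]"
  "nbs 151 = [150, 57, 59, 61, 63]" "nbs 152 = [153, 64, 66, 68, 70]"
  "nbs 153 = [152, 65, 67, 69, 71]" "nbs 154 = [155, 72, 74, 76, 78]"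
  "nbs 155 = [154, 73, 75, 77, 79]" "nbs 156 = [157, 80, 82, 84, 86]"
  "nbs 157 = [156, 81, 83, 85, 87]" "nbs 158 = [159, 88, 90, 92, 94]"
  "nbs 159 = [158, 89, 91, 93, 95]" "nbs 160 = [161, 96, 98, 100, 102]"
  "nbs 161 = [160, 97, 99, 101, 103]" "nbs 162 = [163, 104, 106, 108, 110]"
  "nbs 163 = [162, 105, 107, 109, 111]" "nbs 164 = [165, 112, 114, 116, 118]"
  "nbs 165 = [164, 113, 115, 117, 119]" "nbs 166 = [167, 120, 122, 124, 126]"
  "nbs 167 = [166, 121, 123, 125, 127]" "nbs 168 = [169, 128, 130, 132, 134]"
  "nbs 169 = [168, 129, 131, 133, 135]"
  by (simp_all add: nbs_def)

text \<open>Turns a quantifier over the vertices into a conjunction that the simplifier can unfold.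
  The interval is unrolled by a rule for numerals, and 0 and 1 are not of the form
  \<open>numeral n\<close>; hence they are split off.\<close>

lemma all_less_170: "(\<forall>v < (170 :: nat). P v) \<longleftrightarrow> P 0 \<and> P 1 \<and> list_all P [2..<170]"
proof -
  have less_170: "{..<170 :: nat} = insert 0 (insert 1 (set [2..<170]))"
    by (auto simp del: upt_rec_numeral)
  have "(\<forall>v < 170. P v) \<longleftrightarrow> (\<forall>v \<in> {..<170}. P v)"
    by blast
  also have "\<dots> \<longleftrightarrow> P 0 \<and> P 1 \<and> list_all P [2..<170]"
    by (simp only: less_170 ball_simps list_all_iff)
  finally show ?thesis .
qed

text \<open>Symmetry is not visible in the formulas: an edge may run between a leaf and a centre, or
  be produced by a generator at one end and by its inverse at the other. So it is checked entry by
  entry.\<close>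

lemma nbs_props: "\<forall>u < 170. \<forall>v \<in> set (nbs u). v < 170 \<and> v \<noteq> u \<and> u \<in> set (nbs v)"
  unfolding all_less_170 by (simp add: nbs_table)

text \<open>Injectivity on each neighbourhood is what sends walks without backtracking to walks
  without backtracking. All conditions refer to single neighbour lists, so they can be checked
  vertex by vertex.\<close>

definition local_automorphism :: "(nat \<Rightarrow> nat) \<Rightarrow> bool" where
  "local_automorphism f \<longleftrightarrow>
    (\<forall>u < 170. f u < 170 \<and> set (map f (nbs u)) \<subseteq> set (nbs (f u)) \<and> distinct (map f (nbs u)))"

text \<open>The structural reason is that left and right multiplications commute; with the table at
  hand it becomes a finite computation.\<close>

lemma local_automorphism_turn: "local_automorphism turn"
  unfolding local_automorphism_def all_less_170
  \<comment> \<open>The flipped equation restores \<open>Suc (Suc 0)\<close> to the numeral 2, the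
    form in which the table has its entry for that vertex.\<close>
  by (simp add: nbs_table turn_def flip: numeral_2_eq_2)

lemma local_automorphism_shift: "local_automorphism shift"
  unfolding local_automorphism_def all_less_170
  by (simp add: nbs_table shift_def flip: numeral_2_eq_2)

section \<open>A colouring with four colours\<close>

text \<open>Position \<open>v\<close> holds the colour of vertex \<open>v\<close>. In this witness
  every centre of even leaves has colour 0; the centres of odd leaves have colour 1 for
  \<open>x = 0\<close>, colour 2 for \<open>x = 1, 2, 3\<close> and colour 3 from there on.\<close>

definition colouring4 :: "nat list" where
  "colouring4 = 
    [2,2,1,3,1,2,1,2,3,3,1,0,3,0,1,1,1,1,1,0,2,3,1,3,3,0,1,0,1,3,2,1,1,1,2,2,1,2,3,1,2,2,1,2,1,1,
     3,1,2,1,3,2,2,1,2,2,1,0,3,2,3,1,3,1,2,2,2,1,2,1,2,1,1,0,1,2,2,2,2,1,2,0,1,1,1,1,1,0,1,0,1,1,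
     3,1,3,0,3,0,1,0,3,2,3,0,2,0,1,0,1,1,3,0,3,0,3,2,3,0,3,0,3,0,3,0,3,0,3,0,3,0,3,0,3,0,3,0,0,1,
     0,2,0,2,0,2,0,3,0,3,0,3,0,3,0,3,0,3,0,3,0,3,0,3,0,3,0,3,0,3,0,3]"

lemma colouring4_proper:
  "\<forall>u < 170. colouring4 ! u < 4 \<and> (\<forall>v \<in> set (nbs u). colouring4 ! u \<noteq> colouring4 ! v)"
  unfolding all_less_170 by (simp add: nbs_table colouring4_def)

section \<open>Absence of short cycles, transported along the symmetries\<close>

text \<open>
  Condition \<open>no_short_cycle_at r\<close> forbids closed walks without backtracking of length 3 to 6
  through \<open>r\<close>, with the vertices in cyclic order \<open>r, a, b, c, e, d\<close>.
\<close>

definition no_short_cycle_at :: "nat \<Rightarrow> bool" where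
  "no_short_cycle_at r \<longleftrightarrow>
    (\<forall>a \<in> set (nbs r). \<forall>b \<in> set (nbs a). b \<noteq> r \<longrightarrow> b \<notin> set (nbs r) \<and>
      (\<forall>d \<in> set (nbs r). d \<noteq> a \<longrightarrow> (\<forall>e \<in> set (nbs d). e \<noteq> r \<longrightarrow>
        b \<noteq> e \<and> b \<notin> set (nbs e) \<and> (\<forall>c \<in> set (nbs b). c \<noteq> a \<longrightarrow> c \<notin> set (nbs e)))))"

lemma no_short_cycle_at_0: "no_short_cycle_at 0"
  by (simp add: no_short_cycle_at_def nbs_table)

lemma no_short_cycle_at_136: "no_short_cycle_at 136"
  by (simp add: no_short_cycle_at_def nbs_table)

text \<open>A forbidden configuration at \<open>r\<close> is carried to a forbidden one at
  \<open>f r\<close>. Adjacencies are preserved, and the inequalities that have to survive all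
  compare two neighbours of one vertex: \<open>b\<close> and \<open>r\<close> at \<open>a\<close>,
  \<open>d\<close> and \<open>a\<close> at \<open>r\<close>, \<open>e\<close> and \<open>r\<close>
  at \<open>d\<close>, \<open>c\<close> and \<open>a\<close> at \<open>b\<close>.\<close>

lemma no_short_cycle_at_local_automorphism:
  assumes f: "local_automorphism f" and r: "r < 170" and "no_short_cycle_at (f r)"
  shows "no_short_cycle_at r"
proof -
  have lt: "v < 170" if "u < 170" "v \<in> set (nbs u)" for u v
    using nbs_props that by blast
  have hom: "f v \<in> set (nbs (f u))" if "u < 170" "v \<in> set (nbs u)" for u v
    using f that by (auto simp: local_automorphism_def)
  have inj: "f v \<noteq> f w" if "u < 170" "v \<in> set (nbs u)" "w \<in> set (nbs u)" "v \<noteq> w" for u v w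
    using f that by (auto simp: local_automorphism_def distinct_map inj_on_def)
  have rev: "u \<in> set (nbs v)" if "u < 170" "v \<in> set (nbs u)" for u v
    using nbs_props that by blast
  show ?thesis
    unfolding no_short_cycle_at_def
  proof (intro ballI impI conjI)
    fix a b assume ab: "a \<in> set (nbs r)" "b \<in> set (nbs a)" "b \<noteq> r"
    note lts = lt[OF r ab(1)] lt[OF lt[OF r ab(1)] ab(2)]
    \<comment> \<open>That \<open>r\<close> is a neighbour of \<open>a\<close> comes from symmetry;
      this is the use of \<open>rev\<close>.\<close>
    have fab: "f a \<in> set (nbs (f r))" "f b \<in> set (nbs (f a))" "f b \<noteq> f r"
      using hom inj ab lts r rev by blast+
    show "b \<notin> set (nbs r)"
      using assms(3) fab hom[OF r] unfolding no_short_cycle_at_def by blast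
    fix d e assume de: "d \<in> set (nbs r)" "d \<noteq> a" "e \<in> set (nbs d)" "e \<noteq> r"
    note lts' = lt[OF r de(1)] lt[OF lt[OF r de(1)] de(3)]
    have fde: "f d \<in> set (nbs (f r))" "f d \<noteq> f a" "f e \<in> set (nbs (f d))" "f e \<noteq> f r"
      using hom inj ab de lts' r rev by blast+
    \<comment> \<open>The condition at \<open>f r\<close> for the images. Any coincidence or
      adjacency among \<open>b\<close>, \<open>c\<close> and \<open>e\<close> would be passed on to
      the images by \<open>hom\<close> and contradict it.\<close>
    have *: "f b \<noteq> f e" "f b \<notin> set (nbs (f e))"
        "\<forall>c \<in> set (nbs (f b)). c \<noteq> f a \<longrightarrow> c \<notin> set (nbs (f e))"
      using assms(3) fab fde unfolding no_short_cycle_at_def by blast+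
    show "b \<noteq> e" and "b \<notin> set (nbs e)"
      using * hom lts' by blast+
    fix c assume c: "c \<in> set (nbs b)" "c \<noteq> a"
    have "f c \<in> set (nbs (f b))" "f c \<noteq> f a"
      using hom inj ab c lts rev by blast+
    then show "c \<notin> set (nbs e)"
      using * hom lts' by blast
  qed
qed

lemma no_short_cycle_at_shift: "v < 170 \<Longrightarrow> no_short_cycle_at (shift v) \<Longrightarrow> no_short_cycle_at v"
  and no_short_cycle_at_turn: "v < 170 \<Longrightarrow> no_short_cycle_at (turn v) \<Longrightarrow> no_short_cycle_at v"
  using no_short_cycle_at_local_automorphism local_automorphism_turn local_automorphism_shift
  by blast+

text \<open>Information flows from the image of a vertex back to the vertex. Each vertex is
  therefore settled by following its orbit forwards until one of the two computed cases 0 and 136 is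
  met.\<close>

lemma no_short_cycle_at_all:
  assumes "v < 170"
  shows "no_short_cycle_at v"
proof -
  have row: "no_short_cycle_at v" if "v < 8" for v
    using that
  \<comment> \<open>On the leaves over \<open>x = 0\<close> the map \<open>turn\<close> adds one
    below 7 and sends 7 to the base case 0, so \<open>8 - v\<close> decreases.\<close>
  proof (induction "8 - v" arbitrary: v rule: less_induct)
    case less
    show ?case
    proof (cases "v = 0")
      case False
      have "no_short_cycle_at (turn v)"
      proof (cases "v = 7")
        case True
        then show ?thesis by (simp add: turn_def no_short_cycle_at_0)
      next
        case False
        with \<open>v \<noteq> 0\<close> less have "turn v = v + 1" "v + 1 < 8" by (auto simp: turn_def)
        with less show ?thesis by simp
      qed
      then show ?thesis
        using less.prems by (simp add: no_short_cycle_at_turn)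
    qed (simp add: no_short_cycle_at_0)
  qed
  \<comment> \<open>\<open>turn\<close> exchanges 136 and 137, which links the two kinds of
    centres.\<close>
  have centre: "no_short_cycle_at 137"
    by (rule no_short_cycle_at_turn) (simp_all add: turn_def no_short_cycle_at_136)
  show ?thesis
    using assms
  \<comment> \<open>\<open>shift\<close> raises the vertex number until \<open>x = 16\<close>; from
    there it wraps around to the double star over \<open>x = 0\<close>, whose ten vertices are
    settled by \<open>row\<close>, \<open>centre\<close> and the computation at 136.\<close>
  proof (induction "170 - v" arbitrary: v rule: less_induct)
    case less
    have "no_short_cycle_at (shift v)"
    proof -
      consider "v < 128" | "128 \<le> v" "v < 136" | "136 \<le> v" "v < 168" | "v = 168" | "v = 169"
        using less.prems by linarith
      then show ?thesis
      proof cases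
        case 1
        then have "shift v = v + 8" by (simp add: shift_def)
        with less 1 show ?thesis by simp
      next
        case 2
        then have "shift v = v - 128" by (simp add: shift_def mod_if)
        with row[of "v - 128"] 2 show ?thesis by simp
      next
        case 3
        then have "shift v = v + 2" by (simp add: shift_def)
        with less 3 show ?thesis by simp
      qed (simp_all add: shift_def no_short_cycle_at_136 centre)
    qed
    then show ?case
      using less.prems by (simp add: no_short_cycle_at_shift)
  qed
qed

section \<open>The pair graph and its girth\<close>

text \<open>Vertex 170 brings the order to exactly 171. The guard \<open>u < 170\<close> keeps it
  isolated, because the formula for \<open>nbs\<close> yields a list at 170 too; no list of a
  smaller vertex contains 170 by \<open>nbs_props\<close>.\<close>

definition star_graph :: "nat pair_pre_digraph" where
  "star_graph = \<lparr>pverts = {..<171}, parcs = {(u, v). u < 170 \<and> v \<in> set (nbs u)}\<rparr>"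

lemma arc_star_graph:
  assumes "(u, v) \<in> parcs star_graph"
  shows "u < 170" "v < 170" "u \<noteq> v" "v \<in> set (nbs u)" "u \<in> set (nbs v)" "(v, u) \<in> parcs star_graph"
proof -
  have *: "u < 170" "v \<in> set (nbs u)"
    using assms by (simp_all add: star_graph_def)
  have "v < 170 \<and> v \<noteq> u \<and> u \<in> set (nbs v)"
    using nbs_props * by blast
  with * show "u < 170" "v < 170" "u \<noteq> v" "v \<in> set (nbs u)" "u \<in> set (nbs v)"
      "(v, u) \<in> parcs star_graph"
    by (auto simp: star_graph_def)
qed

lemma pverts_star_graph: "pverts star_graph = {..<171}"
  by (simp add: star_graph_def)

lemma pair_graph_star_graph: "pair_graph star_graph"
proof -
  have sub: "fst e \<in> {..<171} \<and> snd e \<in> {..<171} \<and> fst e \<noteq> snd e"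
    if "e \<in> parcs star_graph" for e
    using arc_star_graph[of "fst e" "snd e"] that by auto
  have "finite (parcs star_graph)"
    by (rule finite_subset[of _ "{..<171} \<times> {..<171}"]) (use sub in \<open>auto intro!: SigmaI\<close>)
  moreover have "symmetric (with_proj star_graph)"
    using arc_star_graph(6) by (auto simp: symmetric_def intro: symI)
  ultimately show ?thesis
    using sub by unfold_locales (auto simp: pverts_star_graph)
qed

text \<open>A cycle of length 3 to 6 starting at \<open>u\<close> contains a configuration forbidden
  at \<open>u\<close>: it is read forwards from \<open>u\<close> along \<open>a\<close>,
  \<open>b\<close>, \<open>c\<close> and backwards from \<open>u\<close> along \<open>d\<close>,
  \<open>e\<close>, until the two readings meet.\<close>

lemma girth_star_graph: "7 \<le> girth star_graph"
proof -
  have "7 \<le> length p" if cyc: "pre_digraph.cycle (with_proj star_graph) p" and "3 \<le> length p" for p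
  proof (rule ccontr)
    assume "\<not> 7 \<le> length p"
    \<comment> \<open>Distinctness concerns all visited vertices but the first. As the walk is
      closed, \<open>u\<close> is still among them as the last one, which gives the inequalities
      with \<open>u\<close>.\<close>
    from cyc obtain u where
      u: "set p \<subseteq> parcs star_graph" "pcas u p u" "distinct (tl (pawalk_verts u p))" "p \<noteq> []"
      by (auto simp: pre_digraph.cycle_def pre_digraph.awalk_def cas_with_proj_eq
          awalk_verts_with_proj_eq)
    \<comment> \<open>A cycle cannot start at the isolated vertex: \<open>u\<close> has an outgoing
      arc, hence \<open>u < 170\<close>.\<close>
    have "(u, snd (hd p)) \<in> parcs star_graph"
      using u(1,2,4) by (cases p) auto
    then have "no_short_cycle_at u"
      using arc_star_graph(1) no_short_cycle_at_all by blast
    then have no_short: "b \<notin> set (nbs u) \<and>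
        (\<forall>d \<in> set (nbs u). d \<noteq> a \<longrightarrow> (\<forall>e \<in> set (nbs d). e \<noteq> u \<longrightarrow>
          b \<noteq> e \<and> b \<notin> set (nbs e) \<and> (\<forall>c \<in> set (nbs b). c \<noteq> a \<longrightarrow> c \<notin> set (nbs e))))"
      if "a \<in> set (nbs u)" "b \<in> set (nbs a)" "b \<noteq> u" for a b
      using that unfolding no_short_cycle_at_def by blast
    consider "length p = 3" | "length p = 4" | "length p = 5" | "length p = 6"
      using \<open>3 \<le> length p\<close> \<open>\<not> 7 \<le> length p\<close> by linarith
    then show False
    proof cases
      \<comment> \<open>Length 3: \<open>b\<close> would be a neighbour of \<open>u\<close>.\<close>
      case 1
      then obtain a b where p: "p = [(u, a), (a, b), (b, u)]"
        using u(2) by (auto simp: length_Suc_conv eval_nat_numeral)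
      then have arcs: "(u, a) \<in> parcs star_graph" "(a, b) \<in> parcs star_graph" "(b, u) \<in> parcs star_graph"
        using u(1) by auto
      have ne: "b \<noteq> u"
        using u(3) p by auto
      show False
        using no_short[OF arc_star_graph(4)[OF arcs(1)] arc_star_graph(4)[OF arcs(2)] ne(1)] ne
          arc_star_graph(5)[OF arcs(3)]
        by blast
    next
      \<comment> \<open>Length 4: the vertex \<open>b\<close> also plays the role of
        \<open>e\<close>, being a neighbour of \<open>d\<close>.\<close>
      case 2
      then obtain a b d where p: "p = [(u, a), (a, b), (b, d), (d, u)]"
        using u(2) by (auto simp: length_Suc_conv eval_nat_numeral)
      then have arcs: "(u, a) \<in> parcs star_graph" "(a, b) \<in> parcs star_graph" "(b, d) \<in> parcs star_graph" "(d, u) \<in> parcs star_graph"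
        using u(1) by auto
      have ne: "b \<noteq> u" "d \<noteq> a"
        using u(3) p by auto
      show False
        using no_short[OF arc_star_graph(4)[OF arcs(1)] arc_star_graph(4)[OF arcs(2)] ne(1)] ne
          arc_star_graph(5)[OF arcs(3)] arc_star_graph(5)[OF arcs(4)]
        by blast
    next
      \<comment> \<open>Length 5: the two readings end at the adjacent vertices \<open>b\<close> and
        \<open>e\<close>.\<close>
      case 3
      then obtain a b e d where p: "p = [(u, a), (a, b), (b, e), (e, d), (d, u)]"
        using u(2) by (auto simp: length_Suc_conv eval_nat_numeral)
      then have arcs: "(u, a) \<in> parcs star_graph" "(a, b) \<in> parcs star_graph" "(b, e) \<in> parcs star_graph" "(e, d) \<in> parcs star_graph" "(d, u) \<in> parcs star_graph"
        using u(1) by auto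
      have ne: "b \<noteq> u" "d \<noteq> a" "e \<noteq> u"
        using u(3) p by auto
      show False
        using no_short[OF arc_star_graph(4)[OF arcs(1)] arc_star_graph(4)[OF arcs(2)] ne(1)] ne
          arc_star_graph(5)[OF arcs(3)] arc_star_graph(5)[OF arcs(4)] arc_star_graph(5)[OF arcs(5)]
        by blast
    next
      \<comment> \<open>Length 6: \<open>c\<close> would be a common neighbour of \<open>b\<close>
        and \<open>e\<close>.\<close>
      case 4
      then obtain a b c e d where p: "p = [(u, a), (a, b), (b, c), (c, e), (e, d), (d, u)]"
        using u(2) by (auto simp: length_Suc_conv eval_nat_numeral)
      then have arcs: "(u, a) \<in> parcs star_graph" "(a, b) \<in> parcs star_graph" "(b, c) \<in> parcs star_graph" "(c, e) \<in> parcs star_graph" "(e, d) \<in> parcs star_graph" "(d, u) \<in> parcs star_graph"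
        using u(1) by auto
      have ne: "b \<noteq> u" "d \<noteq> a" "e \<noteq> u" "c \<noteq> a"
        using u(3) p by auto
      show False
        using no_short[OF arc_star_graph(4)[OF arcs(1)] arc_star_graph(4)[OF arcs(2)] ne(1)] ne
          arc_star_graph(4)[OF arcs(3)] arc_star_graph(5)[OF arcs(4)] arc_star_graph(5)[OF arcs(5)] arc_star_graph(5)[OF arcs(6)]
        by blast
    qed
  qed
  then show ?thesis
    by (auto simp: girth_def le_INF_iff numeral_eq_enat)
qed

section \<open>Three-colourings as truth assignments\<close>

text \<open>
  The letters stand for the colours 0, 1 and 2. A vertex may have several colours: clauses that
  exclude this only slow the refutations down.
\<close>

locale three_coloured =
  fixes
    r0 r1 r2 r3 r4 r5 r6 r7 r8 r9 r10 r11 r12 r13 r14 r15 r16 r17 r18 r19 r20 r21 r22 r23 r24 r25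
    r26 r27 r28 r29 r30 r31 r32 r33 r34 r35 r36 r37 r38 r39 r40 r41 r42 r43 r44 r45 r46 r47 r48
    r49 r50 r51 r52 r53 r54 r55 r56 r57 r58 r59 r60 r61 r62 r63 r64 r65 r66 r67 r68 r69 r70 r71
    r72 r73 r74 r75 r76 r77 r78 r79 r80 r81 r82 r83 r84 r85 r86 r87 r88 r89 r90 r91 r92 r93 r94
    r95 r96 r97 r98 r99 r100 r101 r102 r103 r104 r105 r106 r107 r108 r109 r110 r111 r112 r113
    r114 r115 r116 r117 r118 r119 r120 r121 r122 r123 r124 r125 r126 r127 r128 r129 r130 r131
    r132 r133 r134 r135 r136 r137 r138 r139 r140 r141 r142 r143 r144 r145 r146 r147 r148 r149
    r150 r151 r152 r153 r154 r155 r156 r157 r158 r159 r160 r161 r162 r163 r164 r165 r166 r167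
    r168 r169 g0 g1 g2 g3 g4 g5 g6 g7 g8 g9 g10 g11 g12 g13 g14 g15 g16 g17 g18 g19 g20 g21 g22
    g23 g24 g25 g26 g27 g28 g29 g30 g31 g32 g33 g34 g35 g36 g37 g38 g39 g40 g41 g42 g43 g44 g45
    g46 g47 g48 g49 g50 g51 g52 g53 g54 g55 g56 g57 g58 g59 g60 g61 g62 g63 g64 g65 g66 g67 g68
    g69 g70 g71 g72 g73 g74 g75 g76 g77 g78 g79 g80 g81 g82 g83 g84 g85 g86 g87 g88 g89 g90 g91
    g92 g93 g94 g95 g96 g97 g98 g99 g100 g101 g102 g103 g104 g105 g106 g107 g108 g109 g110 g111
    g112 g113 g114 g115 g116 g117 g118 g119 g120 g121 g122 g123 g124 g125 g126 g127 g128 g129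
    g130 g131 g132 g133 g134 g135 g136 g137 g138 g139 g140 g141 g142 g143 g144 g145 g146 g147
    g148 g149 g150 g151 g152 g153 g154 g155 g156 g157 g158 g159 g160 g161 g162 g163 g164 g165
    g166 g167 g168 g169 b0 b1 b2 b3 b4 b5 b6 b7 b8 b9 b10 b11 b12 b13 b14 b15 b16 b17 b18 b19 b20
    b21 b22 b23 b24 b25 b26 b27 b28 b29 b30 b31 b32 b33 b34 b35 b36 b37 b38 b39 b40 b41 b42 b43
    b44 b45 b46 b47 b48 b49 b50 b51 b52 b53 b54 b55 b56 b57 b58 b59 b60 b61 b62 b63 b64 b65 b66
    b67 b68 b69 b70 b71 b72 b73 b74 b75 b76 b77 b78 b79 b80 b81 b82 b83 b84 b85 b86 b87 b88 b89
    b90 b91 b92 b93 b94 b95 b96 b97 b98 b99 b100 b101 b102 b103 b104 b105 b106 b107 b108 b109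
    b110 b111 b112 b113 b114 b115 b116 b117 b118 b119 b120 b121 b122 b123 b124 b125 b126 b127
    b128 b129 b130 b131 b132 b133 b134 b135 b136 b137 b138 b139 b140 b141 b142 b143 b144 b145
    b146 b147 b148 b149 b150 b151 b152 b153 b154 b155 b156 b157 b158 b159 b160 b161 b162 b163
    b164 b165 b166 b167 b168 b169 :: bool
  assumes E:
    "r0 \<or> g0 \<or> b0" "r1 \<or> g1 \<or> b1" "r2 \<or> g2 \<or> b2" "r3 \<or> g3 \<or> b3"
    "r4 \<or> g4 \<or> b4" "r5 \<or> g5 \<or> b5" "r6 \<or> g6 \<or> b6" "r7 \<or> g7 \<or> b7"
    "r8 \<or> g8 \<or> b8" "r9 \<or> g9 \<or> b9" "r10 \<or> g10 \<or> b10"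
    "r11 \<or> g11 \<or> b11" "r12 \<or> g12 \<or> b12" "r13 \<or> g13 \<or> b13"
    "r14 \<or> g14 \<or> b14" "r15 \<or> g15 \<or> b15" "r16 \<or> g16 \<or> b16"
    "r17 \<or> g17 \<or> b17" "r18 \<or> g18 \<or> b18" "r19 \<or> g19 \<or> b19"
    "r20 \<or> g20 \<or> b20" "r21 \<or> g21 \<or> b21" "r22 \<or> g22 \<or> b22"
    "r23 \<or> g23 \<or> b23" "r24 \<or> g24 \<or> b24" "r25 \<or> g25 \<or> b25"
    "r26 \<or> g26 \<or> b26" "r27 \<or> g27 \<or> b27" "r28 \<or> g28 \<or> b28"
    "r29 \<or> g29 \<or> b29" "r30 \<or> g30 \<or> b30" "r31 \<or> g31 \<or> b31"
    "r32 \<or> g32 \<or> b32" "r33 \<or> g33 \<or> b33" "r34 \<or> g34 \<or> b34"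
    "r35 \<or> g35 \<or> b35" "r36 \<or> g36 \<or> b36" "r37 \<or> g37 \<or> b37"
    "r38 \<or> g38 \<or> b38" "r39 \<or> g39 \<or> b39" "r40 \<or> g40 \<or> b40"
    "r41 \<or> g41 \<or> b41" "r42 \<or> g42 \<or> b42" "r43 \<or> g43 \<or> b43"
    "r44 \<or> g44 \<or> b44" "r45 \<or> g45 \<or> b45" "r46 \<or> g46 \<or> b46"
    "r47 \<or> g47 \<or> b47" "r48 \<or> g48 \<or> b48" "r49 \<or> g49 \<or> b49"
    "r50 \<or> g50 \<or> b50" "r51 \<or> g51 \<or> b51" "r52 \<or> g52 \<or> b52"
    "r53 \<or> g53 \<or> b53" "r54 \<or> g54 \<or> b54" "r55 \<or> g55 \<or> b55"
    "r56 \<or> g56 \<or> b56" "r57 \<or> g57 \<or> b57" "r58 \<or> g58 \<or> b58"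
    "r59 \<or> g59 \<or> b59" "r60 \<or> g60 \<or> b60" "r61 \<or> g61 \<or> b61"
    "r62 \<or> g62 \<or> b62" "r63 \<or> g63 \<or> b63" "r64 \<or> g64 \<or> b64"
    "r65 \<or> g65 \<or> b65" "r66 \<or> g66 \<or> b66" "r67 \<or> g67 \<or> b67"
    "r68 \<or> g68 \<or> b68" "r69 \<or> g69 \<or> b69" "r70 \<or> g70 \<or> b70"
    "r71 \<or> g71 \<or> b71" "r72 \<or> g72 \<or> b72" "r73 \<or> g73 \<or> b73"
    "r74 \<or> g74 \<or> b74" "r75 \<or> g75 \<or> b75" "r76 \<or> g76 \<or> b76"
    "r77 \<or> g77 \<or> b77" "r78 \<or> g78 \<or> b78" "r79 \<or> g79 \<or> b79"
    "r80 \<or> g80 \<or> b80" "r81 \<or> g81 \<or> b81" "r82 \<or> g82 \<or> b82"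
    "r83 \<or> g83 \<or> b83" "r84 \<or> g84 \<or> b84" "r85 \<or> g85 \<or> b85"
    "r86 \<or> g86 \<or> b86" "r87 \<or> g87 \<or> b87" "r88 \<or> g88 \<or> b88"
    "r89 \<or> g89 \<or> b89" "r90 \<or> g90 \<or> b90" "r91 \<or> g91 \<or> b91"
    "r92 \<or> g92 \<or> b92" "r93 \<or> g93 \<or> b93" "r94 \<or> g94 \<or> b94"
    "r95 \<or> g95 \<or> b95" "r96 \<or> g96 \<or> b96" "r97 \<or> g97 \<or> b97"
    "r98 \<or> g98 \<or> b98" "r99 \<or> g99 \<or> b99" "r100 \<or> g100 \<or> b100"
    "r101 \<or> g101 \<or> b101" "r102 \<or> g102 \<or> b102" "r103 \<or> g103 \<or> b103"
    "r104 \<or> g104 \<or> b104" "r105 \<or> g105 \<or> b105" "r106 \<or> g106 \<or> b106"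
    "r107 \<or> g107 \<or> b107" "r108 \<or> g108 \<or> b108" "r109 \<or> g109 \<or> b109"
    "r110 \<or> g110 \<or> b110" "r111 \<or> g111 \<or> b111" "r112 \<or> g112 \<or> b112"
    "r113 \<or> g113 \<or> b113" "r114 \<or> g114 \<or> b114" "r115 \<or> g115 \<or> b115"
    "r116 \<or> g116 \<or> b116" "r117 \<or> g117 \<or> b117" "r118 \<or> g118 \<or> b118"
    "r119 \<or> g119 \<or> b119" "r120 \<or> g120 \<or> b120" "r121 \<or> g121 \<or> b121"
    "r122 \<or> g122 \<or> b122" "r123 \<or> g123 \<or> b123" "r124 \<or> g124 \<or> b124"
    "r125 \<or> g125 \<or> b125" "r126 \<or> g126 \<or> b126" "r127 \<or> g127 \<or> b127"
    "r128 \<or> g128 \<or> b128" "r129 \<or> g129 \<or> b129" "r130 \<or> g130 \<or> b130"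
    "r131 \<or> g131 \<or> b131" "r132 \<or> g132 \<or> b132" "r133 \<or> g133 \<or> b133"
    "r134 \<or> g134 \<or> b134" "r135 \<or> g135 \<or> b135" "r136 \<or> g136 \<or> b136"
    "r137 \<or> g137 \<or> b137" "r138 \<or> g138 \<or> b138" "r139 \<or> g139 \<or> b139"
    "r140 \<or> g140 \<or> b140" "r141 \<or> g141 \<or> b141" "r142 \<or> g142 \<or> b142"
    "r143 \<or> g143 \<or> b143" "r144 \<or> g144 \<or> b144" "r145 \<or> g145 \<or> b145"
    "r146 \<or> g146 \<or> b146" "r147 \<or> g147 \<or> b147" "r148 \<or> g148 \<or> b148"
    "r149 \<or> g149 \<or> b149" "r150 \<or> g150 \<or> b150" "r151 \<or> g151 \<or> b151"
    "r152 \<or> g152 \<or> b152" "r153 \<or> g153 \<or> b153" "r154 \<or> g154 \<or> b154"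
    "r155 \<or> g155 \<or> b155" "r156 \<or> g156 \<or> b156" "r157 \<or> g157 \<or> b157"
    "r158 \<or> g158 \<or> b158" "r159 \<or> g159 \<or> b159" "r160 \<or> g160 \<or> b160"
    "r161 \<or> g161 \<or> b161" "r162 \<or> g162 \<or> b162" "r163 \<or> g163 \<or> b163"
    "r164 \<or> g164 \<or> b164" "r165 \<or> g165 \<or> b165" "r166 \<or> g166 \<or> b166"
    "r167 \<or> g167 \<or> b167" "r168 \<or> g168 \<or> b168" "r169 \<or> g169 \<or> b169"
    "\<not> r0 \<or> \<not> r9" "\<not> g0 \<or> \<not> g9" "\<not> b0 \<or> \<not> b9"
    "\<not> r0 \<or> \<not> r44" "\<not> g0 \<or> \<not> g44" "\<not> b0 \<or> \<not> b44"
    "\<not> r0 \<or> \<not> r60" "\<not> g0 \<or> \<not> g60" "\<not> b0 \<or> \<not> b60"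
    "\<not> r0 \<or> \<not> r71" "\<not> g0 \<or> \<not> g71" "\<not> b0 \<or> \<not> b71"
    "\<not> r0 \<or> \<not> r136" "\<not> g0 \<or> \<not> g136" "\<not> b0 \<or> \<not> b136"
    "\<not> r1 \<or> \<not> r18" "\<not> g1 \<or> \<not> g18" "\<not> b1 \<or> \<not> b18"
    "\<not> r1 \<or> \<not> r85" "\<not> g1 \<or> \<not> g85" "\<not> b1 \<or> \<not> b85"
    "\<not> r1 \<or> \<not> r117" "\<not> g1 \<or> \<not> g117" "\<not> b1 \<or> \<not> b117"
    "\<not> r1 \<or> \<not> r128" "\<not> g1 \<or> \<not> g128" "\<not> b1 \<or> \<not> b128"
    "\<not> r1 \<or> \<not> r137" "\<not> g1 \<or> \<not> g137" "\<not> b1 \<or> \<not> b137"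
    "\<not> r2 \<or> \<not> r30" "\<not> g2 \<or> \<not> g30" "\<not> b2 \<or> \<not> b30"
    "\<not> r2 \<or> \<not> r35" "\<not> g2 \<or> \<not> g35" "\<not> b2 \<or> \<not> b35"
    "\<not> r2 \<or> \<not> r94" "\<not> g2 \<or> \<not> g94" "\<not> b2 \<or> \<not> b94"
    "\<not> r2 \<or> \<not> r121" "\<not> g2 \<or> \<not> g121" "\<not> b2 \<or> \<not> b121"
    "\<not> r2 \<or> \<not> r136" "\<not> g2 \<or> \<not> g136" "\<not> b2 \<or> \<not> b136"
    "\<not> r3 \<or> \<not> r47" "\<not> g3 \<or> \<not> g47" "\<not> b3 \<or> \<not> b47"
    "\<not> r3 \<or> \<not> r55" "\<not> g3 \<or> \<not> g55" "\<not> b3 \<or> \<not> b55"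
    "\<not> r3 \<or> \<not> r68" "\<not> g3 \<or> \<not> g68" "\<not> b3 \<or> \<not> b68"
    "\<not> r3 \<or> \<not> r106" "\<not> g3 \<or> \<not> g106" "\<not> b3 \<or> \<not> b106"
    "\<not> r3 \<or> \<not> r137" "\<not> g3 \<or> \<not> g137" "\<not> b3 \<or> \<not> b137"
    "\<not> r4 \<or> \<not> r75" "\<not> g4 \<or> \<not> g75" "\<not> b4 \<or> \<not> b75"
    "\<not> r4 \<or> \<not> r80" "\<not> g4 \<or> \<not> g80" "\<not> b4 \<or> \<not> b80"
    "\<not> r4 \<or> \<not> r96" "\<not> g4 \<or> \<not> g96" "\<not> b4 \<or> \<not> b96"
    "\<not> r4 \<or> \<not> r133" "\<not> g4 \<or> \<not> g133" "\<not> b4 \<or> \<not> b133"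
    "\<not> r4 \<or> \<not> r136" "\<not> g4 \<or> \<not> g136" "\<not> b4 \<or> \<not> b136"
    "\<not> r5 \<or> \<not> r12" "\<not> g5 \<or> \<not> g12" "\<not> b5 \<or> \<not> b12"
    "\<not> r5 \<or> \<not> r25" "\<not> g5 \<or> \<not> g25" "\<not> b5 \<or> \<not> b25"
    "\<not> r5 \<or> \<not> r57" "\<not> g5 \<or> \<not> g57" "\<not> b5 \<or> \<not> b57"
    "\<not> r5 \<or> \<not> r126" "\<not> g5 \<or> \<not> g126" "\<not> b5 \<or> \<not> b126"
    "\<not> r5 \<or> \<not> r137" "\<not> g5 \<or> \<not> g137" "\<not> b5 \<or> \<not> b137"
    "\<not> r6 \<or> \<not> r21" "\<not> g6 \<or> \<not> g21" "\<not> b6 \<or> \<not> b21"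
    "\<not> r6 \<or> \<not> r50" "\<not> g6 \<or> \<not> g50" "\<not> b6 \<or> \<not> b50"
    "\<not> r6 \<or> \<not> r111" "\<not> g6 \<or> \<not> g111" "\<not> b6 \<or> \<not> b111"
    "\<not> r6 \<or> \<not> r114" "\<not> g6 \<or> \<not> g114" "\<not> b6 \<or> \<not> b114"
    "\<not> r6 \<or> \<not> r136" "\<not> g6 \<or> \<not> g136" "\<not> b6 \<or> \<not> b136"
    "\<not> r7 \<or> \<not> r38" "\<not> g7 \<or> \<not> g38" "\<not> b7 \<or> \<not> b38"
    "\<not> r7 \<or> \<not> r72" "\<not> g7 \<or> \<not> g72" "\<not> b7 \<or> \<not> b72"
    "\<not> r7 \<or> \<not> r91" "\<not> g7 \<or> \<not> g91" "\<not> b7 \<or> \<not> b91"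
    "\<not> r7 \<or> \<not> r99" "\<not> g7 \<or> \<not> g99" "\<not> b7 \<or> \<not> b99"
    "\<not> r7 \<or> \<not> r137" "\<not> g7 \<or> \<not> g137" "\<not> b7 \<or> \<not> b137"
    "\<not> r8 \<or> \<not> r17" "\<not> g8 \<or> \<not> g17" "\<not> b8 \<or> \<not> b17"
    "\<not> r8 \<or> \<not> r52" "\<not> g8 \<or> \<not> g52" "\<not> b8 \<or> \<not> b52"
    "\<not> r8 \<or> \<not> r68" "\<not> g8 \<or> \<not> g68" "\<not> b8 \<or> \<not> b68"
    "\<not> r8 \<or> \<not> r79" "\<not> g8 \<or> \<not> g79" "\<not> b8 \<or> \<not> b79"
    "\<not> r8 \<or> \<not> r138" "\<not> g8 \<or> \<not> g138" "\<not> b8 \<or> \<not> b138"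
    "\<not> r9 \<or> \<not> r26" "\<not> g9 \<or> \<not> g26" "\<not> b9 \<or> \<not> b26"
    "\<not> r9 \<or> \<not> r93" "\<not> g9 \<or> \<not> g93" "\<not> b9 \<or> \<not> b93"
    "\<not> r9 \<or> \<not> r125" "\<not> g9 \<or> \<not> g125" "\<not> b9 \<or> \<not> b125"
    "\<not> r9 \<or> \<not> r139" "\<not> g9 \<or> \<not> g139" "\<not> b9 \<or> \<not> b139"
    "\<not> r10 \<or> \<not> r38" "\<not> g10 \<or> \<not> g38" "\<not> b10 \<or> \<not> b38"
    "\<not> r10 \<or> \<not> r43" "\<not> g10 \<or> \<not> g43" "\<not> b10 \<or> \<not> b43"
    "\<not> r10 \<or> \<not> r102" "\<not> g10 \<or> \<not> g102" "\<not> b10 \<or> \<not> b102"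
    "\<not> r10 \<or> \<not> r129" "\<not> g10 \<or> \<not> g129" "\<not> b10 \<or> \<not> b129"
    "\<not> r10 \<or> \<not> r138" "\<not> g10 \<or> \<not> g138" "\<not> b10 \<or> \<not> b138"
    "\<not> r11 \<or> \<not> r55" "\<not> g11 \<or> \<not> g55" "\<not> b11 \<or> \<not> b55"
    "\<not> r11 \<or> \<not> r63" "\<not> g11 \<or> \<not> g63" "\<not> b11 \<or> \<not> b63"
    "\<not> r11 \<or> \<not> r76" "\<not> g11 \<or> \<not> g76" "\<not> b11 \<or> \<not> b76"
    "\<not> r11 \<or> \<not> r114" "\<not> g11 \<or> \<not> g114" "\<not> b11 \<or> \<not> b114"
    "\<not> r11 \<or> \<not> r139" "\<not> g11 \<or> \<not> g139" "\<not> b11 \<or> \<not> b139"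
    "\<not> r12 \<or> \<not> r83" "\<not> g12 \<or> \<not> g83" "\<not> b12 \<or> \<not> b83"
    "\<not> r12 \<or> \<not> r88" "\<not> g12 \<or> \<not> g88" "\<not> b12 \<or> \<not> b88"
    "\<not> r12 \<or> \<not> r104" "\<not> g12 \<or> \<not> g104" "\<not> b12 \<or> \<not> b104"
    "\<not> r12 \<or> \<not> r138" "\<not> g12 \<or> \<not> g138" "\<not> b12 \<or> \<not> b138"
    "\<not> r13 \<or> \<not> r20" "\<not> g13 \<or> \<not> g20" "\<not> b13 \<or> \<not> b20"
    "\<not> r13 \<or> \<not> r33" "\<not> g13 \<or> \<not> g33" "\<not> b13 \<or> \<not> b33"
    "\<not> r13 \<or> \<not> r65" "\<not> g13 \<or> \<not> g65" "\<not> b13 \<or> \<not> b65"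
    "\<not> r13 \<or> \<not> r134" "\<not> g13 \<or> \<not> g134" "\<not> b13 \<or> \<not> b134"
    "\<not> r13 \<or> \<not> r139" "\<not> g13 \<or> \<not> g139" "\<not> b13 \<or> \<not> b139"
    "\<not> r14 \<or> \<not> r29" "\<not> g14 \<or> \<not> g29" "\<not> b14 \<or> \<not> b29"
    "\<not> r14 \<or> \<not> r58" "\<not> g14 \<or> \<not> g58" "\<not> b14 \<or> \<not> b58"
    "\<not> r14 \<or> \<not> r119" "\<not> g14 \<or> \<not> g119" "\<not> b14 \<or> \<not> b119"
    "\<not> r14 \<or> \<not> r122" "\<not> g14 \<or> \<not> g122" "\<not> b14 \<or> \<not> b122"
    "\<not> r14 \<or> \<not> r138" "\<not> g14 \<or> \<not> g138" "\<not> b14 \<or> \<not> b138"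
    "\<not> r15 \<or> \<not> r46" "\<not> g15 \<or> \<not> g46" "\<not> b15 \<or> \<not> b46"
    "\<not> r15 \<or> \<not> r80" "\<not> g15 \<or> \<not> g80" "\<not> b15 \<or> \<not> b80"
    "\<not> r15 \<or> \<not> r99" "\<not> g15 \<or> \<not> g99" "\<not> b15 \<or> \<not> b99"
    "\<not> r15 \<or> \<not> r107" "\<not> g15 \<or> \<not> g107" "\<not> b15 \<or> \<not> b107"
    "\<not> r15 \<or> \<not> r139" "\<not> g15 \<or> \<not> g139" "\<not> b15 \<or> \<not> b139"
    "\<not> r16 \<or> \<not> r25" "\<not> g16 \<or> \<not> g25" "\<not> b16 \<or> \<not> b25"
    "\<not> r16 \<or> \<not> r60" "\<not> g16 \<or> \<not> g60" "\<not> b16 \<or> \<not> b60"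
    "\<not> r16 \<or> \<not> r76" "\<not> g16 \<or> \<not> g76" "\<not> b16 \<or> \<not> b76"
    "\<not> r16 \<or> \<not> r87" "\<not> g16 \<or> \<not> g87" "\<not> b16 \<or> \<not> b87"
    "\<not> r16 \<or> \<not> r140" "\<not> g16 \<or> \<not> g140" "\<not> b16 \<or> \<not> b140"
    "\<not> r17 \<or> \<not> r34" "\<not> g17 \<or> \<not> g34" "\<not> b17 \<or> \<not> b34"
    "\<not> r17 \<or> \<not> r101" "\<not> g17 \<or> \<not> g101" "\<not> b17 \<or> \<not> b101"
    "\<not> r17 \<or> \<not> r133" "\<not> g17 \<or> \<not> g133" "\<not> b17 \<or> \<not> b133"
    "\<not> r17 \<or> \<not> r141" "\<not> g17 \<or> \<not> g141" "\<not> b17 \<or> \<not> b141"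
    "\<not> r18 \<or> \<not> r46" "\<not> g18 \<or> \<not> g46" "\<not> b18 \<or> \<not> b46"
    "\<not> r18 \<or> \<not> r51" "\<not> g18 \<or> \<not> g51" "\<not> b18 \<or> \<not> b51"
    "\<not> r18 \<or> \<not> r110" "\<not> g18 \<or> \<not> g110" "\<not> b18 \<or> \<not> b110"
    "\<not> r18 \<or> \<not> r140" "\<not> g18 \<or> \<not> g140" "\<not> b18 \<or> \<not> b140"
    "\<not> r19 \<or> \<not> r63" "\<not> g19 \<or> \<not> g63" "\<not> b19 \<or> \<not> b63"
    "\<not> r19 \<or> \<not> r71" "\<not> g19 \<or> \<not> g71" "\<not> b19 \<or> \<not> b71"
    "\<not> r19 \<or> \<not> r84" "\<not> g19 \<or> \<not> g84" "\<not> b19 \<or> \<not> b84"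
    "\<not> r19 \<or> \<not> r122" "\<not> g19 \<or> \<not> g122" "\<not> b19 \<or> \<not> b122"
    "\<not> r19 \<or> \<not> r141" "\<not> g19 \<or> \<not> g141" "\<not> b19 \<or> \<not> b141"
    "\<not> r20 \<or> \<not> r91" "\<not> g20 \<or> \<not> g91" "\<not> b20 \<or> \<not> b91"
    "\<not> r20 \<or> \<not> r96" "\<not> g20 \<or> \<not> g96" "\<not> b20 \<or> \<not> b96"
    "\<not> r20 \<or> \<not> r112" "\<not> g20 \<or> \<not> g112" "\<not> b20 \<or> \<not> b112"
    "\<not> r20 \<or> \<not> r140" "\<not> g20 \<or> \<not> g140" "\<not> b20 \<or> \<not> b140"
    "\<not> r21 \<or> \<not> r28" "\<not> g21 \<or> \<not> g28" "\<not> b21 \<or> \<not> b28"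
    "\<not> r21 \<or> \<not> r41" "\<not> g21 \<or> \<not> g41" "\<not> b21 \<or> \<not> b41"
    "\<not> r21 \<or> \<not> r73" "\<not> g21 \<or> \<not> g73" "\<not> b21 \<or> \<not> b73"
    "\<not> r21 \<or> \<not> r141" "\<not> g21 \<or> \<not> g141" "\<not> b21 \<or> \<not> b141"
    "\<not> r22 \<or> \<not> r37" "\<not> g22 \<or> \<not> g37" "\<not> b22 \<or> \<not> b37"
    "\<not> r22 \<or> \<not> r66" "\<not> g22 \<or> \<not> g66" "\<not> b22 \<or> \<not> b66"
    "\<not> r22 \<or> \<not> r127" "\<not> g22 \<or> \<not> g127" "\<not> b22 \<or> \<not> b127"
    "\<not> r22 \<or> \<not> r130" "\<not> g22 \<or> \<not> g130" "\<not> b22 \<or> \<not> b130"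
    "\<not> r22 \<or> \<not> r140" "\<not> g22 \<or> \<not> g140" "\<not> b22 \<or> \<not> b140"
    "\<not> r23 \<or> \<not> r54" "\<not> g23 \<or> \<not> g54" "\<not> b23 \<or> \<not> b54"
    "\<not> r23 \<or> \<not> r88" "\<not> g23 \<or> \<not> g88" "\<not> b23 \<or> \<not> b88"
    "\<not> r23 \<or> \<not> r107" "\<not> g23 \<or> \<not> g107" "\<not> b23 \<or> \<not> b107"
    "\<not> r23 \<or> \<not> r115" "\<not> g23 \<or> \<not> g115" "\<not> b23 \<or> \<not> b115"
    "\<not> r23 \<or> \<not> r141" "\<not> g23 \<or> \<not> g141" "\<not> b23 \<or> \<not> b141"
    "\<not> r24 \<or> \<not> r33" "\<not> g24 \<or> \<not> g33" "\<not> b24 \<or> \<not> b33"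
    "\<not> r24 \<or> \<not> r68" "\<not> g24 \<or> \<not> g68" "\<not> b24 \<or> \<not> b68"
    "\<not> r24 \<or> \<not> r84" "\<not> g24 \<or> \<not> g84" "\<not> b24 \<or> \<not> b84"
    "\<not> r24 \<or> \<not> r95" "\<not> g24 \<or> \<not> g95" "\<not> b24 \<or> \<not> b95"
    "\<not> r24 \<or> \<not> r142" "\<not> g24 \<or> \<not> g142" "\<not> b24 \<or> \<not> b142"
    "\<not> r25 \<or> \<not> r42" "\<not> g25 \<or> \<not> g42" "\<not> b25 \<or> \<not> b42"
    "\<not> r25 \<or> \<not> r109" "\<not> g25 \<or> \<not> g109" "\<not> b25 \<or> \<not> b109"
    "\<not> r25 \<or> \<not> r143" "\<not> g25 \<or> \<not> g143" "\<not> b25 \<or> \<not> b143"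
    "\<not> r26 \<or> \<not> r54" "\<not> g26 \<or> \<not> g54" "\<not> b26 \<or> \<not> b54"
    "\<not> r26 \<or> \<not> r59" "\<not> g26 \<or> \<not> g59" "\<not> b26 \<or> \<not> b59"
    "\<not> r26 \<or> \<not> r118" "\<not> g26 \<or> \<not> g118" "\<not> b26 \<or> \<not> b118"
    "\<not> r26 \<or> \<not> r142" "\<not> g26 \<or> \<not> g142" "\<not> b26 \<or> \<not> b142"
    "\<not> r27 \<or> \<not> r71" "\<not> g27 \<or> \<not> g71" "\<not> b27 \<or> \<not> b71"
    "\<not> r27 \<or> \<not> r79" "\<not> g27 \<or> \<not> g79" "\<not> b27 \<or> \<not> b79"
    "\<not> r27 \<or> \<not> r92" "\<not> g27 \<or> \<not> g92" "\<not> b27 \<or> \<not> b92"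
    "\<not> r27 \<or> \<not> r130" "\<not> g27 \<or> \<not> g130" "\<not> b27 \<or> \<not> b130"
    "\<not> r27 \<or> \<not> r143" "\<not> g27 \<or> \<not> g143" "\<not> b27 \<or> \<not> b143"
    "\<not> r28 \<or> \<not> r99" "\<not> g28 \<or> \<not> g99" "\<not> b28 \<or> \<not> b99"
    "\<not> r28 \<or> \<not> r104" "\<not> g28 \<or> \<not> g104" "\<not> b28 \<or> \<not> b104"
    "\<not> r28 \<or> \<not> r120" "\<not> g28 \<or> \<not> g120" "\<not> b28 \<or> \<not> b120"
    "\<not> r28 \<or> \<not> r142" "\<not> g28 \<or> \<not> g142" "\<not> b28 \<or> \<not> b142"
    "\<not> r29 \<or> \<not> r36" "\<not> g29 \<or> \<not> g36" "\<not> b29 \<or> \<not> b36"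
    "\<not> r29 \<or> \<not> r49" "\<not> g29 \<or> \<not> g49" "\<not> b29 \<or> \<not> b49"
    "\<not> r29 \<or> \<not> r81" "\<not> g29 \<or> \<not> g81" "\<not> b29 \<or> \<not> b81"
    "\<not> r29 \<or> \<not> r143" "\<not> g29 \<or> \<not> g143" "\<not> b29 \<or> \<not> b143"
    "\<not> r30 \<or> \<not> r45" "\<not> g30 \<or> \<not> g45" "\<not> b30 \<or> \<not> b45"
    "\<not> r30 \<or> \<not> r74" "\<not> g30 \<or> \<not> g74" "\<not> b30 \<or> \<not> b74"
    "\<not> r30 \<or> \<not> r135" "\<not> g30 \<or> \<not> g135" "\<not> b30 \<or> \<not> b135"
    "\<not> r30 \<or> \<not> r142" "\<not> g30 \<or> \<not> g142" "\<not> b30 \<or> \<not> b142"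
    "\<not> r31 \<or> \<not> r62" "\<not> g31 \<or> \<not> g62" "\<not> b31 \<or> \<not> b62"
    "\<not> r31 \<or> \<not> r96" "\<not> g31 \<or> \<not> g96" "\<not> b31 \<or> \<not> b96"
    "\<not> r31 \<or> \<not> r115" "\<not> g31 \<or> \<not> g115" "\<not> b31 \<or> \<not> b115"
    "\<not> r31 \<or> \<not> r123" "\<not> g31 \<or> \<not> g123" "\<not> b31 \<or> \<not> b123"
    "\<not> r31 \<or> \<not> r143" "\<not> g31 \<or> \<not> g143" "\<not> b31 \<or> \<not> b143"
    "\<not> r32 \<or> \<not> r41" "\<not> g32 \<or> \<not> g41" "\<not> b32 \<or> \<not> b41"
    "\<not> r32 \<or> \<not> r76" "\<not> g32 \<or> \<not> g76" "\<not> b32 \<or> \<not> b76"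
    "\<not> r32 \<or> \<not> r92" "\<not> g32 \<or> \<not> g92" "\<not> b32 \<or> \<not> b92"
    "\<not> r32 \<or> \<not> r103" "\<not> g32 \<or> \<not> g103" "\<not> b32 \<or> \<not> b103"
    "\<not> r32 \<or> \<not> r144" "\<not> g32 \<or> \<not> g144" "\<not> b32 \<or> \<not> b144"
    "\<not> r33 \<or> \<not> r50" "\<not> g33 \<or> \<not> g50" "\<not> b33 \<or> \<not> b50"
    "\<not> r33 \<or> \<not> r117" "\<not> g33 \<or> \<not> g117" "\<not> b33 \<or> \<not> b117"
    "\<not> r33 \<or> \<not> r145" "\<not> g33 \<or> \<not> g145" "\<not> b33 \<or> \<not> b145"
    "\<not> r34 \<or> \<not> r62" "\<not> g34 \<or> \<not> g62" "\<not> b34 \<or> \<not> b62"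
    "\<not> r34 \<or> \<not> r67" "\<not> g34 \<or> \<not> g67" "\<not> b34 \<or> \<not> b67"
    "\<not> r34 \<or> \<not> r126" "\<not> g34 \<or> \<not> g126" "\<not> b34 \<or> \<not> b126"
    "\<not> r34 \<or> \<not> r144" "\<not> g34 \<or> \<not> g144" "\<not> b34 \<or> \<not> b144"
    "\<not> r35 \<or> \<not> r79" "\<not> g35 \<or> \<not> g79" "\<not> b35 \<or> \<not> b79"
    "\<not> r35 \<or> \<not> r87" "\<not> g35 \<or> \<not> g87" "\<not> b35 \<or> \<not> b87"
    "\<not> r35 \<or> \<not> r100" "\<not> g35 \<or> \<not> g100" "\<not> b35 \<or> \<not> b100"
    "\<not> r35 \<or> \<not> r145" "\<not> g35 \<or> \<not> g145" "\<not> b35 \<or> \<not> b145"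
    "\<not> r36 \<or> \<not> r107" "\<not> g36 \<or> \<not> g107" "\<not> b36 \<or> \<not> b107"
    "\<not> r36 \<or> \<not> r112" "\<not> g36 \<or> \<not> g112" "\<not> b36 \<or> \<not> b112"
    "\<not> r36 \<or> \<not> r128" "\<not> g36 \<or> \<not> g128" "\<not> b36 \<or> \<not> b128"
    "\<not> r36 \<or> \<not> r144" "\<not> g36 \<or> \<not> g144" "\<not> b36 \<or> \<not> b144"
    "\<not> r37 \<or> \<not> r44" "\<not> g37 \<or> \<not> g44" "\<not> b37 \<or> \<not> b44"
    "\<not> r37 \<or> \<not> r57" "\<not> g37 \<or> \<not> g57" "\<not> b37 \<or> \<not> b57"
    "\<not> r37 \<or> \<not> r89" "\<not> g37 \<or> \<not> g89" "\<not> b37 \<or> \<not> b89"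
    "\<not> r37 \<or> \<not> r145" "\<not> g37 \<or> \<not> g145" "\<not> b37 \<or> \<not> b145"
    "\<not> r38 \<or> \<not> r53" "\<not> g38 \<or> \<not> g53" "\<not> b38 \<or> \<not> b53"
    "\<not> r38 \<or> \<not> r82" "\<not> g38 \<or> \<not> g82" "\<not> b38 \<or> \<not> b82"
    "\<not> r38 \<or> \<not> r144" "\<not> g38 \<or> \<not> g144" "\<not> b38 \<or> \<not> b144"
    "\<not> r39 \<or> \<not> r70" "\<not> g39 \<or> \<not> g70" "\<not> b39 \<or> \<not> b70"
    "\<not> r39 \<or> \<not> r104" "\<not> g39 \<or> \<not> g104" "\<not> b39 \<or> \<not> b104"
    "\<not> r39 \<or> \<not> r123" "\<not> g39 \<or> \<not> g123" "\<not> b39 \<or> \<not> b123"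
    "\<not> r39 \<or> \<not> r131" "\<not> g39 \<or> \<not> g131" "\<not> b39 \<or> \<not> b131"
    "\<not> r39 \<or> \<not> r145" "\<not> g39 \<or> \<not> g145" "\<not> b39 \<or> \<not> b145"
    "\<not> r40 \<or> \<not> r49" "\<not> g40 \<or> \<not> g49" "\<not> b40 \<or> \<not> b49"
    "\<not> r40 \<or> \<not> r84" "\<not> g40 \<or> \<not> g84" "\<not> b40 \<or> \<not> b84"
    "\<not> r40 \<or> \<not> r100" "\<not> g40 \<or> \<not> g100" "\<not> b40 \<or> \<not> b100"
    "\<not> r40 \<or> \<not> r111" "\<not> g40 \<or> \<not> g111" "\<not> b40 \<or> \<not> b111"
    "\<not> r40 \<or> \<not> r146" "\<not> g40 \<or> \<not> g146" "\<not> b40 \<or> \<not> b146"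
    "\<not> r41 \<or> \<not> r58" "\<not> g41 \<or> \<not> g58" "\<not> b41 \<or> \<not> b58"
    "\<not> r41 \<or> \<not> r125" "\<not> g41 \<or> \<not> g125" "\<not> b41 \<or> \<not> b125"
    "\<not> r41 \<or> \<not> r147" "\<not> g41 \<or> \<not> g147" "\<not> b41 \<or> \<not> b147"
    "\<not> r42 \<or> \<not> r70" "\<not> g42 \<or> \<not> g70" "\<not> b42 \<or> \<not> b70"
    "\<not> r42 \<or> \<not> r75" "\<not> g42 \<or> \<not> g75" "\<not> b42 \<or> \<not> b75"
    "\<not> r42 \<or> \<not> r134" "\<not> g42 \<or> \<not> g134" "\<not> b42 \<or> \<not> b134"
    "\<not> r42 \<or> \<not> r146" "\<not> g42 \<or> \<not> g146" "\<not> b42 \<or> \<not> b146"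
    "\<not> r43 \<or> \<not> r87" "\<not> g43 \<or> \<not> g87" "\<not> b43 \<or> \<not> b87"
    "\<not> r43 \<or> \<not> r95" "\<not> g43 \<or> \<not> g95" "\<not> b43 \<or> \<not> b95"
    "\<not> r43 \<or> \<not> r108" "\<not> g43 \<or> \<not> g108" "\<not> b43 \<or> \<not> b108"
    "\<not> r43 \<or> \<not> r147" "\<not> g43 \<or> \<not> g147" "\<not> b43 \<or> \<not> b147"
    "\<not> r44 \<or> \<not> r115" "\<not> g44 \<or> \<not> g115" "\<not> b44 \<or> \<not> b115"
    "\<not> r44 \<or> \<not> r120" "\<not> g44 \<or> \<not> g120" "\<not> b44 \<or> \<not> b120"
    "\<not> r44 \<or> \<not> r146" "\<not> g44 \<or> \<not> g146" "\<not> b44 \<or> \<not> b146"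
    "\<not> r45 \<or> \<not> r52" "\<not> g45 \<or> \<not> g52" "\<not> b45 \<or> \<not> b52"
    "\<not> r45 \<or> \<not> r65" "\<not> g45 \<or> \<not> g65" "\<not> b45 \<or> \<not> b65"
    "\<not> r45 \<or> \<not> r97" "\<not> g45 \<or> \<not> g97" "\<not> b45 \<or> \<not> b97"
    "\<not> r45 \<or> \<not> r147" "\<not> g45 \<or> \<not> g147" "\<not> b45 \<or> \<not> b147"
    "\<not> r46 \<or> \<not> r61" "\<not> g46 \<or> \<not> g61" "\<not> b46 \<or> \<not> b61"
    "\<not> r46 \<or> \<not> r90" "\<not> g46 \<or> \<not> g90" "\<not> b46 \<or> \<not> b90"
    "\<not> r46 \<or> \<not> r146" "\<not> g46 \<or> \<not> g146" "\<not> b46 \<or> \<not> b146"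
    "\<not> r47 \<or> \<not> r78" "\<not> g47 \<or> \<not> g78" "\<not> b47 \<or> \<not> b78"
    "\<not> r47 \<or> \<not> r112" "\<not> g47 \<or> \<not> g112" "\<not> b47 \<or> \<not> b112"
    "\<not> r47 \<or> \<not> r131" "\<not> g47 \<or> \<not> g131" "\<not> b47 \<or> \<not> b131"
    "\<not> r47 \<or> \<not> r147" "\<not> g47 \<or> \<not> g147" "\<not> b47 \<or> \<not> b147"
    "\<not> r48 \<or> \<not> r57" "\<not> g48 \<or> \<not> g57" "\<not> b48 \<or> \<not> b57"
    "\<not> r48 \<or> \<not> r92" "\<not> g48 \<or> \<not> g92" "\<not> b48 \<or> \<not> b92"
    "\<not> r48 \<or> \<not> r108" "\<not> g48 \<or> \<not> g108" "\<not> b48 \<or> \<not> b108"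
    "\<not> r48 \<or> \<not> r119" "\<not> g48 \<or> \<not> g119" "\<not> b48 \<or> \<not> b119"
    "\<not> r48 \<or> \<not> r148" "\<not> g48 \<or> \<not> g148" "\<not> b48 \<or> \<not> b148"
    "\<not> r49 \<or> \<not> r66" "\<not> g49 \<or> \<not> g66" "\<not> b49 \<or> \<not> b66"
    "\<not> r49 \<or> \<not> r133" "\<not> g49 \<or> \<not> g133" "\<not> b49 \<or> \<not> b133"
    "\<not> r49 \<or> \<not> r149" "\<not> g49 \<or> \<not> g149" "\<not> b49 \<or> \<not> b149"
    "\<not> r50 \<or> \<not> r78" "\<not> g50 \<or> \<not> g78" "\<not> b50 \<or> \<not> b78"
    "\<not> r50 \<or> \<not> r83" "\<not> g50 \<or> \<not> g83" "\<not> b50 \<or> \<not> b83"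
    "\<not> r50 \<or> \<not> r148" "\<not> g50 \<or> \<not> g148" "\<not> b50 \<or> \<not> b148"
    "\<not> r51 \<or> \<not> r95" "\<not> g51 \<or> \<not> g95" "\<not> b51 \<or> \<not> b95"
    "\<not> r51 \<or> \<not> r103" "\<not> g51 \<or> \<not> g103" "\<not> b51 \<or> \<not> b103"
    "\<not> r51 \<or> \<not> r116" "\<not> g51 \<or> \<not> g116" "\<not> b51 \<or> \<not> b116"
    "\<not> r51 \<or> \<not> r149" "\<not> g51 \<or> \<not> g149" "\<not> b51 \<or> \<not> b149"
    "\<not> r52 \<or> \<not> r123" "\<not> g52 \<or> \<not> g123" "\<not> b52 \<or> \<not> b123"
    "\<not> r52 \<or> \<not> r128" "\<not> g52 \<or> \<not> g128" "\<not> b52 \<or> \<not> b128"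
    "\<not> r52 \<or> \<not> r148" "\<not> g52 \<or> \<not> g148" "\<not> b52 \<or> \<not> b148"
    "\<not> r53 \<or> \<not> r60" "\<not> g53 \<or> \<not> g60" "\<not> b53 \<or> \<not> b60"
    "\<not> r53 \<or> \<not> r73" "\<not> g53 \<or> \<not> g73" "\<not> b53 \<or> \<not> b73"
    "\<not> r53 \<or> \<not> r105" "\<not> g53 \<or> \<not> g105" "\<not> b53 \<or> \<not> b105"
    "\<not> r53 \<or> \<not> r149" "\<not> g53 \<or> \<not> g149" "\<not> b53 \<or> \<not> b149"
    "\<not> r54 \<or> \<not> r69" "\<not> g54 \<or> \<not> g69" "\<not> b54 \<or> \<not> b69"
    "\<not> r54 \<or> \<not> r98" "\<not> g54 \<or> \<not> g98" "\<not> b54 \<or> \<not> b98"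
    "\<not> r54 \<or> \<not> r148" "\<not> g54 \<or> \<not> g148" "\<not> b54 \<or> \<not> b148"
    "\<not> r55 \<or> \<not> r86" "\<not> g55 \<or> \<not> g86" "\<not> b55 \<or> \<not> b86"
    "\<not> r55 \<or> \<not> r120" "\<not> g55 \<or> \<not> g120" "\<not> b55 \<or> \<not> b120"
    "\<not> r55 \<or> \<not> r149" "\<not> g55 \<or> \<not> g149" "\<not> b55 \<or> \<not> b149"
    "\<not> r56 \<or> \<not> r65" "\<not> g56 \<or> \<not> g65" "\<not> b56 \<or> \<not> b65"
    "\<not> r56 \<or> \<not> r100" "\<not> g56 \<or> \<not> g100" "\<not> b56 \<or> \<not> b100"
    "\<not> r56 \<or> \<not> r116" "\<not> g56 \<or> \<not> g116" "\<not> b56 \<or> \<not> b116"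
    "\<not> r56 \<or> \<not> r127" "\<not> g56 \<or> \<not> g127" "\<not> b56 \<or> \<not> b127"
    "\<not> r56 \<or> \<not> r150" "\<not> g56 \<or> \<not> g150" "\<not> b56 \<or> \<not> b150"
    "\<not> r57 \<or> \<not> r74" "\<not> g57 \<or> \<not> g74" "\<not> b57 \<or> \<not> b74"
    "\<not> r57 \<or> \<not> r151" "\<not> g57 \<or> \<not> g151" "\<not> b57 \<or> \<not> b151"
    "\<not> r58 \<or> \<not> r86" "\<not> g58 \<or> \<not> g86" "\<not> b58 \<or> \<not> b86"
    "\<not> r58 \<or> \<not> r91" "\<not> g58 \<or> \<not> g91" "\<not> b58 \<or> \<not> b91"
    "\<not> r58 \<or> \<not> r150" "\<not> g58 \<or> \<not> g150" "\<not> b58 \<or> \<not> b150"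
    "\<not> r59 \<or> \<not> r103" "\<not> g59 \<or> \<not> g103" "\<not> b59 \<or> \<not> b103"
    "\<not> r59 \<or> \<not> r111" "\<not> g59 \<or> \<not> g111" "\<not> b59 \<or> \<not> b111"
    "\<not> r59 \<or> \<not> r124" "\<not> g59 \<or> \<not> g124" "\<not> b59 \<or> \<not> b124"
    "\<not> r59 \<or> \<not> r151" "\<not> g59 \<or> \<not> g151" "\<not> b59 \<or> \<not> b151"
    "\<not> r60 \<or> \<not> r131" "\<not> g60 \<or> \<not> g131" "\<not> b60 \<or> \<not> b131"
    "\<not> r60 \<or> \<not> r150" "\<not> g60 \<or> \<not> g150" "\<not> b60 \<or> \<not> b150"
    "\<not> r61 \<or> \<not> r68" "\<not> g61 \<or> \<not> g68" "\<not> b61 \<or> \<not> b68"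
    "\<not> r61 \<or> \<not> r81" "\<not> g61 \<or> \<not> g81" "\<not> b61 \<or> \<not> b81"
    "\<not> r61 \<or> \<not> r113" "\<not> g61 \<or> \<not> g113" "\<not> b61 \<or> \<not> b113"
    "\<not> r61 \<or> \<not> r151" "\<not> g61 \<or> \<not> g151" "\<not> b61 \<or> \<not> b151"
    "\<not> r62 \<or> \<not> r77" "\<not> g62 \<or> \<not> g77" "\<not> b62 \<or> \<not> b77"
    "\<not> r62 \<or> \<not> r106" "\<not> g62 \<or> \<not> g106" "\<not> b62 \<or> \<not> b106"
    "\<not> r62 \<or> \<not> r150" "\<not> g62 \<or> \<not> g150" "\<not> b62 \<or> \<not> b150"
    "\<not> r63 \<or> \<not> r94" "\<not> g63 \<or> \<not> g94" "\<not> b63 \<or> \<not> b94"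
    "\<not> r63 \<or> \<not> r128" "\<not> g63 \<or> \<not> g128" "\<not> b63 \<or> \<not> b128"
    "\<not> r63 \<or> \<not> r151" "\<not> g63 \<or> \<not> g151" "\<not> b63 \<or> \<not> b151"
    "\<not> r64 \<or> \<not> r73" "\<not> g64 \<or> \<not> g73" "\<not> b64 \<or> \<not> b73"
    "\<not> r64 \<or> \<not> r108" "\<not> g64 \<or> \<not> g108" "\<not> b64 \<or> \<not> b108"
    "\<not> r64 \<or> \<not> r124" "\<not> g64 \<or> \<not> g124" "\<not> b64 \<or> \<not> b124"
    "\<not> r64 \<or> \<not> r135" "\<not> g64 \<or> \<not> g135" "\<not> b64 \<or> \<not> b135"
    "\<not> r64 \<or> \<not> r152" "\<not> g64 \<or> \<not> g152" "\<not> b64 \<or> \<not> b152"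
    "\<not> r65 \<or> \<not> r82" "\<not> g65 \<or> \<not> g82" "\<not> b65 \<or> \<not> b82"
    "\<not> r65 \<or> \<not> r153" "\<not> g65 \<or> \<not> g153" "\<not> b65 \<or> \<not> b153"
    "\<not> r66 \<or> \<not> r94" "\<not> g66 \<or> \<not> g94" "\<not> b66 \<or> \<not> b94"
    "\<not> r66 \<or> \<not> r99" "\<not> g66 \<or> \<not> g99" "\<not> b66 \<or> \<not> b99"
    "\<not> r66 \<or> \<not> r152" "\<not> g66 \<or> \<not> g152" "\<not> b66 \<or> \<not> b152"
    "\<not> r67 \<or> \<not> r111" "\<not> g67 \<or> \<not> g111" "\<not> b67 \<or> \<not> b111"
    "\<not> r67 \<or> \<not> r119" "\<not> g67 \<or> \<not> g119" "\<not> b67 \<or> \<not> b119"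
    "\<not> r67 \<or> \<not> r132" "\<not> g67 \<or> \<not> g132" "\<not> b67 \<or> \<not> b132"
    "\<not> r67 \<or> \<not> r153" "\<not> g67 \<or> \<not> g153" "\<not> b67 \<or> \<not> b153"
    "\<not> r68 \<or> \<not> r152" "\<not> g68 \<or> \<not> g152" "\<not> b68 \<or> \<not> b152"
    "\<not> r69 \<or> \<not> r76" "\<not> g69 \<or> \<not> g76" "\<not> b69 \<or> \<not> b76"
    "\<not> r69 \<or> \<not> r89" "\<not> g69 \<or> \<not> g89" "\<not> b69 \<or> \<not> b89"
    "\<not> r69 \<or> \<not> r121" "\<not> g69 \<or> \<not> g121" "\<not> b69 \<or> \<not> b121"
    "\<not> r69 \<or> \<not> r153" "\<not> g69 \<or> \<not> g153" "\<not> b69 \<or> \<not> b153"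
    "\<not> r70 \<or> \<not> r85" "\<not> g70 \<or> \<not> g85" "\<not> b70 \<or> \<not> b85"
    "\<not> r70 \<or> \<not> r114" "\<not> g70 \<or> \<not> g114" "\<not> b70 \<or> \<not> b114"
    "\<not> r70 \<or> \<not> r152" "\<not> g70 \<or> \<not> g152" "\<not> b70 \<or> \<not> b152"
    "\<not> r71 \<or> \<not> r102" "\<not> g71 \<or> \<not> g102" "\<not> b71 \<or> \<not> b102"
    "\<not> r71 \<or> \<not> r153" "\<not> g71 \<or> \<not> g153" "\<not> b71 \<or> \<not> b153"
    "\<not> r72 \<or> \<not> r81" "\<not> g72 \<or> \<not> g81" "\<not> b72 \<or> \<not> b81"
    "\<not> r72 \<or> \<not> r116" "\<not> g72 \<or> \<not> g116" "\<not> b72 \<or> \<not> b116"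
    "\<not> r72 \<or> \<not> r132" "\<not> g72 \<or> \<not> g132" "\<not> b72 \<or> \<not> b132"
    "\<not> r72 \<or> \<not> r154" "\<not> g72 \<or> \<not> g154" "\<not> b72 \<or> \<not> b154"
    "\<not> r73 \<or> \<not> r90" "\<not> g73 \<or> \<not> g90" "\<not> b73 \<or> \<not> b90"
    "\<not> r73 \<or> \<not> r155" "\<not> g73 \<or> \<not> g155" "\<not> b73 \<or> \<not> b155"
    "\<not> r74 \<or> \<not> r102" "\<not> g74 \<or> \<not> g102" "\<not> b74 \<or> \<not> b102"
    "\<not> r74 \<or> \<not> r107" "\<not> g74 \<or> \<not> g107" "\<not> b74 \<or> \<not> b107"
    "\<not> r74 \<or> \<not> r154" "\<not> g74 \<or> \<not> g154" "\<not> b74 \<or> \<not> b154"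
    "\<not> r75 \<or> \<not> r119" "\<not> g75 \<or> \<not> g119" "\<not> b75 \<or> \<not> b119"
    "\<not> r75 \<or> \<not> r127" "\<not> g75 \<or> \<not> g127" "\<not> b75 \<or> \<not> b127"
    "\<not> r75 \<or> \<not> r155" "\<not> g75 \<or> \<not> g155" "\<not> b75 \<or> \<not> b155"
    "\<not> r76 \<or> \<not> r154" "\<not> g76 \<or> \<not> g154" "\<not> b76 \<or> \<not> b154"
    "\<not> r77 \<or> \<not> r84" "\<not> g77 \<or> \<not> g84" "\<not> b77 \<or> \<not> b84"
    "\<not> r77 \<or> \<not> r97" "\<not> g77 \<or> \<not> g97" "\<not> b77 \<or> \<not> b97"
    "\<not> r77 \<or> \<not> r129" "\<not> g77 \<or> \<not> g129" "\<not> b77 \<or> \<not> b129"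
    "\<not> r77 \<or> \<not> r155" "\<not> g77 \<or> \<not> g155" "\<not> b77 \<or> \<not> b155"
    "\<not> r78 \<or> \<not> r93" "\<not> g78 \<or> \<not> g93" "\<not> b78 \<or> \<not> b93"
    "\<not> r78 \<or> \<not> r122" "\<not> g78 \<or> \<not> g122" "\<not> b78 \<or> \<not> b122"
    "\<not> r78 \<or> \<not> r154" "\<not> g78 \<or> \<not> g154" "\<not> b78 \<or> \<not> b154"
    "\<not> r79 \<or> \<not> r110" "\<not> g79 \<or> \<not> g110" "\<not> b79 \<or> \<not> b110"
    "\<not> r79 \<or> \<not> r155" "\<not> g79 \<or> \<not> g155" "\<not> b79 \<or> \<not> b155"
    "\<not> r80 \<or> \<not> r89" "\<not> g80 \<or> \<not> g89" "\<not> b80 \<or> \<not> b89"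
    "\<not> r80 \<or> \<not> r124" "\<not> g80 \<or> \<not> g124" "\<not> b80 \<or> \<not> b124"
    "\<not> r80 \<or> \<not> r156" "\<not> g80 \<or> \<not> g156" "\<not> b80 \<or> \<not> b156"
    "\<not> r81 \<or> \<not> r98" "\<not> g81 \<or> \<not> g98" "\<not> b81 \<or> \<not> b98"
    "\<not> r81 \<or> \<not> r157" "\<not> g81 \<or> \<not> g157" "\<not> b81 \<or> \<not> b157"
    "\<not> r82 \<or> \<not> r110" "\<not> g82 \<or> \<not> g110" "\<not> b82 \<or> \<not> b110"
    "\<not> r82 \<or> \<not> r115" "\<not> g82 \<or> \<not> g115" "\<not> b82 \<or> \<not> b115"
    "\<not> r82 \<or> \<not> r156" "\<not> g82 \<or> \<not> g156" "\<not> b82 \<or> \<not> b156"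
    "\<not> r83 \<or> \<not> r127" "\<not> g83 \<or> \<not> g127" "\<not> b83 \<or> \<not> b127"
    "\<not> r83 \<or> \<not> r135" "\<not> g83 \<or> \<not> g135" "\<not> b83 \<or> \<not> b135"
    "\<not> r83 \<or> \<not> r157" "\<not> g83 \<or> \<not> g157" "\<not> b83 \<or> \<not> b157"
    "\<not> r84 \<or> \<not> r156" "\<not> g84 \<or> \<not> g156" "\<not> b84 \<or> \<not> b156"
    "\<not> r85 \<or> \<not> r92" "\<not> g85 \<or> \<not> g92" "\<not> b85 \<or> \<not> b92"
    "\<not> r85 \<or> \<not> r105" "\<not> g85 \<or> \<not> g105" "\<not> b85 \<or> \<not> b105"
    "\<not> r85 \<or> \<not> r157" "\<not> g85 \<or> \<not> g157" "\<not> b85 \<or> \<not> b157"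
    "\<not> r86 \<or> \<not> r101" "\<not> g86 \<or> \<not> g101" "\<not> b86 \<or> \<not> b101"
    "\<not> r86 \<or> \<not> r130" "\<not> g86 \<or> \<not> g130" "\<not> b86 \<or> \<not> b130"
    "\<not> r86 \<or> \<not> r156" "\<not> g86 \<or> \<not> g156" "\<not> b86 \<or> \<not> b156"
    "\<not> r87 \<or> \<not> r118" "\<not> g87 \<or> \<not> g118" "\<not> b87 \<or> \<not> b118"
    "\<not> r87 \<or> \<not> r157" "\<not> g87 \<or> \<not> g157" "\<not> b87 \<or> \<not> b157"
    "\<not> r88 \<or> \<not> r97" "\<not> g88 \<or> \<not> g97" "\<not> b88 \<or> \<not> b97"
    "\<not> r88 \<or> \<not> r132" "\<not> g88 \<or> \<not> g132" "\<not> b88 \<or> \<not> b132"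
    "\<not> r88 \<or> \<not> r158" "\<not> g88 \<or> \<not> g158" "\<not> b88 \<or> \<not> b158"
    "\<not> r89 \<or> \<not> r106" "\<not> g89 \<or> \<not> g106" "\<not> b89 \<or> \<not> b106"
    "\<not> r89 \<or> \<not> r159" "\<not> g89 \<or> \<not> g159" "\<not> b89 \<or> \<not> b159"
    "\<not> r90 \<or> \<not> r118" "\<not> g90 \<or> \<not> g118" "\<not> b90 \<or> \<not> b118"
    "\<not> r90 \<or> \<not> r123" "\<not> g90 \<or> \<not> g123" "\<not> b90 \<or> \<not> b123"
    "\<not> r90 \<or> \<not> r158" "\<not> g90 \<or> \<not> g158" "\<not> b90 \<or> \<not> b158"
    "\<not> r91 \<or> \<not> r135" "\<not> g91 \<or> \<not> g135" "\<not> b91 \<or> \<not> b135"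
    "\<not> r91 \<or> \<not> r159" "\<not> g91 \<or> \<not> g159" "\<not> b91 \<or> \<not> b159"
    "\<not> r92 \<or> \<not> r158" "\<not> g92 \<or> \<not> g158" "\<not> b92 \<or> \<not> b158"
    "\<not> r93 \<or> \<not> r100" "\<not> g93 \<or> \<not> g100" "\<not> b93 \<or> \<not> b100"
    "\<not> r93 \<or> \<not> r113" "\<not> g93 \<or> \<not> g113" "\<not> b93 \<or> \<not> b113"
    "\<not> r93 \<or> \<not> r159" "\<not> g93 \<or> \<not> g159" "\<not> b93 \<or> \<not> b159"
    "\<not> r94 \<or> \<not> r109" "\<not> g94 \<or> \<not> g109" "\<not> b94 \<or> \<not> b109"
    "\<not> r94 \<or> \<not> r158" "\<not> g94 \<or> \<not> g158" "\<not> b94 \<or> \<not> b158"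
    "\<not> r95 \<or> \<not> r126" "\<not> g95 \<or> \<not> g126" "\<not> b95 \<or> \<not> b126"
    "\<not> r95 \<or> \<not> r159" "\<not> g95 \<or> \<not> g159" "\<not> b95 \<or> \<not> b159"
    "\<not> r96 \<or> \<not> r105" "\<not> g96 \<or> \<not> g105" "\<not> b96 \<or> \<not> b105"
    "\<not> r96 \<or> \<not> r160" "\<not> g96 \<or> \<not> g160" "\<not> b96 \<or> \<not> b160"
    "\<not> r97 \<or> \<not> r114" "\<not> g97 \<or> \<not> g114" "\<not> b97 \<or> \<not> b114"
    "\<not> r97 \<or> \<not> r161" "\<not> g97 \<or> \<not> g161" "\<not> b97 \<or> \<not> b161"
    "\<not> r98 \<or> \<not> r126" "\<not> g98 \<or> \<not> g126" "\<not> b98 \<or> \<not> b126"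
    "\<not> r98 \<or> \<not> r131" "\<not> g98 \<or> \<not> g131" "\<not> b98 \<or> \<not> b131"
    "\<not> r98 \<or> \<not> r160" "\<not> g98 \<or> \<not> g160" "\<not> b98 \<or> \<not> b160"
    "\<not> r99 \<or> \<not> r161" "\<not> g99 \<or> \<not> g161" "\<not> b99 \<or> \<not> b161"
    "\<not> r100 \<or> \<not> r160" "\<not> g100 \<or> \<not> g160"
    "\<not> b100 \<or> \<not> b160" "\<not> r101 \<or> \<not> r108"
    "\<not> g101 \<or> \<not> g108" "\<not> b101 \<or> \<not> b108"
    "\<not> r101 \<or> \<not> r121" "\<not> g101 \<or> \<not> g121"
    "\<not> b101 \<or> \<not> b121" "\<not> r101 \<or> \<not> r161"
    "\<not> g101 \<or> \<not> g161" "\<not> b101 \<or> \<not> b161"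
    "\<not> r102 \<or> \<not> r117" "\<not> g102 \<or> \<not> g117"
    "\<not> b102 \<or> \<not> b117" "\<not> r102 \<or> \<not> r160"
    "\<not> g102 \<or> \<not> g160" "\<not> b102 \<or> \<not> b160"
    "\<not> r103 \<or> \<not> r134" "\<not> g103 \<or> \<not> g134"
    "\<not> b103 \<or> \<not> b134" "\<not> r103 \<or> \<not> r161"
    "\<not> g103 \<or> \<not> g161" "\<not> b103 \<or> \<not> b161"
    "\<not> r104 \<or> \<not> r113" "\<not> g104 \<or> \<not> g113"
    "\<not> b104 \<or> \<not> b113" "\<not> r104 \<or> \<not> r162"
    "\<not> g104 \<or> \<not> g162" "\<not> b104 \<or> \<not> b162"
    "\<not> r105 \<or> \<not> r122" "\<not> g105 \<or> \<not> g122"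
    "\<not> b105 \<or> \<not> b122" "\<not> r105 \<or> \<not> r163"
    "\<not> g105 \<or> \<not> g163" "\<not> b105 \<or> \<not> b163"
    "\<not> r106 \<or> \<not> r134" "\<not> g106 \<or> \<not> g134"
    "\<not> b106 \<or> \<not> b134" "\<not> r106 \<or> \<not> r162"
    "\<not> g106 \<or> \<not> g162" "\<not> b106 \<or> \<not> b162"
    "\<not> r107 \<or> \<not> r163" "\<not> g107 \<or> \<not> g163"
    "\<not> b107 \<or> \<not> b163" "\<not> r108 \<or> \<not> r162"
    "\<not> g108 \<or> \<not> g162" "\<not> b108 \<or> \<not> b162"
    "\<not> r109 \<or> \<not> r116" "\<not> g109 \<or> \<not> g116"
    "\<not> b109 \<or> \<not> b116" "\<not> r109 \<or> \<not> r129"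
    "\<not> g109 \<or> \<not> g129" "\<not> b109 \<or> \<not> b129"
    "\<not> r109 \<or> \<not> r163" "\<not> g109 \<or> \<not> g163"
    "\<not> b109 \<or> \<not> b163" "\<not> r110 \<or> \<not> r125"
    "\<not> g110 \<or> \<not> g125" "\<not> b110 \<or> \<not> b125"
    "\<not> r110 \<or> \<not> r162" "\<not> g110 \<or> \<not> g162"
    "\<not> b110 \<or> \<not> b162" "\<not> r111 \<or> \<not> r163"
    "\<not> g111 \<or> \<not> g163" "\<not> b111 \<or> \<not> b163"
    "\<not> r112 \<or> \<not> r121" "\<not> g112 \<or> \<not> g121"
    "\<not> b112 \<or> \<not> b121" "\<not> r112 \<or> \<not> r164"
    "\<not> g112 \<or> \<not> g164" "\<not> b112 \<or> \<not> b164"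
    "\<not> r113 \<or> \<not> r130" "\<not> g113 \<or> \<not> g130"
    "\<not> b113 \<or> \<not> b130" "\<not> r113 \<or> \<not> r165"
    "\<not> g113 \<or> \<not> g165" "\<not> b113 \<or> \<not> b165"
    "\<not> r114 \<or> \<not> r164" "\<not> g114 \<or> \<not> g164"
    "\<not> b114 \<or> \<not> b164" "\<not> r115 \<or> \<not> r165"
    "\<not> g115 \<or> \<not> g165" "\<not> b115 \<or> \<not> b165"
    "\<not> r116 \<or> \<not> r164" "\<not> g116 \<or> \<not> g164"
    "\<not> b116 \<or> \<not> b164" "\<not> r117 \<or> \<not> r124"
    "\<not> g117 \<or> \<not> g124" "\<not> b117 \<or> \<not> b124"
    "\<not> r117 \<or> \<not> r165" "\<not> g117 \<or> \<not> g165"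
    "\<not> b117 \<or> \<not> b165" "\<not> r118 \<or> \<not> r133"
    "\<not> g118 \<or> \<not> g133" "\<not> b118 \<or> \<not> b133"
    "\<not> r118 \<or> \<not> r164" "\<not> g118 \<or> \<not> g164"
    "\<not> b118 \<or> \<not> b164" "\<not> r119 \<or> \<not> r165"
    "\<not> g119 \<or> \<not> g165" "\<not> b119 \<or> \<not> b165"
    "\<not> r120 \<or> \<not> r129" "\<not> g120 \<or> \<not> g129"
    "\<not> b120 \<or> \<not> b129" "\<not> r120 \<or> \<not> r166"
    "\<not> g120 \<or> \<not> g166" "\<not> b120 \<or> \<not> b166"
    "\<not> r121 \<or> \<not> r167" "\<not> g121 \<or> \<not> g167"
    "\<not> b121 \<or> \<not> b167" "\<not> r122 \<or> \<not> r166"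
    "\<not> g122 \<or> \<not> g166" "\<not> b122 \<or> \<not> b166"
    "\<not> r123 \<or> \<not> r167" "\<not> g123 \<or> \<not> g167"
    "\<not> b123 \<or> \<not> b167" "\<not> r124 \<or> \<not> r166"
    "\<not> g124 \<or> \<not> g166" "\<not> b124 \<or> \<not> b166"
    "\<not> r125 \<or> \<not> r132" "\<not> g125 \<or> \<not> g132"
    "\<not> b125 \<or> \<not> b132" "\<not> r125 \<or> \<not> r167"
    "\<not> g125 \<or> \<not> g167" "\<not> b125 \<or> \<not> b167"
    "\<not> r126 \<or> \<not> r166" "\<not> g126 \<or> \<not> g166"
    "\<not> b126 \<or> \<not> b166" "\<not> r127 \<or> \<not> r167"
    "\<not> g127 \<or> \<not> g167" "\<not> b127 \<or> \<not> b167"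
    "\<not> r128 \<or> \<not> r168" "\<not> g128 \<or> \<not> g168"
    "\<not> b128 \<or> \<not> b168" "\<not> r129 \<or> \<not> r169"
    "\<not> g129 \<or> \<not> g169" "\<not> b129 \<or> \<not> b169"
    "\<not> r130 \<or> \<not> r168" "\<not> g130 \<or> \<not> g168"
    "\<not> b130 \<or> \<not> b168" "\<not> r131 \<or> \<not> r169"
    "\<not> g131 \<or> \<not> g169" "\<not> b131 \<or> \<not> b169"
    "\<not> r132 \<or> \<not> r168" "\<not> g132 \<or> \<not> g168"
    "\<not> b132 \<or> \<not> b168" "\<not> r133 \<or> \<not> r169"
    "\<not> g133 \<or> \<not> g169" "\<not> b133 \<or> \<not> b169"
    "\<not> r134 \<or> \<not> r168" "\<not> g134 \<or> \<not> g168"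
    "\<not> b134 \<or> \<not> b168" "\<not> r135 \<or> \<not> r169"
    "\<not> g135 \<or> \<not> g169" "\<not> b135 \<or> \<not> b169"
    "\<not> r136 \<or> \<not> r137" "\<not> g136 \<or> \<not> g137"
    "\<not> b136 \<or> \<not> b137" "\<not> r138 \<or> \<not> r139"
    "\<not> g138 \<or> \<not> g139" "\<not> b138 \<or> \<not> b139"
    "\<not> r140 \<or> \<not> r141" "\<not> g140 \<or> \<not> g141"
    "\<not> b140 \<or> \<not> b141" "\<not> r142 \<or> \<not> r143"
    "\<not> g142 \<or> \<not> g143" "\<not> b142 \<or> \<not> b143"
    "\<not> r144 \<or> \<not> r145" "\<not> g144 \<or> \<not> g145"
    "\<not> b144 \<or> \<not> b145" "\<not> r146 \<or> \<not> r147"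
    "\<not> g146 \<or> \<not> g147" "\<not> b146 \<or> \<not> b147"
    "\<not> r148 \<or> \<not> r149" "\<not> g148 \<or> \<not> g149"
    "\<not> b148 \<or> \<not> b149" "\<not> r150 \<or> \<not> r151"
    "\<not> g150 \<or> \<not> g151" "\<not> b150 \<or> \<not> b151"
    "\<not> r152 \<or> \<not> r153" "\<not> g152 \<or> \<not> g153"
    "\<not> b152 \<or> \<not> b153" "\<not> r154 \<or> \<not> r155"
    "\<not> g154 \<or> \<not> g155" "\<not> b154 \<or> \<not> b155"
    "\<not> r156 \<or> \<not> r157" "\<not> g156 \<or> \<not> g157"
    "\<not> b156 \<or> \<not> b157" "\<not> r158 \<or> \<not> r159"
    "\<not> g158 \<or> \<not> g159" "\<not> b158 \<or> \<not> b159"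
    "\<not> r160 \<or> \<not> r161" "\<not> g160 \<or> \<not> g161"
    "\<not> b160 \<or> \<not> b161" "\<not> r162 \<or> \<not> r163"
    "\<not> g162 \<or> \<not> g163" "\<not> b162 \<or> \<not> b163"
    "\<not> r164 \<or> \<not> r165" "\<not> g164 \<or> \<not> g165"
    "\<not> b164 \<or> \<not> b165" "\<not> r166 \<or> \<not> r167"
    "\<not> g166 \<or> \<not> g167" "\<not> b166 \<or> \<not> b167"
    "\<not> r168 \<or> \<not> r169" "\<not> g168 \<or> \<not> g169"
    "\<not> b168 \<or> \<not> b169"

text \<open>
  The number in the name is the binary word, with the bit of leaf 0 as least significant bit.
\<close>

declare [[argo_timeout = 200]]

section \<open>Words with at least four cyclically consecutive leaves free of colour 2\<close>

text \<open>The hypotheses determine the colours of the whole double star: a leaf without colour 2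
  must take the remaining colour that its centre leaves free. Here all even leaves get colour 1 and
  all odd leaves colour 0.\<close>

lemma (in three_coloured) pattern0:
  "r136 \<Longrightarrow> g137 \<Longrightarrow> \<not> b0 \<Longrightarrow> \<not> b1 \<Longrightarrow> \<not> b2 \<Longrightarrow> \<not> b3 \<Longrightarrow> \<not> b4 \<Longrightarrow> \<not> b5 \<Longrightarrow> \<not> b6 \<Longrightarrow> \<not> b7 \<Longrightarrow> False"
  \<comment> \<open>A binary decision tree in depth-first order: \<open>cases\<close> splits the
    current branch on one literal, and \<open>argo E\<close> closes a branch by propositional
    reasoning from the 1445 clauses, one for each of the 170 vertices and three for each of the 425
    edges. In all these trees the root is a neighbour of one of the leaves 0 to 7, so that two
    colours remain for it: leaf 3 has colour 0 here, and \<open>g47\<close> decides between 1 and 2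
    for its neighbour 47.\<close>
  by (cases g47, cases r60, cases g16, cases r42, cases g70, cases r50, argo E, argo E, argo E,
      cases r44, cases r35, argo E, argo E, cases r70, argo E, argo E, cases r42, cases g70,
      argo E, cases g11, argo E, argo E, cases r39, argo E, argo E, cases r16, cases r50,
      cases g12, cases g18, argo E, argo E, cases r112, cases r96, argo E, argo E, argo E,
      cases g98, cases r96, argo E, argo E, cases g72, argo E, argo E, cases r50, cases g33,
      cases r35, argo E, argo E, cases r145, argo E, argo E, cases g72, argo E, cases g98,
      argo E, argo E, cases r60, cases g16, cases r35, cases g38, cases r43, argo E, argo E,
      argo E, cases g85, cases r39, argo E, argo E, cases r50, argo E, argo E, cases r133,
      cases r42, cases g70, cases r87, argo E, argo E, argo E, cases g38, argo E, argo E,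
      cases r42, argo E, cases r87, argo E, argo E, cases r78, cases g72, cases r74, cases r16,
      cases r11, argo E, argo E, argo E, cases r16, cases r71, argo E, argo E, argo E, cases r75,
      cases r53, argo E, argo E, cases r83, cases g91, argo E, argo E, cases r88, argo E, argo E,
      cases r154, cases r9, cases g57, cases g26, argo E, cases r102, argo E, argo E, cases r71,
      cases r100, argo E, argo E, cases g10, cases r150, argo E, argo E, argo E, cases r30,
      cases r35, cases g79, cases r53, cases g85, argo E, argo E, argo E, cases r110, argo E,
      argo E, cases r16, argo E, argo E, cases r71, argo E, cases g10, argo E, argo E, cases r53,
      cases r16, cases r11, cases r9, argo E, argo E, argo E, cases r9, argo E, argo E,
      cases r96, argo E, argo E)

text \<open>Each rotation class is represented by its least number. Except for the zero word that
  number is odd, since an even one is halved by a rotation; so leaf 0 has colour 2 from here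
  on.\<close>

lemma (in three_coloured) pattern1:
  "r136 \<Longrightarrow> g137 \<Longrightarrow> b0 \<Longrightarrow> \<not> b1 \<Longrightarrow> \<not> b2 \<Longrightarrow> \<not> b3 \<Longrightarrow> \<not> b4 \<Longrightarrow> \<not> b5 \<Longrightarrow> \<not> b6 \<Longrightarrow> \<not> b7 \<Longrightarrow> False"
  by (cases g47, cases r50, cases r112, cases g36, cases g20, cases g33, argo E, argo E,
      cases g33, argo E, argo E, cases g20, cases r9, argo E, argo E, cases g33, argo E, argo E,
      cases g33, cases r71, argo E, cases r9, argo E, argo E, cases g12, cases r9, argo E,
      argo E, cases g91, argo E, argo E, cases g72, cases r74, cases r83, cases g102, argo E,
      argo E, cases g102, cases r112, argo E, argo E, argo E, cases g117, cases r80, cases r59,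
      argo E, argo E, argo E, cases r48, argo E, argo E, cases r30, cases r112, cases g20,
      argo E, argo E, cases r116, argo E, argo E, cases g102, cases r112, argo E, argo E,
      cases r83, argo E, argo E, cases r60, cases r133, cases g91, cases g12, argo E, cases r20,
      argo E, argo E, cases g16, cases r109, argo E, cases r20, argo E, argo E, cases r94,
      argo E, argo E, cases g38, cases g16, cases r49, argo E, argo E, argo E, cases r21,
      cases r90, argo E, argo E, cases g16, argo E, argo E, cases r112, cases r16, cases g18,
      cases r135, cases g98, argo E, argo E, argo E, cases r21, argo E, argo E, cases r94,
      argo E, cases g20, argo E, argo E, cases g25, cases r42, cases r94, cases g63, argo E,
      argo E, argo E, cases r114, argo E, cases r94, argo E, argo E, cases r20, cases g98,
      cases r114, argo E, cases g102, argo E, argo E, cases r31, argo E, argo E, cases g85,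
      argo E, argo E)

text \<open>With two leaves of colour 2 the class is determined by their cyclic distance: 1 here, 2
  for 5, 3 for 9 and 4 for 17.\<close>

lemma (in three_coloured) pattern3:
  "r136 \<Longrightarrow> g137 \<Longrightarrow> b0 \<Longrightarrow> b1 \<Longrightarrow> \<not> b2 \<Longrightarrow> \<not> b3 \<Longrightarrow> \<not> b4 \<Longrightarrow> \<not> b5 \<Longrightarrow> \<not> b6 \<Longrightarrow> \<not> b7 \<Longrightarrow> False"
  \<comment> \<open>Both kinds of initial split occur. Leaf 5 has colour 0, so \<open>g12\<close>
    decides between 1 and 2 for its neighbour 12; leaf 0 has colour 2, so \<open>r9\<close> decides
    between 0 and 1 for its neighbour 9.\<close>
  by (cases g12, cases r9, cases g139, cases r15, cases g46, cases r117, cases r11, cases r50,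
      argo E, argo E, argo E, cases g26, argo E, argo E, cases r50, cases r117, argo E, argo E,
      cases r11, argo E, argo E, cases r21, cases g89, argo E, argo E, cases r11, cases r39,
      argo E, argo E, argo E, cases r80, cases g8, cases r66, argo E, argo E, cases g10, argo E,
      argo E, cases g10, cases r50, argo E, argo E, cases r71, argo E, argo E, cases r35,
      cases r138, cases r50, cases r85, argo E, argo E, cases g91, argo E, argo E, cases r10,
      cases g11, cases g43, cases r44, argo E, argo E, argo E, cases g43, argo E, argo E,
      cases r50, argo E, cases g87, argo E, argo E, cases r138, cases r50, cases g47, argo E,
      argo E, cases g91, argo E, argo E, cases g11, cases r50, argo E, cases g91, argo E, argo E,
      cases g15, cases r50, argo E, argo E, argo E, cases r18, cases g46, cases r50, cases r15,
      cases g47, cases r9, argo E, argo E, cases r30, argo E, cases r154, argo E, argo E,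
      cases g47, argo E, argo E, cases r33, cases r15, cases r61, cases g57, argo E, argo E,
      cases r104, argo E, argo E, cases r9, argo E, argo E, cases r15, cases r35, argo E, argo E,
      cases g89, argo E, argo E, cases r83, cases r33, cases r80, argo E, cases g64, argo E,
      argo E, cases g91, argo E, cases r20, argo E, argo E, cases r44, cases g55, argo E,
      cases r21, argo E, argo E, cases g25, argo E, cases r16, cases r85, argo E, argo E, argo E,
      cases r44, cases g37, cases g55, cases r35, argo E, argo E, cases r35, argo E, argo E,
      cases r46, cases g15, cases r22, argo E, argo E, argo E, cases g55, cases r28, argo E,
      argo E, argo E, cases r46, cases g15, cases r28, argo E, cases r42, argo E, argo E,
      cases r9, argo E, argo E, cases g25, cases r94, argo E, argo E, cases g47, cases r70,
      argo E, argo E, argo E)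

lemma (in three_coloured) pattern5:
  "r136 \<Longrightarrow> g137 \<Longrightarrow> b0 \<Longrightarrow> \<not> b1 \<Longrightarrow> b2 \<Longrightarrow> \<not> b3 \<Longrightarrow> \<not> b4 \<Longrightarrow> \<not> b5 \<Longrightarrow> \<not> b6 \<Longrightarrow> \<not> b7 \<Longrightarrow> False"
  by (cases g12, cases r9, cases r138, cases r50, cases g10, cases r30, argo E, cases r74,
      argo E, argo E, cases g47, cases g33, argo E, argo E, cases r71, argo E, argo E, cases r78,
      cases g14, cases g85, argo E, cases r75, argo E, argo E, cases g85, argo E, argo E,
      cases r60, argo E, argo E, cases r10, cases r50, cases g47, argo E, argo E, cases g102,
      cases r30, argo E, argo E, argo E, cases r50, cases g47, argo E, argo E, cases r11,
      cases r102, argo E, argo E, argo E, cases r26, cases r50, cases g33, cases g47, argo E,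
      cases r13, argo E, argo E, cases r138, cases g10, argo E, argo E, argo E, cases g91,
      cases r93, argo E, cases r35, argo E, argo E, cases g85, argo E, cases r138, argo E,
      argo E, cases r138, cases r50, cases r30, argo E, cases g28, argo E, argo E, cases g8,
      argo E, cases r52, argo E, argo E, cases g15, cases r66, argo E, argo E, argo E, cases g18,
      cases r46, cases g15, cases r66, cases g61, argo E, argo E, cases g90, argo E, argo E,
      cases r21, cases r9, argo E, argo E, cases g89, argo E, argo E, cases r83, cases g85,
      cases r61, argo E, argo E, cases r81, argo E, cases r44, argo E, argo E, cases r135,
      cases r44, cases g37, argo E, cases r42, argo E, argo E, cases g25, argo E, cases r94,
      argo E, argo E, cases r44, cases r42, argo E, argo E, cases g47, cases r20, argo E, argo E,
      argo E, cases r44, cases g37, cases r80, cases g117, argo E, argo E, cases r15, cases r30,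
      argo E, argo E, argo E, cases r22, cases g66, argo E, argo E, cases g16, argo E, cases r46,
      argo E, argo E, cases r83, cases g91, cases r37, cases r20, argo E, argo E, argo E,
      cases r20, argo E, cases r112, argo E, argo E, cases r75, cases r121, argo E, cases r22,
      argo E, argo E, cases r42, cases g70, cases g91, argo E, argo E, argo E, cases r94, argo E,
      argo E)

text \<open>With three leaves of colour 2 the class is given by the cyclic sequence of gaps: 1, 1, 6
  here; 1, 2, 5 for 11; 2, 1, 5 for 13; 1, 3, 4 for 19; 2, 2, 4 for 21; 3, 1, 4 for 25; 2, 3, 3 for
  37.\<close>

lemma (in three_coloured) pattern7:
  "r136 \<Longrightarrow> g137 \<Longrightarrow> b0 \<Longrightarrow> b1 \<Longrightarrow> b2 \<Longrightarrow> \<not> b3 \<Longrightarrow> \<not> b4 \<Longrightarrow> \<not> b5 \<Longrightarrow> \<not> b6 \<Longrightarrow> \<not> b7 \<Longrightarrow> False"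
  by (cases g47, cases r50, cases r121, cases g12, cases r30, argo E, cases r74, argo E, argo E,
      cases g91, cases r85, argo E, cases r14, argo E, argo E, cases r9, argo E, cases r80,
      argo E, argo E, cases r9, cases g12, cases r85, cases r80, argo E, argo E, cases r30,
      argo E, argo E, cases r75, cases g25, argo E, argo E, argo E, cases g33, cases g91, argo E,
      argo E, cases r125, cases g12, argo E, argo E, cases r35, cases g12, argo E, argo E,
      argo E, cases r83, cases r75, cases g72, cases g57, argo E, cases r21, cases r53, argo E,
      argo E, argo E, cases g91, cases r33, argo E, argo E, argo E, cases r33, cases g72,
      cases r30, argo E, argo E, argo E, cases g91, cases r13, argo E, argo E, argo E, cases g72,
      cases r81, cases r33, argo E, cases r30, argo E, argo E, cases r70, argo E, argo E,
      cases r33, cases r75, argo E, argo E, cases g102, argo E, argo E, cases r60, cases r112,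
      cases g20, cases r30, cases g16, cases r69, argo E, argo E, argo E, cases g16, argo E,
      argo E, cases g16, argo E, cases r35, cases g38, argo E, argo E, argo E, cases g16,
      cases r20, cases g38, argo E, argo E, argo E, cases r20, cases r85, argo E, argo E,
      cases g38, argo E, argo E, cases r16, cases r53, cases g98, cases r96, cases g20, argo E,
      argo E, cases g87, argo E, argo E, cases g55, cases r11, argo E, argo E, cases r44, argo E,
      argo E, cases r112, cases g20, cases r30, argo E, argo E, argo E, cases g69, argo E,
      cases r11, argo E, argo E, cases r42, cases g39, cases r18, argo E, argo E, cases r35,
      argo E, cases g38, argo E, argo E, cases r70, argo E, cases r35, argo E, argo E)

lemma (in three_coloured) pattern9:
  "r136 \<Longrightarrow> g137 \<Longrightarrow> b0 \<Longrightarrow> \<not> b1 \<Longrightarrow> \<not> b2 \<Longrightarrow> b3 \<Longrightarrow> \<not> b4 \<Longrightarrow> \<not> b5 \<Longrightarrow> \<not> b6 \<Longrightarrow> \<not> b7 \<Longrightarrow> False"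
  by (cases r44, cases g12, cases g120, cases r50, cases g33, cases r21, argo E, cases r113,
      argo E, argo E, argo E, cases r21, argo E, cases g91, argo E, argo E, cases g37, cases r50,
      cases r35, cases r106, argo E, argo E, cases r28, argo E, cases r30, argo E, argo E,
      cases r30, cases r35, argo E, argo E, cases r28, argo E, argo E, cases r50, cases g33,
      argo E, argo E, cases r89, cases r124, argo E, argo E, cases r33, argo E, argo E,
      cases r83, cases g37, cases r80, cases g91, argo E, cases g117, argo E, argo E, cases g91,
      argo E, argo E, cases r89, cases g91, argo E, cases g85, argo E, argo E, cases r47, argo E,
      argo E, cases g37, cases r80, cases g15, cases r35, argo E, argo E, argo E, cases r22,
      argo E, cases r48, argo E, argo E, cases r30, cases r20, cases r22, argo E, argo E, argo E,
      cases r75, cases g25, argo E, argo E, cases r66, argo E, argo E, cases g18, cases g12,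
      cases r55, cases r50, cases g33, cases r46, argo E, argo E, cases g148, argo E, argo E,
      cases g85, cases r47, argo E, argo E, argo E, cases r11, cases r50, cases r46, argo E,
      argo E, cases g85, argo E, argo E, cases r9, cases r15, argo E, argo E, cases r8, argo E,
      argo E, cases r21, cases g28, cases r30, cases r9, argo E, argo E, cases r83, argo E,
      argo E, cases r15, argo E, argo E, cases r46, cases r28, cases r42, argo E, argo E,
      cases r41, argo E, argo E, cases r73, cases r94, argo E, argo E, cases g25, argo E, argo E,
      cases r146, cases g25, cases r94, cases r51, argo E, argo E, cases r15, argo E, argo E,
      cases r16, cases r22, argo E, argo E, cases r70, argo E, argo E, cases r55, cases r47,
      cases g25, cases r21, argo E, argo E, cases r16, argo E, argo E, cases g99, argo E,
      cases g25, cases r112, argo E, argo E, cases r16, argo E, argo E, cases r11, cases r42,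
      cases r47, cases r30, argo E, argo E, argo E, cases r47, argo E, argo E, cases r47,
      cases r42, cases g112, argo E, argo E, argo E, cases r75, argo E, cases r112, argo E,
      argo E)

lemma (in three_coloured) pattern11:
  "r136 \<Longrightarrow> g137 \<Longrightarrow> b0 \<Longrightarrow> b1 \<Longrightarrow> \<not> b2 \<Longrightarrow> b3 \<Longrightarrow> \<not> b4 \<Longrightarrow> \<not> b5 \<Longrightarrow> \<not> b6 \<Longrightarrow> \<not> b7 \<Longrightarrow> False"
  by (cases r30, cases g25, cases r94, cases g66, cases r49, cases r42, cases g70, argo E,
      argo E, cases g40, argo E, argo E, cases g91, argo E, argo E, cases r15, cases g57, argo E,
      argo E, cases r21, argo E, cases r18, argo E, argo E, cases g57, cases r63, cases g72,
      argo E, argo E, cases r11, argo E, argo E, cases r63, cases r37, argo E, argo E, cases r11,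
      cases r37, argo E, argo E, argo E, cases r16, cases g91, cases g57, cases r20, cases r58,
      argo E, argo E, argo E, cases g140, cases r83, argo E, argo E, argo E, cases r50,
      cases r85, argo E, cases r53, argo E, argo E, cases r47, argo E, argo E, cases r35,
      cases g91, cases r83, argo E, argo E, cases r50, cases g57, argo E, argo E, argo E,
      cases g57, cases r154, cases r71, argo E, argo E, cases r50, argo E, argo E, cases r37,
      argo E, argo E, cases r135, cases g57, cases g12, cases g72, cases r81, argo E, cases g131,
      argo E, argo E, cases r81, argo E, cases r61, argo E, argo E, cases r75, cases g72, argo E,
      argo E, cases r155, cases g22, cases r66, argo E, argo E, argo E, argo E, cases g12,
      cases r85, cases r37, cases r80, argo E, argo E, cases r80, argo E, argo E, cases r70,
      cases g64, argo E, argo E, cases g72, argo E, cases r37, argo E, argo E, cases g169,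
      cases r75, cases r22, argo E, argo E, cases r37, cases r55, argo E, argo E, argo E,
      cases r75, cases r22, argo E, argo E, cases r48, argo E, argo E, cases r50, cases r133,
      cases r85, cases r35, argo E, argo E, argo E, cases g33, cases r35, cases r85, argo E,
      argo E, argo E, cases r24, argo E, cases r85, argo E, argo E, cases r133, cases r47,
      argo E, cases g72, argo E, argo E, cases r20, cases r85, cases r60, argo E, cases r98,
      argo E, argo E, cases g112, argo E, argo E, cases r13, cases r112, argo E, argo E,
      cases r112, cases r45, argo E, argo E, cases r118, argo E, argo E)

text \<open>The mirror image of the word 11. Rotations do not include the reversal of a word, so
  both members of each of the six mirror pairs 11 and 13, 19 and 25, 23 and 29, 43 and 53, 47 and
  61, 55 and 59 are refuted separately.\<close>

lemma (in three_coloured) pattern13: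
  "r136 \<Longrightarrow> g137 \<Longrightarrow> b0 \<Longrightarrow> \<not> b1 \<Longrightarrow> b2 \<Longrightarrow> b3 \<Longrightarrow> \<not> b4 \<Longrightarrow> \<not> b5 \<Longrightarrow> \<not> b6 \<Longrightarrow> \<not> b7 \<Longrightarrow> False"
  by (cases r47, cases g18, cases g25, cases r16, cases r20, cases r98, cases r42, argo E,
      argo E, cases g99, argo E, argo E, cases r42, argo E, argo E, cases r96, cases r35,
      cases r42, argo E, argo E, cases r42, argo E, argo E, cases r35, cases r42, argo E, argo E,
      argo E, cases r94, cases r51, cases g63, argo E, cases g66, argo E, argo E, cases g112,
      argo E, cases r111, argo E, argo E, cases r51, cases r16, cases r66, argo E, argo E,
      cases g38, argo E, cases g95, argo E, argo E, cases r55, argo E, argo E, cases g25,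
      cases r42, cases g146, cases g70, argo E, argo E, cases r16, cases r21, argo E, argo E,
      cases r35, cases r21, argo E, cases r73, argo E, argo E, cases r21, argo E, argo E,
      cases r44, cases g15, cases r40, argo E, argo E, argo E, cases r70, cases g39, argo E,
      argo E, cases r15, argo E, argo E, cases r16, cases r20, cases r53, argo E, argo E,
      cases g69, argo E, argo E, cases g38, cases r105, argo E, argo E, cases r21, argo E,
      argo E, cases r50, cases g33, cases g12, cases g91, cases g57, cases r24, argo E, argo E,
      argo E, cases r24, cases r9, argo E, argo E, cases r30, argo E, argo E, cases r75,
      cases r9, argo E, argo E, cases r71, argo E, argo E, cases r24, cases r80, cases g12,
      argo E, argo E, argo E, cases r80, cases g15, cases r122, argo E, argo E, argo E,
      cases g12, argo E, cases r35, argo E, argo E, cases r83, cases r30, cases g57, cases r71,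
      cases r75, argo E, argo E, argo E, cases g117, cases r80, argo E, argo E, argo E,
      cases g85, cases r20, argo E, argo E, cases r20, cases g72, cases g102, argo E, argo E,
      argo E, argo E, cases r30, cases r20, cases g18, argo E, argo E, argo E, cases g72,
      cases r81, argo E, cases g102, cases r45, argo E, argo E, argo E, cases r75, argo E,
      cases r88, argo E, argo E)

text \<open>Colour 2 occurs on exactly half of the leaves. This happens in ten classes, namely those
  of 15, 23, 27, 29, 39, 43, 45, 51, 53 and 85.\<close>

lemma (in three_coloured) pattern15:
  "r136 \<Longrightarrow> g137 \<Longrightarrow> b0 \<Longrightarrow> b1 \<Longrightarrow> b2 \<Longrightarrow> b3 \<Longrightarrow> \<not> b4 \<Longrightarrow> \<not> b5 \<Longrightarrow> \<not> b6 \<Longrightarrow> \<not> b7 \<Longrightarrow> False"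
  by (cases r47, cases g131, cases r133, cases g16, cases g38, cases r94, argo E, argo E,
      cases r10, argo E, argo E, cases r18, cases r30, argo E, cases r35, argo E, argo E,
      cases g20, argo E, argo E, cases g91, cases r83, cases g16, argo E, argo E, cases r75,
      argo E, cases g16, argo E, argo E, cases g38, cases r85, argo E, argo E, cases r96, argo E,
      argo E, cases g112, cases r98, cases g72, cases r114, cases g54, argo E, argo E, argo E,
      cases g54, cases r20, argo E, argo E, cases g78, argo E, argo E, cases r20, cases r114,
      cases g97, argo E, argo E, cases r39, argo E, argo E, cases r35, cases r18, argo E, argo E,
      argo E, cases r98, cases g72, cases r29, cases r96, argo E, argo E, cases r61, argo E,
      argo E, cases g78, cases r96, argo E, cases r85, argo E, argo E, cases r116, cases g12,
      argo E, argo E, argo E, cases g91, cases r85, cases g99, argo E, argo E, cases r81,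
      cases r35, argo E, argo E, argo E, cases r30, cases r36, argo E, argo E, cases r36,
      cases r45, argo E, argo E, argo E, cases r131, cases g98, cases r96, cases g20, cases r30,
      argo E, argo E, cases r50, argo E, argo E, cases r50, cases r85, cases r117, argo E,
      argo E, argo E, cases g93, cases g91, argo E, argo E, argo E, cases r50, cases g33,
      cases r9, argo E, cases g91, argo E, argo E, cases r35, cases g12, argo E, argo E,
      cases r16, cases r81, argo E, argo E, argo E, cases g72, cases r30, argo E, argo E,
      cases r33, argo E, argo E, cases r50, cases g12, cases r9, cases r104, argo E, cases r106,
      argo E, argo E, cases r138, argo E, argo E, cases r39, cases r9, cases g33, argo E, argo E,
      argo E, cases r145, cases r9, argo E, argo E, argo E, cases g93, cases g91, cases r20,
      cases r98, cases g13, argo E, argo E, cases r33, argo E, argo E, cases r13, argo E, argo E,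
      cases r30, argo E, argo E, cases r83, cases g91, cases r20, cases g95, argo E, argo E,
      cases r13, argo E, argo E, cases g57, argo E, argo E, cases g91, cases r20, argo E, argo E,
      cases r33, argo E, argo E)

section \<open>Words whose longest cyclic run of leaves free of colour 2 has length three\<close>

text \<open>The two leaves of colour 2 are opposite each other, so the word has period 4 and its
  class has four members instead of eight.\<close>

lemma (in three_coloured) pattern17:
  "r136 \<Longrightarrow> g137 \<Longrightarrow> b0 \<Longrightarrow> \<not> b1 \<Longrightarrow> \<not> b2 \<Longrightarrow> \<not> b3 \<Longrightarrow> b4 \<Longrightarrow> \<not> b5 \<Longrightarrow> \<not> b6 \<Longrightarrow> \<not> b7 \<Longrightarrow> False"
  by (cases g47, cases r50, cases g33, cases r9, cases r80, cases g15, argo E, argo E, argo E,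
      cases r80, argo E, cases r13, argo E, argo E, cases g12, cases r9, argo E, cases g91,
      argo E, argo E, cases r24, cases g95, cases r9, argo E, argo E, argo E, cases r9, argo E,
      argo E, cases r112, cases g20, cases g85, argo E, argo E, cases r13, cases r71, argo E,
      argo E, cases g36, argo E, cases g24, argo E, argo E, cases r33, cases r20, cases g72,
      cases r30, argo E, cases g18, argo E, argo E, cases r116, cases g25, argo E, argo E,
      argo E, cases r83, argo E, argo E, cases r20, cases r71, argo E, argo E, argo E, cases r60,
      cases r112, cases r96, cases g16, cases r35, cases g38, argo E, argo E, argo E, cases g38,
      argo E, argo E, cases g16, cases g38, argo E, argo E, cases r31, argo E, argo E,
      cases r114, cases g11, cases g16, argo E, argo E, cases g70, argo E, argo E, cases g72,
      cases r109, cases r11, argo E, argo E, argo E, cases r78, argo E, argo E, cases r112,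
      cases g36, cases r96, cases g98, cases r29, argo E, argo E, cases g85, argo E, argo E,
      cases r16, argo E, argo E, cases g169, cases r63, argo E, argo E, cases g20, argo E,
      argo E, cases r114, cases g39, cases g11, argo E, argo E, cases r96, argo E, argo E,
      cases r96, cases r16, argo E, argo E, cases r53, cases g55, argo E, argo E, cases g72,
      argo E, argo E)

lemma (in three_coloured) pattern19:
  "r136 \<Longrightarrow> g137 \<Longrightarrow> b0 \<Longrightarrow> b1 \<Longrightarrow> \<not> b2 \<Longrightarrow> \<not> b3 \<Longrightarrow> b4 \<Longrightarrow> \<not> b5 \<Longrightarrow> \<not> b6 \<Longrightarrow> \<not> b7 \<Longrightarrow> False"
  by (cases g47, cases r50, cases r9, cases g91, cases r30, cases r20, argo E, cases g57, argo E,
      argo E, cases r20, cases r35, argo E, argo E, cases r18, cases r74, argo E, argo E, argo E,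
      cases g12, cases g89, argo E, argo E, cases r112, argo E, argo E, cases g91, cases r20,
      cases g13, cases r80, argo E, argo E, argo E, cases g12, argo E, cases r69, argo E, argo E,
      cases r135, cases r74, cases r131, argo E, argo E, cases g106, argo E, argo E, argo E,
      cases r112, cases g20, cases g105, cases r19, cases r102, argo E, argo E, argo E,
      cases r83, cases r53, cases g55, argo E, argo E, argo E, argo E, cases r13, cases g72,
      argo E, argo E, cases r9, argo E, argo E, cases g72, cases r20, cases r75, cases r21,
      argo E, argo E, cases r36, argo E, argo E, cases g105, argo E, cases r83, argo E, argo E,
      cases r33, cases r30, argo E, cases r20, argo E, argo E, cases r30, argo E, cases r116,
      argo E, argo E, cases r78, cases r33, cases g72, cases g57, cases g24, argo E, argo E,
      cases r60, cases r37, argo E, argo E, cases g39, argo E, argo E, cases r30, argo E,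
      cases r83, argo E, argo E, cases r35, cases g93, cases g72, argo E, argo E, cases g102,
      argo E, argo E, cases g38, cases g37, argo E, argo E, cases g37, argo E, cases r80, argo E,
      argo E, cases r112, cases g20, cases g105, cases g38, cases g36, cases r60, argo E, argo E,
      cases g34, argo E, argo E, argo E, cases g126, argo E, cases r53, argo E, argo E,
      cases r93, cases r18, argo E, argo E, cases g95, cases g89, argo E, cases r166, argo E,
      argo E, cases r122, argo E, argo E, cases g72, cases r114, cases g25, cases r42, argo E,
      argo E, argo E, cases r109, cases r36, argo E, cases r11, cases r19, argo E, argo E,
      argo E, argo E, cases r114, cases g57, argo E, cases g11, argo E, argo E, cases r94,
      cases r70, argo E, argo E, cases r11, argo E, argo E)

text \<open>Colour 2 is confined to even leaves, which forces colour 0 on all four odd ones. The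
  words 0, 1, 5, 17 and 85 share this feature.\<close>

lemma (in three_coloured) pattern21:
  "r136 \<Longrightarrow> g137 \<Longrightarrow> b0 \<Longrightarrow> \<not> b1 \<Longrightarrow> b2 \<Longrightarrow> \<not> b3 \<Longrightarrow> b4 \<Longrightarrow> \<not> b5 \<Longrightarrow> \<not> b6 \<Longrightarrow> \<not> b7 \<Longrightarrow> False"
  by (cases g38, cases r9, cases g18, cases r82, cases r21, cases g73, cases r46, argo E, argo E,
      argo E, cases g58, cases r20, argo E, argo E, cases g47, argo E, argo E, cases g106,
      cases r44, cases r80, argo E, argo E, cases r80, argo E, argo E, cases r80, argo E,
      cases r15, argo E, argo E, cases g125, cases g106, cases r44, cases g37, argo E, argo E,
      cases r37, cases r69, argo E, argo E, argo E, cases r80, argo E, argo E, cases r121,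
      cases g47, cases r20, cases r50, argo E, argo E, argo E, cases r114, argo E, argo E,
      cases r21, cases r32, cases r35, argo E, argo E, argo E, cases r53, argo E, cases r96,
      argo E, argo E, cases r35, cases r93, cases g145, cases g117, cases g47, cases r10, argo E,
      argo E, cases r112, argo E, argo E, argo E, cases g117, argo E, cases g47, argo E, argo E,
      cases r96, cases g20, argo E, argo E, cases r53, cases g55, argo E, argo E, cases g91,
      cases r50, argo E, argo E, cases g47, argo E, argo E, cases r144, cases r33, cases g34,
      cases g36, argo E, argo E, cases g24, argo E, argo E, cases r37, argo E, argo E, cases g33,
      cases r71, cases r80, argo E, argo E, argo E, cases g37, argo E, argo E, cases g25,
      cases r53, cases g85, cases r42, cases g11, argo E, cases r9, argo E, argo E, cases r44,
      cases r40, argo E, argo E, cases g47, argo E, argo E, cases g55, cases g20, argo E, argo E,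
      cases r109, argo E, argo E, cases r21, cases r75, cases r105, argo E, argo E, cases g47,
      cases g72, argo E, argo E, cases g72, argo E, argo E, cases r35, cases r42, argo E, argo E,
      cases g85, argo E, argo E, cases r94, cases g63, cases r16, argo E, cases r105, argo E,
      argo E, cases r16, cases g85, argo E, argo E, cases g55, argo E, argo E, cases r16,
      cases g55, argo E, cases g85, argo E, argo E, cases g72, cases g55, argo E, argo E, argo E)

lemma (in three_coloured) pattern23:
  "r136 \<Longrightarrow> g137 \<Longrightarrow> b0 \<Longrightarrow> b1 \<Longrightarrow> b2 \<Longrightarrow> \<not> b3 \<Longrightarrow> b4 \<Longrightarrow> \<not> b5 \<Longrightarrow> \<not> b6 \<Longrightarrow> \<not> b7 \<Longrightarrow> False"
  by (cases g12, cases r50, cases g33, cases g47, cases r30, argo E, cases r154, argo E, argo E,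
      cases r75, argo E, cases r112, argo E, argo E, cases r35, cases r39, cases r30, argo E,
      argo E, cases g28, argo E, argo E, cases g37, cases r75, argo E, argo E, cases r22, argo E,
      cases r85, argo E, argo E, cases r75, cases g91, cases r20, cases g47, cases g72, argo E,
      argo E, argo E, cases g25, cases r70, argo E, cases r112, argo E, argo E, cases r70,
      argo E, argo E, cases r33, cases r64, argo E, cases r20, argo E, argo E, cases g57, argo E,
      argo E, cases r42, cases g91, cases r33, argo E, cases r121, argo E, argo E, cases g106,
      argo E, argo E, cases g91, cases r44, argo E, argo E, cases r20, argo E, argo E, cases g25,
      cases r42, cases r83, cases g91, cases r133, argo E, argo E, cases r33, argo E, argo E,
      cases r16, cases g70, cases r80, argo E, argo E, cases g11, argo E, argo E, cases g70,
      cases r35, cases g106, cases r135, argo E, argo E, argo E, cases r18, cases r79, argo E,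
      argo E, argo E, cases r18, argo E, argo E, cases r70, cases r44, cases r40, cases g68,
      argo E, argo E, cases g55, argo E, argo E, cases r88, cases g47, argo E, argo E, cases g99,
      argo E, argo E, cases g157, cases g91, argo E, cases r20, argo E, argo E, cases r35,
      cases g145, cases r44, argo E, cases g40, argo E, argo E, cases g47, argo E, argo E,
      cases r44, cases g37, argo E, argo E, cases g43, argo E, argo E, cases r83, cases r94,
      cases g66, cases g91, argo E, argo E, cases r33, argo E, argo E, cases r16, cases r42,
      argo E, argo E, cases g47, argo E, argo E, cases r94, cases r16, cases g87, cases r111,
      argo E, argo E, argo E, cases g38, argo E, argo E, cases g72, cases r42, argo E, cases r16,
      argo E, argo E, cases r16, argo E, argo E)

lemma (in three_coloured) pattern25:
  "r136 \<Longrightarrow> g137 \<Longrightarrow> b0 \<Longrightarrow> \<not> b1 \<Longrightarrow> \<not> b2 \<Longrightarrow> b3 \<Longrightarrow> b4 \<Longrightarrow> \<not> b5 \<Longrightarrow> \<not> b6 \<Longrightarrow> \<not> b7 \<Longrightarrow> False"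
  by (cases g38, cases r9, cases g26, cases r53, cases g85, cases r30, cases r24, argo E, argo E,
      cases g25, argo E, argo E, cases r59, argo E, argo E, cases r55, cases r50, argo E,
      cases g11, argo E, argo E, cases r59, argo E, cases g18, argo E, argo E, cases r118,
      cases g87, cases r10, cases g12, argo E, argo E, cases g25, cases g95, cases r94, argo E,
      argo E, argo E, cases r131, argo E, argo E, cases g93, argo E, cases r47, argo E, argo E,
      cases r35, cases r114, argo E, cases g72, argo E, argo E, cases r114, cases g70, argo E,
      argo E, argo E, cases r53, cases r131, cases g98, cases g85, cases r50, argo E, argo E,
      argo E, argo E, cases g85, cases r70, cases r11, argo E, cases r35, argo E, argo E,
      cases r133, cases g25, argo E, argo E, cases r26, argo E, argo E, cases g20, argo E,
      cases r16, argo E, argo E, cases r21, cases r96, cases r55, argo E, cases r11, argo E,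
      argo E, cases r20, cases g18, argo E, argo E, argo E, cases r55, cases r96, cases g20,
      cases r13, argo E, argo E, cases r47, argo E, argo E, cases r20, cases g18, cases r82,
      argo E, argo E, argo E, argo E, cases r11, cases g18, argo E, argo E, cases r28, cases r96,
      argo E, argo E, argo E, cases r30, cases r10, cases g57, cases g91, cases r64, argo E,
      argo E, cases g12, argo E, argo E, cases r33, cases r35, cases r96, argo E, argo E, argo E,
      argo E, cases r53, cases g57, cases g85, argo E, argo E, cases g85, cases r37, argo E,
      cases r70, argo E, argo E, argo E, cases g16, cases r35, argo E, argo E, cases r21, argo E,
      argo E, cases r10, cases r135, cases g129, cases g102, argo E, cases g12, argo E, argo E,
      cases g12, argo E, cases r53, argo E, argo E, cases r20, cases r53, argo E, argo E,
      cases g102, argo E, argo E, cases r135, cases r102, cases r53, cases g85, argo E, argo E,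
      cases g131, argo E, argo E, cases r33, cases r96, argo E, argo E, cases r144, argo E,
      argo E, cases r102, cases r50, argo E, argo E, cases r33, argo E, argo E)

lemma (in three_coloured) pattern27:
  "r136 \<Longrightarrow> g137 \<Longrightarrow> b0 \<Longrightarrow> b1 \<Longrightarrow> \<not> b2 \<Longrightarrow> b3 \<Longrightarrow> b4 \<Longrightarrow> \<not> b5 \<Longrightarrow> \<not> b6 \<Longrightarrow> \<not> b7 \<Longrightarrow> False"
  by (cases r35, cases r47, cases r60, cases g38, cases g16, cases r85, argo E, argo E,
      cases r94, argo E, argo E, cases g16, cases r42, argo E, argo E, cases r94, cases r21,
      argo E, argo E, cases g72, argo E, argo E, cases r53, cases r50, cases g33, cases r37,
      cases r120, argo E, argo E, cases g148, argo E, argo E, cases g148, argo E, argo E,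
      cases r122, cases r93, cases g91, argo E, argo E, argo E, argo E, cases r85, cases g20,
      argo E, argo E, cases g78, argo E, argo E, cases r50, cases g33, cases g12, cases r9,
      argo E, argo E, cases r9, argo E, argo E, cases r9, cases r24, argo E, argo E, cases r24,
      argo E, argo E, cases g93, cases g72, cases r33, cases r112, argo E, argo E, argo E,
      cases r30, argo E, cases r56, argo E, argo E, cases r112, cases g20, argo E, argo E,
      cases g72, cases r56, argo E, argo E, cases r116, argo E, argo E, cases g25, cases r60,
      cases r94, cases g38, cases r85, argo E, argo E, cases r18, cases r21, argo E, cases g46,
      argo E, argo E, cases g22, argo E, argo E, cases r63, cases g72, argo E, cases r114,
      argo E, argo E, cases r11, argo E, cases r42, argo E, argo E, cases r47, cases r50,
      cases r94, cases r39, cases r85, argo E, argo E, argo E, cases g12, argo E, argo E,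
      cases r94, cases r33, argo E, argo E, argo E, cases r50, cases r9, cases g33, argo E,
      cases g12, argo E, cases r112, argo E, argo E, cases r56, argo E, argo E, cases r94,
      cases r33, cases r37, argo E, argo E, cases g37, argo E, argo E, cases g72, cases r56,
      argo E, argo E, argo E, cases r16, cases r109, cases r42, cases r114, argo E, argo E,
      cases r70, argo E, argo E, cases r47, cases r111, argo E, cases r40, argo E, argo E,
      cases r111, cases r85, argo E, argo E, cases r50, argo E, argo E, cases g38, cases r85,
      cases r42, cases g20, argo E, argo E, argo E, cases r70, argo E, argo E, cases r144,
      cases g34, cases r33, argo E, argo E, argo E, cases r42, argo E, argo E)

lemma (in three_coloured) pattern29:
  "r136 \<Longrightarrow> g137 \<Longrightarrow> b0 \<Longrightarrow> \<not> b1 \<Longrightarrow> b2 \<Longrightarrow> b3 \<Longrightarrow> b4 \<Longrightarrow> \<not> b5 \<Longrightarrow> \<not> b6 \<Longrightarrow> \<not> b7 \<Longrightarrow> False"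
  by (cases r30, cases g57, cases r37, cases g91, cases r159, cases r71, argo E, cases g10,
      argo E, cases g95, argo E, argo E, argo E, cases r50, cases g33, argo E, argo E, cases r71,
      cases r47, argo E, argo E, cases g10, argo E, argo E, cases r71, cases g91, argo E,
      cases r33, argo E, argo E, cases g10, cases r80, cases g91, argo E, argo E, cases r35,
      argo E, argo E, cases r80, cases r35, argo E, argo E, cases g91, argo E, argo E, cases g91,
      cases r71, cases r96, argo E, cases g98, cases r33, argo E, argo E, argo E, cases r50,
      cases g33, cases r64, argo E, argo E, cases r35, argo E, argo E, cases r47, cases r19,
      argo E, cases g85, argo E, argo E, cases r75, argo E, argo E, cases r50, cases r102,
      cases g10, argo E, cases g33, argo E, argo E, argo E, cases r102, cases g10, argo E,
      cases r48, argo E, argo E, cases r20, argo E, argo E, cases g25, cases r42, cases g70,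
      cases r96, cases r142, argo E, cases r24, argo E, argo E, cases r31, cases g28, argo E,
      argo E, cases g38, argo E, argo E, cases r142, cases g28, cases r66, argo E, argo E,
      cases r31, argo E, argo E, cases r28, argo E, argo E, cases r16, cases r142, cases r31,
      cases r106, argo E, argo E, argo E, cases r44, cases g37, argo E, argo E, argo E,
      cases r70, cases r11, cases r94, argo E, argo E, cases r44, argo E, cases g18, argo E,
      argo E, cases r44, cases r35, argo E, argo E, cases r35, cases g18, argo E, argo E, argo E,
      cases r94, cases r16, cases r111, cases r53, argo E, argo E, cases g18, argo E, argo E,
      cases r111, cases g66, argo E, argo E, cases g66, argo E, argo E, cases r66, cases r16,
      cases g18, argo E, argo E, cases r42, cases g70, argo E, argo E, cases g72, argo E, argo E,
      cases r21, cases r44, argo E, argo E, cases g120, argo E, argo E)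

text \<open>The three leaves without colour 2 are consecutive. In general the words with five leaves
  of colour 2 are, up to rotation, the complements of those with three, hence again seven classes:
  31, 47, 55, 59, 61, 87 and 91.\<close>

lemma (in three_coloured) pattern31:
  "r136 \<Longrightarrow> g137 \<Longrightarrow> b0 \<Longrightarrow> b1 \<Longrightarrow> b2 \<Longrightarrow> b3 \<Longrightarrow> b4 \<Longrightarrow> \<not> b5 \<Longrightarrow> \<not> b6 \<Longrightarrow> \<not> b7 \<Longrightarrow> False"
  by (cases g25, cases r94, cases g72, cases g63, cases r11, cases r70, argo E, argo E,
      cases g66, cases r9, argo E, argo E, cases r42, argo E, argo E, cases r114, cases r16,
      argo E, cases r18, argo E, argo E, cases g66, cases r70, cases r97, argo E, argo E,
      cases r19, argo E, cases r21, argo E, argo E, cases r68, argo E, argo E, cases g66,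
      cases g63, cases r11, cases r70, argo E, argo E, cases r76, argo E, argo E, cases r19,
      cases r152, cases r15, argo E, argo E, cases g67, argo E, argo E, cases r15, cases r21,
      argo E, argo E, cases r21, argo E, argo E, cases r49, cases r21, cases r44, argo E, argo E,
      cases r111, argo E, argo E, cases r40, cases r42, argo E, argo E, argo E, cases r42,
      cases r16, cases r85, cases r53, cases r44, cases g37, argo E, cases r63, argo E, argo E,
      cases r47, argo E, argo E, cases g20, argo E, argo E, cases r68, cases r92, argo E, argo E,
      argo E, cases g70, cases r35, cases r18, argo E, cases r66, cases g20, argo E, argo E,
      argo E, cases r18, argo E, argo E, cases r68, cases g11, cases r18, argo E, argo E,
      cases r9, argo E, argo E, argo E, cases r16, cases r44, cases g37, cases r46, argo E,
      argo E, cases r80, argo E, argo E, cases r131, cases r50, argo E, argo E, cases r39,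
      cases g87, argo E, argo E, cases r37, argo E, argo E, cases r106, cases r44, cases r70,
      argo E, argo E, cases r18, cases r13, argo E, argo E, cases r70, argo E, argo E, cases r44,
      cases r18, argo E, argo E, cases r35, argo E, cases r18, argo E, argo E, cases r16,
      cases r18, cases g87, cases r94, cases r111, argo E, cases g79, argo E, argo E, cases r42,
      argo E, cases g51, argo E, argo E, cases r118, cases r94, cases g66, argo E, argo E,
      argo E, cases r85, argo E, argo E, cases r42, cases g146, cases r20, argo E, argo E,
      cases g15, argo E, cases r94, argo E, argo E, cases r70, cases r11, argo E, argo E,
      cases g11, argo E, argo E, cases r18, cases r42, cases g38, argo E, cases r21, argo E,
      argo E, cases r94, cases r20, cases g66, argo E, argo E, argo E, cases r70, argo E, argo E,
      cases r87, cases r42, cases r94, argo E, argo E, cases r70, cases r11, argo E, argo E,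
      cases r46, argo E, argo E, cases g38, cases r85, argo E, argo E, cases r85, argo E, argo E)

section \<open>Words whose longest cyclic run of leaves free of colour 2 has length two\<close>

text \<open>The most even cyclic distribution of three leaves of colour 2, with gaps 2, 3 and 3;
  hence no three consecutive leaves avoid that colour.\<close>

lemma (in three_coloured) pattern37:
  "r136 \<Longrightarrow> g137 \<Longrightarrow> b0 \<Longrightarrow> \<not> b1 \<Longrightarrow> b2 \<Longrightarrow> \<not> b3 \<Longrightarrow> \<not> b4 \<Longrightarrow> b5 \<Longrightarrow> \<not> b6 \<Longrightarrow> \<not> b7 \<Longrightarrow> False"
  by (cases g47, cases r50, cases r112, cases r9, cases g20, cases g33, cases g89, argo E,
      argo E, argo E, cases g33, argo E, cases r113, argo E, argo E, cases g20, cases g33,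
      argo E, argo E, cases g100, argo E, argo E, cases r20, cases g13, cases r80, cases r9,
      argo E, argo E, cases g18, argo E, argo E, cases r71, cases r164, argo E, argo E, argo E,
      cases g18, cases g33, cases r9, cases r164, argo E, argo E, argo E, cases r35, argo E,
      argo E, cases r9, cases g89, argo E, argo E, cases r13, argo E, argo E, cases r12,
      cases r33, cases r135, cases g72, cases g145, argo E, argo E, cases r75, argo E, argo E,
      cases r75, cases r20, cases g72, argo E, argo E, argo E, cases g72, argo E, argo E,
      cases r135, cases r45, argo E, argo E, cases r13, argo E, argo E, cases r33, cases g24,
      cases g85, cases r70, argo E, argo E, cases r70, argo E, argo E, cases g85, argo E, argo E,
      cases g72, cases r30, argo E, argo E, cases r71, cases g91, argo E, argo E, argo E,
      cases r112, cases r78, cases g20, cases g72, argo E, cases r12, argo E, argo E, cases g85,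
      argo E, argo E, cases g20, cases r93, cases r69, argo E, argo E, cases r60, cases r133,
      cases r35, argo E, cases g56, argo E, argo E, cases r50, argo E, argo E, cases r16,
      cases r35, argo E, argo E, cases g36, argo E, argo E, cases r93, cases g100, argo E,
      argo E, cases g89, cases r35, argo E, argo E, argo E, cases r20, cases g18, cases r16,
      cases g69, argo E, argo E, cases g38, argo E, argo E, cases r50, cases r60, argo E,
      cases g13, argo E, argo E, cases r12, cases r21, argo E, argo E, cases r114, argo E,
      argo E, cases r114, cases g11, cases g70, argo E, argo E, cases g70, argo E, argo E,
      cases g72, cases g85, argo E, argo E, cases r78, argo E, argo E)

lemma (in three_coloured) pattern39:
  "r136 \<Longrightarrow> g137 \<Longrightarrow> b0 \<Longrightarrow> b1 \<Longrightarrow> b2 \<Longrightarrow> \<not> b3 \<Longrightarrow> \<not> b4 \<Longrightarrow> b5 \<Longrightarrow> \<not> b6 \<Longrightarrow> \<not> b7 \<Longrightarrow> False"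
  by (cases r35, cases g47, cases r131, cases g39, cases r70, cases r37, argo E, argo E,
      cases r25, argo E, argo E, cases r33, argo E, cases r12, cases r21, argo E, cases r70,
      argo E, argo E, argo E, cases r98, cases r50, cases g33, argo E, cases g72, argo E, argo E,
      cases r9, cases g93, cases r33, argo E, argo E, argo E, argo E, cases r50, cases r96,
      argo E, cases r85, cases g83, argo E, argo E, argo E, cases r96, argo E, cases r33,
      cases g24, argo E, argo E, argo E, cases r9, cases r60, cases g93, cases g16, argo E,
      argo E, cases g16, argo E, argo E, cases g93, cases r112, argo E, argo E, cases r96,
      cases r112, argo E, argo E, cases g39, argo E, argo E, cases r78, cases r12, argo E,
      argo E, cases r18, cases r112, cases r125, cases g20, argo E, argo E, argo E, cases r114,
      cases g11, argo E, argo E, cases g51, argo E, argo E, cases r110, cases r112, cases g20,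
      argo E, argo E, argo E, cases r75, argo E, argo E, cases r18, cases r21, cases g28,
      cases g140, cases r16, argo E, cases r66, argo E, cases r19, argo E, argo E, cases r22,
      argo E, argo E, cases r12, cases r44, argo E, cases r15, argo E, argo E, cases g106,
      argo E, cases g8, argo E, argo E, cases r28, cases r44, cases g46, cases r25, cases r70,
      argo E, cases g37, argo E, argo E, cases r16, argo E, argo E, cases r42, cases r73, argo E,
      argo E, cases r70, argo E, argo E, cases r37, cases r33, argo E, cases g22, argo E, argo E,
      cases g39, cases g38, argo E, argo E, argo E, cases r66, cases g22, cases r37, argo E,
      argo E, cases g55, argo E, argo E, cases r49, cases g51, argo E, argo E, cases g55,
      cases g38, argo E, argo E, argo E, cases r9, cases r79, cases r21, cases g8, cases r12,
      argo E, argo E, cases r46, argo E, argo E, cases r73, cases g8, argo E, argo E, argo E,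
      cases g93, cases g106, cases r12, argo E, argo E, cases r104, argo E, cases r50, argo E,
      argo E, cases r78, cases r33, argo E, argo E, cases r112, cases g38, argo E, argo E,
      argo E, cases r79, cases g8, cases r138, cases r93, argo E, argo E, cases g11, argo E,
      argo E, cases r12, cases r52, argo E, argo E, argo E, cases r93, cases g47, cases r154,
      argo E, argo E, cases g38, argo E, argo E, cases r121, cases g47, argo E, argo E,
      cases g47, argo E, argo E)

lemma (in three_coloured) pattern43:
  "r136 \<Longrightarrow> g137 \<Longrightarrow> b0 \<Longrightarrow> b1 \<Longrightarrow> \<not> b2 \<Longrightarrow> b3 \<Longrightarrow> \<not> b4 \<Longrightarrow> b5 \<Longrightarrow> \<not> b6 \<Longrightarrow> \<not> b7 \<Longrightarrow> False"
  by (cases r25, cases g16, cases r35, cases r85, cases r50, cases g38, argo E, argo E,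
      cases r47, argo E, argo E, cases g72, cases r70, argo E, argo E, cases r96, argo E,
      cases r47, argo E, argo E, cases r47, cases g78, cases g43, cases r44, argo E, cases g38,
      argo E, argo E, cases g38, cases r21, argo E, argo E, argo E, cases r9, argo E, argo E,
      cases r39, cases r33, argo E, argo E, argo E, cases g42, cases r70, cases r18, cases r11,
      cases r21, argo E, argo E, argo E, cases r11, cases r46, argo E, argo E, argo E, cases g11,
      cases r63, argo E, cases r68, argo E, cases r19, argo E, argo E, cases r18, cases r20,
      cases g13, argo E, argo E, argo E, cases r63, argo E, cases g20, argo E, argo E, cases r70,
      cases r11, cases r96, argo E, argo E, cases g72, argo E, argo E, cases r18, cases r20,
      cases r44, argo E, argo E, cases r47, argo E, argo E, cases g22, argo E, argo E, cases r16,
      cases g87, cases r53, cases r94, cases r118, cases g73, argo E, argo E, argo E, cases r85,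
      cases g72, argo E, argo E, argo E, cases r10, cases r94, argo E, argo E, cases r85, argo E,
      argo E, cases r85, cases r94, cases r50, cases g33, argo E, argo E, argo E, cases r42,
      argo E, argo E, cases r53, argo E, argo E, cases r18, cases r20, cases r85, cases r94,
      cases g110, argo E, argo E, argo E, cases r42, argo E, argo E, cases r30, cases r12,
      cases r22, argo E, argo E, argo E, cases r47, argo E, argo E, cases r42, cases r94,
      cases g22, argo E, cases g146, argo E, argo E, cases g20, cases r112, argo E, argo E,
      argo E, cases g20, cases r112, argo E, argo E, cases r47, argo E, argo E)

lemma (in three_coloured) pattern45:
  "r136 \<Longrightarrow> g137 \<Longrightarrow> b0 \<Longrightarrow> \<not> b1 \<Longrightarrow> b2 \<Longrightarrow> b3 \<Longrightarrow> \<not> b4 \<Longrightarrow> b5 \<Longrightarrow> \<not> b6 \<Longrightarrow> \<not> b7 \<Longrightarrow> False"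
  by (cases r35, cases r50, cases g33, cases r37, cases r80, cases r120, argo E, argo E,
      cases r71, cases g100, argo E, argo E, argo E, cases r124, argo E, cases r71, cases r166,
      argo E, argo E, cases g10, argo E, argo E, cases r24, cases r80, cases r37, argo E, argo E,
      cases r30, cases g64, argo E, argo E, cases r74, argo E, argo E, cases r30, cases g83,
      argo E, argo E, cases r80, cases r74, argo E, argo E, cases r74, argo E, argo E, cases r12,
      cases g91, cases r47, cases r93, cases r20, cases r95, argo E, argo E, argo E, cases r20,
      argo E, argo E, cases r20, cases g93, cases g18, argo E, argo E, argo E, argo E, cases r47,
      cases r93, argo E, cases r56, argo E, argo E, cases g93, argo E, cases r56, argo E, argo E,
      cases g85, cases r96, cases r47, argo E, argo E, cases g91, argo E, argo E, cases r16,
      cases r42, argo E, cases g79, argo E, argo E, cases g38, cases r80, argo E, argo E, argo E,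
      cases r50, cases g33, cases r24, cases r71, cases r96, cases g19, argo E, argo E,
      cases r40, argo E, argo E, cases r8, argo E, cases g10, argo E, cases g18, argo E, argo E,
      cases r95, cases g91, cases r135, cases r13, argo E, argo E, argo E, cases r93, argo E,
      argo E, cases r124, cases r30, argo E, cases r89, argo E, argo E, cases r59, cases r43,
      argo E, argo E, argo E, cases r24, cases r8, cases g52, argo E, argo E, cases r80,
      cases r126, argo E, argo E, cases g18, argo E, argo E, cases g38, cases r34, cases r80,
      argo E, argo E, cases r10, argo E, argo E, cases r102, argo E, cases r53, argo E, argo E,
      cases r47, cases r93, cases r33, cases g131, argo E, cases r98, argo E, argo E, cases r12,
      argo E, argo E, cases r60, cases r12, cases r87, argo E, argo E, cases g85, argo E, argo E,
      cases r98, argo E, argo E, cases r9, cases r33, cases g72, cases r30, argo E, argo E,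
      cases r12, argo E, argo E, cases r71, cases r96, argo E, argo E, cases g72, argo E, argo E,
      cases r12, cases r87, argo E, argo E, cases g56, argo E, argo E)

lemma (in three_coloured) pattern47:
  "r136 \<Longrightarrow> g137 \<Longrightarrow> b0 \<Longrightarrow> b1 \<Longrightarrow> b2 \<Longrightarrow> b3 \<Longrightarrow> \<not> b4 \<Longrightarrow> b5 \<Longrightarrow> \<not> b6 \<Longrightarrow> \<not> b7 \<Longrightarrow> False"
  by (cases r21, cases r30, cases r18, cases g140, cases g91, cases g28, cases r66, argo E,
      argo E, argo E, cases g28, argo E, argo E, cases g91, cases r16, argo E, argo E, cases r16,
      argo E, argo E, cases r9, cases g91, cases r20, argo E, cases r47, argo E, argo E,
      cases r50, cases g26, argo E, argo E, argo E, cases r110, cases g28, cases g91, argo E,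
      argo E, argo E, cases g28, cases r106, argo E, argo E, argo E, cases g28, cases r104,
      cases r74, cases r50, cases g72, argo E, argo E, cases r33, argo E, argo E, cases r15,
      argo E, argo E, cases r66, cases r120, cases r106, argo E, argo E, cases g49, cases r106,
      argo E, cases r40, argo E, argo E, cases g17, argo E, argo E, cases r106, cases r15,
      argo E, cases r74, argo E, argo E, cases g109, argo E, cases r96, argo E, argo E,
      cases g24, cases r44, cases r12, argo E, argo E, cases r12, argo E, argo E, cases r15,
      cases r33, argo E, argo E, cases r9, cases r44, argo E, argo E, argo E, cases g99,
      cases r30, cases r15, cases g74, cases r89, cases g91, argo E, argo E, cases g91, argo E,
      argo E, cases r71, argo E, argo E, cases g91, cases r20, cases r18, cases r85, argo E,
      argo E, argo E, cases r18, argo E, argo E, cases r12, cases r9, argo E, argo E, cases r106,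
      argo E, argo E, cases r24, cases r9, cases r15, argo E, argo E, cases r66, argo E,
      cases g70, argo E, argo E, cases r9, cases r15, argo E, argo E, cases r15, argo E, argo E,
      cases r15, cases r66, cases r63, cases g11, cases g49, argo E, argo E, cases g70, argo E,
      argo E, cases r11, argo E, argo E, cases r117, cases r59, cases g63, argo E, argo E,
      argo E, cases g64, cases g46, argo E, argo E, argo E, cases r18, cases r139, cases r61,
      cases r73, argo E, cases r66, argo E, argo E, cases g8, argo E, argo E, cases r73,
      cases r12, cases r61, argo E, argo E, argo E, cases r66, argo E, cases r11, argo E, argo E,
      cases r141, cases r16, cases r53, argo E, argo E, cases g38, cases r82, argo E, argo E,
      argo E, cases r66, cases r128, cases r11, argo E, argo E, cases r23, cases r30, argo E,
      argo E, cases r17, argo E, argo E, cases g63, cases r11, argo E, argo E, cases r23, argo E,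
      argo E)

text \<open>Adjacent pairs with and without colour 2 alternate, so the word has period 4 and its
  class has four members.\<close>

lemma (in three_coloured) pattern51:
  "r136 \<Longrightarrow> g137 \<Longrightarrow> b0 \<Longrightarrow> b1 \<Longrightarrow> \<not> b2 \<Longrightarrow> \<not> b3 \<Longrightarrow> b4 \<Longrightarrow> b5 \<Longrightarrow> \<not> b6 \<Longrightarrow> \<not> b7 \<Longrightarrow> False"
  by (cases g47, cases r50, cases r117, cases r9, cases r12, cases r112, cases g20, argo E,
      cases g164, argo E, argo E, cases r20, argo E, argo E, cases r35, argo E, cases r104,
      argo E, argo E, cases r112, cases g113, argo E, argo E, cases r164, cases g91, argo E,
      argo E, cases g91, argo E, argo E, cases r9, cases r112, cases g20, argo E, cases r30,
      argo E, argo E, cases r35, argo E, argo E, cases g91, cases r24, cases r20, argo E, argo E,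
      argo E, cases r112, argo E, cases r94, argo E, argo E, cases r33, cases g24, cases g72,
      cases r12, argo E, argo E, cases r30, argo E, argo E, cases r95, cases g91, argo E, argo E,
      cases g122, argo E, argo E, cases r9, cases g72, cases r112, argo E, argo E, cases r30,
      argo E, argo E, cases r13, cases g20, argo E, argo E, cases r112, argo E, cases g11,
      argo E, argo E, cases r21, cases r50, cases g83, cases g28, cases r15, argo E, argo E,
      cases r93, argo E, argo E, cases r135, cases r60, argo E, cases r57, argo E, argo E,
      cases r20, cases r85, argo E, argo E, cases g105, argo E, argo E, cases g28, cases r60,
      cases r12, cases r33, argo E, argo E, cases r15, cases g38, argo E, argo E, argo E,
      cases r12, argo E, cases r33, argo E, argo E, cases r66, cases r44, argo E, cases r33,
      argo E, argo E, cases r44, argo E, cases r60, argo E, argo E, cases r78, cases r33,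
      cases g24, cases r30, argo E, argo E, cases r95, argo E, argo E, cases r35, cases r37,
      cases r30, argo E, argo E, argo E, cases g38, argo E, argo E, cases r112, cases g36,
      cases g20, cases g105, argo E, argo E, cases r18, argo E, cases r41, argo E, argo E,
      cases r96, cases g105, cases r111, cases r25, argo E, argo E, argo E, cases r107, argo E,
      argo E, cases r105, argo E, argo E, cases r114, cases r118, cases g11, argo E, cases r60,
      argo E, argo E, cases g11, argo E, argo E, cases r70, cases r60, argo E, cases r53, argo E,
      argo E, cases g72, cases g105, argo E, argo E, argo E)

lemma (in three_coloured) pattern53:
  "r136 \<Longrightarrow> g137 \<Longrightarrow> b0 \<Longrightarrow> \<not> b1 \<Longrightarrow> b2 \<Longrightarrow> \<not> b3 \<Longrightarrow> b4 \<Longrightarrow> b5 \<Longrightarrow> \<not> b6 \<Longrightarrow> \<not> b7 \<Longrightarrow> False"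
  by (cases r25, cases g18, cases g16, cases g47, cases r50, cases g38, argo E, cases r9, argo E,
      argo E, cases r98, argo E, cases g72, argo E, argo E, cases r50, cases r76, argo E,
      cases r11, argo E, argo E, cases g38, cases r148, argo E, argo E, cases r51, argo E,
      argo E, cases r94, cases g22, cases r15, cases g20, argo E, argo E, argo E, cases r37,
      argo E, argo E, cases r51, cases r114, argo E, argo E, cases g20, cases g85, argo E,
      argo E, cases r158, cases r35, cases r80, argo E, argo E, argo E, argo E, cases g16,
      cases g42, cases g20, cases g38, argo E, argo E, cases r70, argo E, argo E, cases g20,
      argo E, cases r44, argo E, argo E, cases r35, cases g42, cases g79, cases r76, argo E,
      cases r11, argo E, argo E, cases r70, cases r21, argo E, argo E, cases r21, argo E, argo E,
      cases r70, cases g39, argo E, argo E, cases r44, argo E, cases g47, argo E, argo E,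
      cases r94, cases g66, cases g85, argo E, cases r70, argo E, argo E, cases r21, cases r30,
      argo E, argo E, cases r22, argo E, argo E, cases r51, argo E, cases g43, cases r114,
      argo E, argo E, argo E, cases r94, cases g66, cases r15, cases g63, cases g18, argo E,
      cases r42, argo E, argo E, cases g107, argo E, argo E, cases g117, cases r33, argo E,
      argo E, cases r59, argo E, argo E, cases r21, cases r30, cases g91, argo E, cases r152,
      argo E, argo E, argo E, cases g63, cases g55, cases r126, argo E, argo E, argo E, argo E,
      cases r66, cases r63, cases g68, cases r70, cases r44, cases r46, argo E, argo E, argo E,
      cases r96, cases r71, argo E, argo E, cases r71, cases g27, argo E, argo E, argo E,
      cases r42, cases r71, argo E, argo E, cases r44, argo E, argo E, cases g68, cases r19,
      cases r27, argo E, argo E, cases r67, argo E, argo E, cases r19, cases r42, argo E,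
      cases r44, argo E, argo E, argo E, cases r21, cases r30, cases r49, cases g91, argo E,
      argo E, argo E, cases r44, argo E, argo E, cases r49, cases g55, cases r53, argo E, argo E,
      cases g40, argo E, argo E, cases r29, argo E, cases r44, cases g31, argo E, argo E, argo E)

lemma (in three_coloured) pattern55:
  "r136 \<Longrightarrow> g137 \<Longrightarrow> b0 \<Longrightarrow> b1 \<Longrightarrow> b2 \<Longrightarrow> \<not> b3 \<Longrightarrow> b4 \<Longrightarrow> b5 \<Longrightarrow> \<not> b6 \<Longrightarrow> \<not> b7 \<Longrightarrow> False"
  by (cases r44, cases g37, cases g55, cases r21, cases r15, cases r11, cases g74, argo E,
      argo E, argo E, cases r11, argo E, argo E, cases r126, cases r30, cases g91, argo E,
      cases r50, argo E, argo E, cases r71, argo E, argo E, cases r89, cases g91, argo E, argo E,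
      cases r69, argo E, argo E, cases g74, cases r89, cases r124, argo E, argo E, cases r21,
      argo E, cases g91, argo E, argo E, cases r71, cases r166, cases g19, argo E, argo E,
      argo E, cases r33, argo E, argo E, cases r80, cases g55, cases g15, cases r11, cases r22,
      argo E, argo E, argo E, cases r11, argo E, argo E, cases r35, cases g124, argo E, argo E,
      cases g38, argo E, argo E, cases g91, cases r35, cases r95, cases g55, argo E, argo E,
      cases g55, argo E, argo E, cases g55, argo E, argo E, cases g55, cases r20, argo E,
      cases r28, argo E, argo E, cases r21, argo E, cases r41, argo E, argo E, cases g55,
      cases r37, cases g89, cases r86, cases g58, argo E, cases g22, argo E, argo E, cases r82,
      argo E, argo E, cases r69, cases r11, cases r86, argo E, cases g99, argo E, argo E,
      cases r63, argo E, argo E, cases r11, cases r16, argo E, argo E, cases r63, argo E, argo E,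
      cases r35, cases r80, cases g15, cases r11, argo E, argo E, cases r33, argo E, argo E,
      cases g91, cases r58, argo E, argo E, cases r33, argo E, cases r13, argo E, argo E,
      cases r80, cases g15, argo E, cases r11, argo E, argo E, cases r117, cases r126, cases r86,
      argo E, argo E, argo E, argo E, cases r37, cases g28, cases g89, cases r66, argo E, argo E,
      cases r69, cases r11, argo E, argo E, cases r104, argo E, argo E, cases r80, cases r18,
      argo E, argo E, cases r30, argo E, argo E, cases g28, cases r35, cases r39, cases r15,
      argo E, argo E, argo E, cases r15, cases r22, argo E, argo E, cases r22, argo E, argo E,
      cases r80, cases r12, argo E, argo E, cases g91, cases r95, argo E, argo E, cases g166,
      argo E, argo E)

lemma (in three_coloured) pattern59:
  "r136 \<Longrightarrow> g137 \<Longrightarrow> b0 \<Longrightarrow> b1 \<Longrightarrow> \<not> b2 \<Longrightarrow> b3 \<Longrightarrow> b4 \<Longrightarrow> b5 \<Longrightarrow> \<not> b6 \<Longrightarrow> \<not> b7 \<Longrightarrow> False"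
  by (cases r25, cases g16, cases r35, cases g38, cases r85, cases r50, argo E, argo E,
      cases g109, argo E, argo E, cases r85, cases g109, argo E, argo E, cases r70, argo E,
      argo E, cases g38, cases r85, cases g42, argo E, argo E, cases g109, argo E, argo E,
      cases r21, cases r144, cases r75, argo E, argo E, argo E, cases r85, cases r144, argo E,
      argo E, argo E, cases r94, cases r18, cases g91, cases r21, cases r30, argo E, cases g28,
      argo E, argo E, cases r71, cases g27, cases g66, argo E, argo E, argo E, cases r11, argo E,
      argo E, cases g66, cases r15, cases r21, argo E, argo E, argo E, cases r160, argo E,
      argo E, cases g63, cases g20, cases r11, argo E, argo E, cases r11, argo E, argo E,
      cases r11, argo E, cases g22, argo E, argo E, cases r111, cases r85, cases g31, cases r18,
      argo E, argo E, argo E, cases r70, cases r11, argo E, argo E, argo E, cases r18,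
      cases g110, cases r21, argo E, argo E, cases g42, argo E, argo E, cases r51, cases r106,
      argo E, argo E, cases r63, argo E, argo E, cases r94, cases g63, cases r11, cases r16,
      cases r70, argo E, argo E, cases r69, argo E, argo E, cases r42, cases r9, cases r15,
      argo E, argo E, cases g15, argo E, argo E, cases r9, cases g66, argo E, argo E, cases g15,
      argo E, argo E, cases g66, cases r15, cases r11, cases r57, argo E, argo E, cases r19,
      argo E, argo E, cases r57, cases r46, argo E, argo E, cases r22, argo E, argo E, cases r21,
      cases r11, argo E, argo E, cases r19, cases r11, argo E, argo E, cases r68, argo E, argo E,
      cases r16, cases g72, cases r18, cases r53, cases g105, argo E, argo E, argo E, cases g91,
      argo E, argo E, cases r51, cases r20, argo E, argo E, cases r55, argo E, argo E, cases g72,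
      cases r18, cases r22, argo E, argo E, cases r63, cases r76, argo E, argo E, cases r11,
      argo E, argo E, cases r114, cases r42, cases r47, argo E, argo E, argo E, cases r11,
      argo E, argo E)

lemma (in three_coloured) pattern61:
  "r136 \<Longrightarrow> g137 \<Longrightarrow> b0 \<Longrightarrow> \<not> b1 \<Longrightarrow> b2 \<Longrightarrow> b3 \<Longrightarrow> b4 \<Longrightarrow> b5 \<Longrightarrow> \<not> b6 \<Longrightarrow> \<not> b7 \<Longrightarrow> False"
  by (cases r9, cases g26, cases r142, cases r68, cases g28, cases r15, cases r66, argo E,
      argo E, cases r12, argo E, argo E, cases r59, argo E, argo E, cases r95, argo E, cases r59,
      argo E, argo E, cases g99, cases r15, cases r59, cases r24, argo E, argo E, cases g120,
      argo E, argo E, cases r24, cases r8, cases r66, argo E, argo E, argo E, cases r13, argo E,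
      argo E, cases r59, cases r15, cases r25, cases r33, argo E, argo E, argo E, cases r11,
      cases r97, argo E, argo E, cases r66, argo E, argo E, cases r25, cases g109, argo E,
      cases r57, argo E, argo E, cases r24, argo E, argo E, cases r12, cases r50, cases g138,
      cases g78, cases r11, argo E, argo E, cases g33, argo E, argo E, cases g33, cases r59,
      argo E, argo E, argo E, cases r30, cases g93, argo E, argo E, cases g28, cases r54, argo E,
      argo E, argo E, cases r50, cases g78, cases r35, argo E, cases r118, argo E, argo E,
      cases r159, cases r75, argo E, argo E, argo E, cases r54, cases r118, cases g91, argo E,
      argo E, argo E, cases g91, argo E, argo E, cases r26, cases r30, cases g118, cases r114,
      cases g45, argo E, argo E, cases r11, argo E, cases g49, argo E, argo E, cases r35,
      cases g59, cases g117, cases g74, cases r63, argo E, argo E, cases r33, argo E, argo E,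
      cases g64, argo E, argo E, cases g91, argo E, cases g40, argo E, argo E, cases r93,
      cases g85, argo E, argo E, cases r47, cases g112, argo E, cases r20, argo E, argo E,
      cases g72, argo E, argo E, cases r74, cases g102, cases r24, argo E, argo E, cases r33,
      argo E, cases g54, argo E, argo E, cases r71, cases r24, cases g19, argo E, argo E,
      cases r80, argo E, argo E, cases r25, cases g10, cases r138, argo E, argo E, cases g16,
      argo E, cases r76, argo E, argo E, cases r24, cases g10, argo E, argo E, argo E, cases r59,
      cases g117, cases r33, cases r30, argo E, argo E, cases r24, argo E, argo E, cases g15,
      cases r66, cases r28, argo E, argo E, argo E, cases r107, cases g36, argo E, argo E,
      argo E, cases r124, cases r89, cases g91, cases r94, argo E, argo E, cases r103, argo E,
      argo E, cases r37, cases r54, argo E, argo E, argo E, cases r33, cases r30, argo E,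
      cases r74, argo E, argo E, cases r126, cases r24, argo E, argo E, cases r24, argo E,
      argo E)

text \<open>Only leaves 6 and 7 avoid colour 2; their centres force colours 1 and 0 on them. With
  two such leaves the class again depends on their distance alone: 1 here, 2 for 95, 3 for 111 and 4
  for 119.\<close>

lemma (in three_coloured) pattern63:
  "r136 \<Longrightarrow> g137 \<Longrightarrow> b0 \<Longrightarrow> b1 \<Longrightarrow> b2 \<Longrightarrow> b3 \<Longrightarrow> b4 \<Longrightarrow> b5 \<Longrightarrow> \<not> b6 \<Longrightarrow> \<not> b7 \<Longrightarrow> False"
  by (cases r35, cases r47, cases g112, cases r114, cases g87, cases r20, cases r16, argo E,
      argo E, cases r135, argo E, cases r12, argo E, argo E, cases r16, cases r85, argo E,
      argo E, cases r20, argo E, argo E, cases g87, cases r70, cases r9, argo E, argo E,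
      cases r12, argo E, argo E, cases r16, argo E, cases g72, argo E, argo E, cases g131,
      cases g16, cases r20, cases r118, argo E, argo E, argo E, cases r18, cases r21, argo E,
      cases r73, argo E, argo E, argo E, cases r98, cases g100, cases r40, cases r71, argo E,
      argo E, argo E, argo E, cases r36, cases r20, cases g34, argo E, argo E, argo E,
      cases r133, cases r20, argo E, argo E, cases r29, argo E, cases r20, cases r25, argo E,
      argo E, argo E, cases r50, cases g83, cases r9, cases g138, cases g33, argo E, argo E,
      argo E, cases g33, argo E, argo E, cases g33, cases r9, argo E, cases r37, argo E, argo E,
      cases r9, argo E, cases g91, argo E, argo E, cases g93, cases r96, argo E, cases r33,
      cases r20, argo E, argo E, argo E, cases r33, cases r12, cases r102, argo E, argo E,
      cases g87, argo E, argo E, cases g102, cases g19, argo E, argo E, argo E, cases r50,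
      cases r145, cases g83, cases r87, cases g39, cases r106, argo E, argo E, cases g38, argo E,
      argo E, cases g38, cases g39, argo E, argo E, argo E, cases r85, cases r75, cases g39,
      argo E, cases g37, argo E, argo E, cases g39, argo E, cases r47, argo E, argo E, cases r16,
      cases r75, argo E, argo E, argo E, cases r68, cases r30, cases g83, argo E, argo E,
      cases r37, argo E, argo E, cases r37, cases r71, cases r61, argo E, argo E, argo E,
      cases g115, argo E, argo E, cases r33, cases r12, cases r87, cases r37, cases r74, argo E,
      argo E, argo E, cases r16, argo E, argo E, cases r37, cases r74, argo E, argo E, cases g74,
      cases r47, argo E, argo E, argo E, cases r24, cases r47, cases r93, argo E, cases g40,
      argo E, argo E, cases r8, cases g72, argo E, argo E, argo E, cases r95, cases g91, argo E,
      argo E, cases r47, cases r43, argo E, argo E, cases r30, argo E, argo E)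

section \<open>Words without two cyclically adjacent leaves free of colour 2\<close>

text \<open>The alternating word: even leaves have colour 2 and odd leaves are forced to colour 0.
  It has period 2, and its class consists of this word and its complement.\<close>

lemma (in three_coloured) pattern85:
  "r136 \<Longrightarrow> g137 \<Longrightarrow> b0 \<Longrightarrow> \<not> b1 \<Longrightarrow> b2 \<Longrightarrow> \<not> b3 \<Longrightarrow> b4 \<Longrightarrow> \<not> b5 \<Longrightarrow> b6 \<Longrightarrow> \<not> b7 \<Longrightarrow> False"
  by (cases g25, cases r42, cases g70, cases g11, cases g106, cases r96, argo E, argo E,
      cases r80, argo E, argo E, cases r96, cases r9, argo E, argo E, cases g38, argo E, argo E,
      cases r44, cases g37, cases g55, cases r21, argo E, argo E, argo E, cases r80, argo E,
      cases r35, argo E, argo E, cases r37, cases r80, cases g15, argo E, argo E, cases r69,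
      argo E, argo E, cases r35, argo E, argo E, cases r94, cases r70, cases r111, cases g66,
      argo E, argo E, cases g66, argo E, argo E, cases g11, argo E, argo E, cases r16, cases r70,
      cases g18, cases r44, argo E, argo E, cases r11, argo E, argo E, cases g11, argo E, argo E,
      cases r44, cases r70, cases g68, argo E, cases g55, argo E, argo E, cases g11, argo E,
      argo E, cases r35, cases r70, cases g18, argo E, argo E, argo E, cases r70, cases r37,
      argo E, argo E, argo E, cases r94, cases g66, cases r21, cases r120, argo E, argo E,
      cases r16, cases r15, argo E, argo E, argo E, cases r16, cases r42, cases g18, argo E,
      argo E, cases g18, argo E, argo E, cases r42, cases g47, argo E, argo E, argo E, cases r66,
      cases g72, cases r16, cases g18, argo E, argo E, cases r76, argo E, argo E, cases r42,
      cases g68, argo E, argo E, cases r16, argo E, argo E, cases r42, cases r16, argo E,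
      cases g72, argo E, argo E, cases r16, cases g85, argo E, argo E, cases r49, argo E, argo E)

lemma (in three_coloured) pattern87:
  "r136 \<Longrightarrow> g137 \<Longrightarrow> b0 \<Longrightarrow> b1 \<Longrightarrow> b2 \<Longrightarrow> \<not> b3 \<Longrightarrow> b4 \<Longrightarrow> \<not> b5 \<Longrightarrow> b6 \<Longrightarrow> \<not> b7 \<Longrightarrow> False"
  by (cases r44, cases g37, cases r30, cases g55, cases r80, cases g91, argo E, argo E,
      cases r15, cases r11, cases g91, argo E, argo E, argo E, argo E, cases g91, cases r89,
      cases r124, argo E, argo E, argo E, cases r129, cases g25, argo E, argo E, cases r11,
      argo E, argo E, cases r80, cases g55, cases g15, argo E, argo E, cases r21, argo E, argo E,
      cases r124, cases g72, argo E, argo E, cases g55, cases r59, argo E, argo E, cases r59,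
      cases g26, argo E, argo E, argo E, cases r80, cases r74, cases g15, argo E, argo E,
      cases r71, cases g15, argo E, cases g55, argo E, argo E, cases r59, argo E, argo E,
      cases g69, cases g47, cases r35, argo E, argo E, cases r20, argo E, argo E, cases g91,
      cases g55, cases g99, argo E, argo E, cases r9, argo E, argo E, cases r20, argo E,
      cases r71, argo E, argo E, cases g25, cases r94, cases r42, cases r18, cases g66, argo E,
      argo E, argo E, cases r70, cases g66, argo E, argo E, cases g11, argo E, argo E, cases g57,
      cases r63, cases r60, cases r42, argo E, argo E, cases g62, cases r31, argo E, argo E,
      argo E, cases r42, cases g61, cases g15, argo E, argo E, argo E, cases r11, cases g46,
      argo E, argo E, argo E, cases r66, cases g89, cases r158, argo E, argo E, cases r42,
      argo E, argo E, cases r28, argo E, argo E, cases r16, cases r94, cases r42, argo E,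
      cases r70, argo E, cases r39, cases g66, argo E, argo E, cases g66, argo E, argo E,
      cases r37, cases g89, cases r158, argo E, argo E, cases r62, cases r69, argo E, argo E,
      argo E, cases r80, argo E, argo E, cases r94, cases g47, cases r146, argo E, cases r18,
      argo E, argo E, cases r120, argo E, argo E, cases g47, cases g38, cases r146, argo E,
      argo E, cases r146, argo E, argo E, cases g72, argo E, argo E)

text \<open>Up to rotation the complement of 37: the three leaves without colour 2 are spread as
  evenly as possible.\<close>

lemma (in three_coloured) pattern91:
  "r136 \<Longrightarrow> g137 \<Longrightarrow> b0 \<Longrightarrow> b1 \<Longrightarrow> \<not> b2 \<Longrightarrow> b3 \<Longrightarrow> b4 \<Longrightarrow> \<not> b5 \<Longrightarrow> b6 \<Longrightarrow> \<not> b7 \<Longrightarrow> False"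
  by (cases r21, cases g25, cases r16, cases g140, cases r17, cases g28, argo E, argo E, argo E,
      cases r20, cases g28, argo E, argo E, cases r112, cases g28, cases r22, argo E, argo E,
      argo E, cases r114, argo E, argo E, cases r94, cases g28, cases r18, cases r30, argo E,
      argo E, cases g20, argo E, argo E, cases r18, argo E, argo E, cases r18, cases g28,
      cases r30, argo E, argo E, argo E, cases g28, cases r15, argo E, argo E, cases g20, argo E,
      cases r47, argo E, argo E, cases g28, cases r15, cases r16, cases r30, cases g140, argo E,
      argo E, cases r53, argo E, argo E, cases r35, argo E, cases g38, argo E, argo E, cases r94,
      cases r30, argo E, argo E, cases r16, cases g140, argo E, cases r23, argo E, argo E,
      cases r30, cases r9, argo E, argo E, argo E, cases r66, cases r44, cases g22, argo E,
      argo E, cases r63, argo E, cases r142, argo E, argo E, cases r44, cases g37, argo E,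
      argo E, cases r49, argo E, argo E, cases g25, cases r42, cases r73, cases g38, cases r94,
      cases r85, argo E, argo E, cases r85, argo E, argo E, cases r18, argo E, argo E, cases r94,
      cases g66, cases r53, argo E, argo E, cases r64, argo E, argo E, cases g77, argo E, argo E,
      cases r44, cases r94, cases r70, argo E, cases g66, cases g37, argo E, argo E, argo E,
      cases r70, cases g120, argo E, argo E, cases g72, argo E, argo E, cases r28, cases r106,
      cases g12, argo E, cases r18, argo E, argo E, cases r37, cases r70, argo E, cases r94,
      argo E, argo E, argo E, cases r66, argo E, argo E, cases r94, cases g66, cases r16,
      cases r53, argo E, argo E, cases r22, argo E, argo E, cases r16, cases r68, cases r49,
      argo E, argo E, cases r42, argo E, argo E, cases g38, argo E, cases r105, argo E, argo E,
      cases r66, cases r16, cases g22, cases r20, cases r53, argo E, argo E, argo E, cases r42,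
      argo E, argo E, cases r63, cases g22, argo E, argo E, cases r11, argo E, cases g38, argo E,
      argo E, cases r15, cases r16, cases g12, argo E, argo E, cases r22, argo E, argo E,
      cases g12, cases r63, argo E, argo E, argo E)

lemma (in three_coloured) pattern95:
  "r136 \<Longrightarrow> g137 \<Longrightarrow> b0 \<Longrightarrow> b1 \<Longrightarrow> b2 \<Longrightarrow> b3 \<Longrightarrow> b4 \<Longrightarrow> \<not> b5 \<Longrightarrow> b6 \<Longrightarrow> \<not> b7 \<Longrightarrow> False"
  by (cases r30, cases g57, cases r71, cases r50, cases g12, cases r85, argo E, cases g72,
      argo E, argo E, cases r138, cases g14, argo E, argo E, cases r14, argo E, argo E,
      cases r35, cases g91, argo E, argo E, cases r80, argo E, argo E, cases r44, cases r80,
      cases g15, argo E, argo E, cases g91, argo E, argo E, cases g10, cases r53, cases g91,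
      argo E, argo E, cases r115, argo E, argo E, cases r82, cases g45, argo E, argo E,
      cases r75, argo E, argo E, cases r102, cases r37, cases g91, cases r159, cases g10, argo E,
      argo E, argo E, cases r64, cases g10, argo E, argo E, argo E, cases r33, cases g24, argo E,
      cases g10, argo E, argo E, cases r27, argo E, argo E, cases r154, cases g78, cases g12,
      argo E, argo E, cases r9, cases g26, cases r21, argo E, cases r37, argo E, argo E,
      cases r96, cases r59, argo E, argo E, argo E, cases g91, cases r37, argo E, argo E,
      cases r83, cases r37, cases g22, argo E, argo E, cases r33, argo E, argo E, cases r20,
      argo E, argo E, cases g91, cases r47, argo E, cases r75, argo E, argo E, cases r47, argo E,
      cases r20, argo E, argo E, cases r74, cases g72, cases r47, cases g12, cases r85, argo E,
      argo E, cases r9, argo E, cases r26, argo E, argo E, cases r83, cases r20, cases r105,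
      argo E, argo E, cases r75, argo E, argo E, cases r131, cases r85, argo E, argo E, argo E,
      cases r155, cases g79, cases r27, cases r142, argo E, argo E, cases r85, argo E,
      cases r143, argo E, argo E, cases r8, cases r24, argo E, argo E, cases r27, cases g25,
      argo E, argo E, cases g152, argo E, argo E, cases r35, cases r21, cases r53, cases g28,
      argo E, argo E, argo E, cases r60, cases g16, argo E, argo E, argo E, cases g8, cases r21,
      argo E, argo E, cases r21, argo E, cases r28, argo E, argo E, cases r71, cases r50,
      cases g12, cases r75, argo E, cases r48, argo E, argo E, cases r80, cases g15, cases r21,
      argo E, argo E, cases r28, argo E, argo E, cases r37, argo E, argo E, cases r24, argo E,
      cases r83, argo E, argo E, cases r44, cases r124, argo E, cases r35, argo E, argo E,
      cases r115, cases g10, cases r53, argo E, argo E, cases r75, argo E, argo E, cases r31,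
      cases r23, argo E, argo E, cases r27, argo E, argo E)

lemma (in three_coloured) pattern111:
  "r136 \<Longrightarrow> g137 \<Longrightarrow> b0 \<Longrightarrow> b1 \<Longrightarrow> b2 \<Longrightarrow> b3 \<Longrightarrow> \<not> b4 \<Longrightarrow> b5 \<Longrightarrow> b6 \<Longrightarrow> \<not> b7 \<Longrightarrow> False"
  by (cases g38, cases r10, cases r53, cases r85, cases g73, cases r75, cases g42, argo E,
      argo E, cases g77, argo E, argo E, cases g70, cases r39, argo E, cases r35, argo E, argo E,
      cases r64, cases g43, argo E, argo E, cases r80, argo E, argo E, cases g20, cases r16,
      argo E, argo E, cases r47, argo E, cases r58, argo E, argo E, cases g138, cases r85,
      cases g83, cases r55, argo E, argo E, cases r55, argo E, argo E, cases r55, cases g120,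
      argo E, argo E, cases r21, argo E, cases r28, argo E, argo E, cases r21, cases r55, argo E,
      cases g28, argo E, argo E, cases r8, cases r55, cases r9, argo E, argo E, cases g52,
      argo E, argo E, cases r55, argo E, argo E, cases r21, cases r71, cases g28, cases g19,
      cases r12, argo E, argo E, argo E, cases r96, argo E, argo E, cases g28, cases r80,
      cases r107, argo E, argo E, cases g166, cases g64, argo E, argo E, argo E, cases r15,
      argo E, argo E, cases r53, cases g105, cases r12, cases r14, argo E, argo E, cases r28,
      cases r71, argo E, argo E, argo E, cases r71, cases g20, argo E, argo E, cases g20, argo E,
      argo E, cases r55, cases r71, cases r12, argo E, argo E, cases r12, argo E, argo E,
      cases r71, cases g64, argo E, argo E, cases r85, argo E, argo E, cases r18, cases r53,
      cases r85, cases g51, cases r50, cases r16, argo E, cases r12, argo E, argo E, cases g48,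
      argo E, cases r32, argo E, argo E, cases r16, cases g87, argo E, argo E, cases r95, argo E,
      cases r35, argo E, argo E, cases g20, argo E, cases g51, cases r50, argo E, argo E, argo E,
      cases g16, cases r96, cases r111, argo E, argo E, cases r21, cases g28, argo E, argo E,
      cases g109, argo E, argo E, cases r35, cases g79, cases r20, argo E, argo E, cases r20,
      argo E, argo E, cases r20, cases r12, argo E, argo E, cases g110, argo E, argo E,
      cases r53, cases r25, cases r35, cases r96, cases g31, argo E, argo E, argo E, cases g20,
      cases r55, argo E, argo E, argo E, cases r16, cases r42, cases r21, cases r22, argo E,
      argo E, cases g105, argo E, argo E, cases r70, argo E, argo E, cases g20, cases r51,
      cases r35, argo E, argo E, argo E, cases r47, argo E, cases r58, argo E, argo E, cases r51,
      cases g72, cases g16, argo E, cases r25, argo E, argo E, cases r96, cases r109, argo E,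
      cases g20, argo E, argo E, argo E, cases r95, cases g91, argo E, cases r120, argo E,
      argo E, cases r96, cases g98, argo E, argo E, argo E)

text \<open>The leaves 3 and 7 without colour 2 are opposite each other and, both being odd, have
  colour 0. This is the last class with four members.\<close>

lemma (in three_coloured) pattern119:
  "r136 \<Longrightarrow> g137 \<Longrightarrow> b0 \<Longrightarrow> b1 \<Longrightarrow> b2 \<Longrightarrow> \<not> b3 \<Longrightarrow> b4 \<Longrightarrow> b5 \<Longrightarrow> b6 \<Longrightarrow> \<not> b7 \<Longrightarrow> False"
  by (cases r18, cases g47, cases r112, cases r114, cases g11, cases g20, argo E, cases r16,
      argo E, cases r80, argo E, argo E, cases r86, argo E, argo E, cases g20, cases r16, argo E,
      argo E, cases r30, cases r12, argo E, argo E, cases r45, argo E, argo E, cases r60,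
      cases g16, cases r114, cases g11, argo E, argo E, argo E, cases r105, cases r98, argo E,
      argo E, cases r111, argo E, argo E, cases r114, cases r20, cases r36, cases g38, argo E,
      argo E, cases g11, cases r116, argo E, argo E, argo E, cases r109, argo E, argo E,
      cases g51, argo E, cases r20, cases r149, argo E, argo E, argo E, cases r50, cases g33,
      cases r60, cases g16, argo E, argo E, cases r145, cases r93, argo E, argo E, argo E,
      cases r60, cases r112, cases g16, argo E, argo E, cases r35, argo E, argo E, cases g39,
      cases r16, argo E, argo E, cases r16, cases r70, argo E, argo E, argo E, cases r112,
      cases g20, cases r13, argo E, argo E, cases r83, argo E, cases g72, argo E, argo E,
      cases g72, cases r116, cases r117, argo E, argo E, argo E, cases r20, cases r105, argo E,
      argo E, cases r83, argo E, argo E, cases r35, cases r25, cases r140, cases g20, cases g31,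
      cases g100, argo E, argo E, cases g100, argo E, argo E, cases g16, cases g38, argo E,
      argo E, cases r21, cases g42, cases r46, argo E, argo E, argo E, cases r17, argo E, argo E,
      cases g38, cases r20, argo E, argo E, cases r51, argo E, argo E, cases r16, cases r42,
      cases g106, argo E, cases r80, argo E, argo E, cases r70, cases r53, argo E, argo E,
      argo E, cases g20, cases g100, argo E, argo E, cases r112, cases r21, cases r133, argo E,
      argo E, argo E, cases r50, argo E, argo E, cases r9, cases r100, cases r25, cases r140,
      cases r87, cases g20, cases r79, argo E, argo E, argo E, cases g20, argo E, argo E,
      cases r20, argo E, argo E, cases r16, argo E, cases g20, cases r112, argo E, argo E,
      cases r112, argo E, argo E, cases r79, cases g8, cases g47, cases r96, argo E, argo E,
      argo E, argo E, cases g106, cases r89, argo E, argo E, cases r104, argo E, argo E,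
      cases r93, cases g91, cases g47, argo E, argo E, cases r20, argo E, cases r13, argo E,
      argo E, cases r79, cases g47, argo E, cases r60, argo E, argo E, cases g38, cases r44,
      argo E, argo E, cases r27, argo E, argo E)

lemma (in three_coloured) pattern127:
  "r136 \<Longrightarrow> g137 \<Longrightarrow> b0 \<Longrightarrow> b1 \<Longrightarrow> b2 \<Longrightarrow> b3 \<Longrightarrow> b4 \<Longrightarrow> b5 \<Longrightarrow> b6 \<Longrightarrow> \<not> b7 \<Longrightarrow> False"
  by (cases r9, cases r47, cases g112, cases r20, cases g13, cases r12, cases r33, argo E,
      argo E, cases r50, argo E, argo E, cases r33, argo E, cases g124, argo E, cases r126,
      argo E, argo E, cases r18, cases g110, cases r22, argo E, argo E, cases r75, argo E,
      argo E, cases r50, cases g83, cases g125, argo E, argo E, argo E, cases r83, argo E,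
      argo E, cases r36, cases g38, cases r35, cases g78, argo E, argo E, cases r60, argo E,
      argo E, cases r53, cases r20, argo E, argo E, cases g78, argo E, cases r114, argo E,
      argo E, cases r114, cases g11, cases r13, argo E, argo E, cases r15, argo E, argo E,
      cases g26, cases g72, argo E, cases r20, argo E, argo E, argo E, cases r131, cases r78,
      cases r33, cases g39, cases r37, argo E, argo E, argo E, cases g72, cases r35, argo E,
      cases r30, argo E, argo E, cases r16, argo E, argo E, cases r16, cases g87, cases g39,
      argo E, argo E, cases r85, argo E, cases g72, argo E, argo E, cases r100, cases r76,
      argo E, cases g98, argo E, argo E, cases r18, cases r96, argo E, cases r53, argo E, argo E,
      cases g20, argo E, argo E, cases g93, cases r133, cases g26, cases r98, argo E, cases r96,
      argo E, cases r114, argo E, argo E, cases r30, argo E, cases r45, argo E, argo E,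
      cases g26, cases r159, cases g95, argo E, cases r18, cases r59, argo E, argo E, cases r24,
      argo E, argo E, argo E, cases r112, argo E, argo E, cases g72, cases r30, cases r133,
      argo E, argo E, argo E, cases r133, cases r83, argo E, argo E, cases r74, argo E, argo E,
      cases r26, cases r111, cases g118, cases g142, cases g40, cases r28, argo E, argo E,
      cases r35, argo E, argo E, cases r25, cases g16, cases g40, argo E, argo E, argo E,
      cases r16, argo E, argo E, cases g142, cases r114, cases g11, cases r28, cases g91, argo E,
      argo E, argo E, cases g15, argo E, argo E, cases g72, argo E, cases r11, argo E, cases r76,
      argo E, argo E, cases r25, cases r24, cases r35, argo E, cases r93, argo E, argo E,
      cases r35, argo E, argo E, cases r24, cases r114, cases r109, argo E, argo E, argo E,
      cases r16, argo E, cases r18, argo E, argo E, cases r80, cases g15, cases r107, argo E,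
      argo E, cases g13, argo E, argo E, cases r57, cases r44, cases g120, argo E, argo E,
      argo E, cases r74, argo E, argo E, cases r59, cases r117, cases g151, cases r30, cases g91,
      argo E, cases r20, argo E, argo E, argo E, cases r61, cases g113, argo E, argo E,
      cases g24, argo E, argo E, cases r33, cases r126, argo E, argo E, cases r24, cases g91,
      argo E, argo E, argo E, cases r12, cases r30, cases r28, cases g83, argo E, argo E,
      cases g83, argo E, argo E, cases g28, cases r106, argo E, argo E, argo E, cases r138,
      cases r30, argo E, cases g28, argo E, argo E, cases g15, argo E, cases r8, argo E, argo E)

text \<open>Since all eight leaves have colour 2, none of their 32 neighbours outside the double
  star can have it; the splits on \<open>r12\<close> and \<open>r9\<close> thus choose between
  colours 0 and 1.\<close>

lemma (in three_coloured) pattern255: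
  "r136 \<Longrightarrow> g137 \<Longrightarrow> b0 \<Longrightarrow> b1 \<Longrightarrow> b2 \<Longrightarrow> b3 \<Longrightarrow> b4 \<Longrightarrow> b5 \<Longrightarrow> b6 \<Longrightarrow> b7 \<Longrightarrow> False"
  by (cases r12, cases r9, cases g138, cases r15, cases r28, cases r11, cases g26, argo E,
      argo E, cases g88, argo E, argo E, cases r30, argo E, argo E, cases g28, cases r11,
      cases g89, argo E, argo E, argo E, cases r106, argo E, argo E, cases g83, cases g78,
      cases r10, cases r35, argo E, argo E, cases r35, argo E, argo E, cases r72, cases r11,
      argo E, argo E, cases r81, cases r14, argo E, argo E, argo E, cases r30, cases r8,
      cases r64, argo E, argo E, cases g24, argo E, argo E, cases r13, cases r8, argo E, argo E,
      cases r10, argo E, argo E, cases r50, cases r93, cases g104, cases r28, cases r41,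
      cases r15, argo E, argo E, argo E, cases r44, cases r30, argo E, argo E, cases r11, argo E,
      argo E, cases g33, cases r106, argo E, argo E, cases r21, cases r24, argo E, argo E,
      cases r15, argo E, argo E, cases g33, cases r13, argo E, cases g112, argo E, cases r114,
      argo E, argo E, cases r35, cases r139, argo E, argo E, cases g39, argo E, argo E,
      cases r78, cases r35, cases r30, argo E, argo E, cases r33, argo E, argo E, cases r85,
      cases r30, cases r87, argo E, argo E, argo E, cases g104, cases r61, argo E, argo E,
      cases r72, argo E, argo E, cases r18, cases r35, cases r83, cases g79, cases g87,
      cases r106, argo E, argo E, cases r16, argo E, argo E, cases r75, cases r8, argo E, argo E,
      argo E, cases r75, cases r85, argo E, cases r70, argo E, argo E, cases g79, cases r8,
      argo E, argo E, cases r104, argo E, argo E, cases r44, cases r145, cases r38, cases g33,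
      argo E, cases g46, argo E, cases r24, argo E, argo E, cases g46, cases r10, argo E, argo E,
      cases r10, argo E, argo E, cases r33, cases r71, argo E, cases g46, argo E, argo E, argo E,
      cases g110, cases r37, cases r38, argo E, argo E, cases r82, argo E, cases g33, argo E,
      argo E, cases r37, cases r33, argo E, argo E, cases r80, argo E, argo E, cases r46,
      cases r83, cases g61, cases r104, cases r9, argo E, argo E, cases r106, argo E, argo E,
      cases r33, cases r72, cases r35, argo E, argo E, cases r78, argo E, argo E, cases r72,
      cases r35, argo E, argo E, cases r51, argo E, cases g56, argo E, argo E, cases r30,
      cases r75, cases r22, argo E, argo E, cases r25, argo E, cases r16, argo E, argo E,
      cases r85, cases g61, argo E, argo E, cases r20, argo E, argo E, cases r15, cases r28,
      cases r106, argo E, argo E, cases r44, argo E, argo E, cases r61, cases g66, argo E,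
      argo E, cases r104, cases g66, argo E, argo E, argo E)

section \<open>From the refutations to all colourings\<close>

text \<open>The isolated vertex carries no constraint, so only the vertices below 170 are mentioned.
  A colouring with at most three colours satisfies this, whatever their exact number.\<close>

definition proper3 :: "(nat \<Rightarrow> nat) \<Rightarrow> bool" where
  "proper3 c \<longleftrightarrow> (\<forall>u < 170. c u < 3 \<and> (\<forall>v \<in> set (nbs u). c u \<noteq> c v))"

text \<open>The bridge from colourings to propositional logic: the atoms \<open>r\<close>,
  \<open>g\<close> and \<open>b\<close> of vertex \<open>v\<close> become the equations of
  \<open>c v\<close> with 0, 1 and 2.\<close>

lemma three_coloured_proper3:
  assumes "proper3 c"
  shows "three_coloured
    (c 0 = 0) (c 1 = 0) (c 2 = 0) (c 3 = 0) (c 4 = 0) (c 5 = 0) (c 6 = 0) (c 7 = 0) (c 8 = 0)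
    (c 9 = 0) (c 10 = 0) (c 11 = 0) (c 12 = 0) (c 13 = 0) (c 14 = 0) (c 15 = 0) (c 16 = 0)
    (c 17 = 0) (c 18 = 0) (c 19 = 0) (c 20 = 0) (c 21 = 0) (c 22 = 0) (c 23 = 0) (c 24 = 0)
    (c 25 = 0) (c 26 = 0) (c 27 = 0) (c 28 = 0) (c 29 = 0) (c 30 = 0) (c 31 = 0) (c 32 = 0)
    (c 33 = 0) (c 34 = 0) (c 35 = 0) (c 36 = 0) (c 37 = 0) (c 38 = 0) (c 39 = 0) (c 40 = 0)
    (c 41 = 0) (c 42 = 0) (c 43 = 0) (c 44 = 0) (c 45 = 0) (c 46 = 0) (c 47 = 0) (c 48 = 0)
    (c 49 = 0) (c 50 = 0) (c 51 = 0) (c 52 = 0) (c 53 = 0) (c 54 = 0) (c 55 = 0) (c 56 = 0)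
    (c 57 = 0) (c 58 = 0) (c 59 = 0) (c 60 = 0) (c 61 = 0) (c 62 = 0) (c 63 = 0) (c 64 = 0)
    (c 65 = 0) (c 66 = 0) (c 67 = 0) (c 68 = 0) (c 69 = 0) (c 70 = 0) (c 71 = 0) (c 72 = 0)
    (c 73 = 0) (c 74 = 0) (c 75 = 0) (c 76 = 0) (c 77 = 0) (c 78 = 0) (c 79 = 0) (c 80 = 0)
    (c 81 = 0) (c 82 = 0) (c 83 = 0) (c 84 = 0) (c 85 = 0) (c 86 = 0) (c 87 = 0) (c 88 = 0)
    (c 89 = 0) (c 90 = 0) (c 91 = 0) (c 92 = 0) (c 93 = 0) (c 94 = 0) (c 95 = 0) (c 96 = 0)
    (c 97 = 0) (c 98 = 0) (c 99 = 0) (c 100 = 0) (c 101 = 0) (c 102 = 0) (c 103 = 0) (c 104 = 0)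
    (c 105 = 0) (c 106 = 0) (c 107 = 0) (c 108 = 0) (c 109 = 0) (c 110 = 0) (c 111 = 0)
    (c 112 = 0) (c 113 = 0) (c 114 = 0) (c 115 = 0) (c 116 = 0) (c 117 = 0) (c 118 = 0)
    (c 119 = 0) (c 120 = 0) (c 121 = 0) (c 122 = 0) (c 123 = 0) (c 124 = 0) (c 125 = 0)
    (c 126 = 0) (c 127 = 0) (c 128 = 0) (c 129 = 0) (c 130 = 0) (c 131 = 0) (c 132 = 0)
    (c 133 = 0) (c 134 = 0) (c 135 = 0) (c 136 = 0) (c 137 = 0) (c 138 = 0) (c 139 = 0)
    (c 140 = 0) (c 141 = 0) (c 142 = 0) (c 143 = 0) (c 144 = 0) (c 145 = 0) (c 146 = 0)
    (c 147 = 0) (c 148 = 0) (c 149 = 0) (c 150 = 0) (c 151 = 0) (c 152 = 0) (c 153 = 0)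
    (c 154 = 0) (c 155 = 0) (c 156 = 0) (c 157 = 0) (c 158 = 0) (c 159 = 0) (c 160 = 0)
    (c 161 = 0) (c 162 = 0) (c 163 = 0) (c 164 = 0) (c 165 = 0) (c 166 = 0) (c 167 = 0)
    (c 168 = 0) (c 169 = 0) (c 0 = 1) (c 1 = 1) (c 2 = 1) (c 3 = 1) (c 4 = 1) (c 5 = 1) (c 6 = 1)
    (c 7 = 1) (c 8 = 1) (c 9 = 1) (c 10 = 1) (c 11 = 1) (c 12 = 1) (c 13 = 1) (c 14 = 1)
    (c 15 = 1) (c 16 = 1) (c 17 = 1) (c 18 = 1) (c 19 = 1) (c 20 = 1) (c 21 = 1) (c 22 = 1)
    (c 23 = 1) (c 24 = 1) (c 25 = 1) (c 26 = 1) (c 27 = 1) (c 28 = 1) (c 29 = 1) (c 30 = 1)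
    (c 31 = 1) (c 32 = 1) (c 33 = 1) (c 34 = 1) (c 35 = 1) (c 36 = 1) (c 37 = 1) (c 38 = 1)
    (c 39 = 1) (c 40 = 1) (c 41 = 1) (c 42 = 1) (c 43 = 1) (c 44 = 1) (c 45 = 1) (c 46 = 1)
    (c 47 = 1) (c 48 = 1) (c 49 = 1) (c 50 = 1) (c 51 = 1) (c 52 = 1) (c 53 = 1) (c 54 = 1)
    (c 55 = 1) (c 56 = 1) (c 57 = 1) (c 58 = 1) (c 59 = 1) (c 60 = 1) (c 61 = 1) (c 62 = 1)
    (c 63 = 1) (c 64 = 1) (c 65 = 1) (c 66 = 1) (c 67 = 1) (c 68 = 1) (c 69 = 1) (c 70 = 1)
    (c 71 = 1) (c 72 = 1) (c 73 = 1) (c 74 = 1) (c 75 = 1) (c 76 = 1) (c 77 = 1) (c 78 = 1)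
    (c 79 = 1) (c 80 = 1) (c 81 = 1) (c 82 = 1) (c 83 = 1) (c 84 = 1) (c 85 = 1) (c 86 = 1)
    (c 87 = 1) (c 88 = 1) (c 89 = 1) (c 90 = 1) (c 91 = 1) (c 92 = 1) (c 93 = 1) (c 94 = 1)
    (c 95 = 1) (c 96 = 1) (c 97 = 1) (c 98 = 1) (c 99 = 1) (c 100 = 1) (c 101 = 1) (c 102 = 1)
    (c 103 = 1) (c 104 = 1) (c 105 = 1) (c 106 = 1) (c 107 = 1) (c 108 = 1) (c 109 = 1)
    (c 110 = 1) (c 111 = 1) (c 112 = 1) (c 113 = 1) (c 114 = 1) (c 115 = 1) (c 116 = 1)
    (c 117 = 1) (c 118 = 1) (c 119 = 1) (c 120 = 1) (c 121 = 1) (c 122 = 1) (c 123 = 1)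
    (c 124 = 1) (c 125 = 1) (c 126 = 1) (c 127 = 1) (c 128 = 1) (c 129 = 1) (c 130 = 1)
    (c 131 = 1) (c 132 = 1) (c 133 = 1) (c 134 = 1) (c 135 = 1) (c 136 = 1) (c 137 = 1)
    (c 138 = 1) (c 139 = 1) (c 140 = 1) (c 141 = 1) (c 142 = 1) (c 143 = 1) (c 144 = 1)
    (c 145 = 1) (c 146 = 1) (c 147 = 1) (c 148 = 1) (c 149 = 1) (c 150 = 1) (c 151 = 1)
    (c 152 = 1) (c 153 = 1) (c 154 = 1) (c 155 = 1) (c 156 = 1) (c 157 = 1) (c 158 = 1)
    (c 159 = 1) (c 160 = 1) (c 161 = 1) (c 162 = 1) (c 163 = 1) (c 164 = 1) (c 165 = 1)
    (c 166 = 1) (c 167 = 1) (c 168 = 1) (c 169 = 1) (c 0 = 2) (c 1 = 2) (c 2 = 2) (c 3 = 2)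
    (c 4 = 2) (c 5 = 2) (c 6 = 2) (c 7 = 2) (c 8 = 2) (c 9 = 2) (c 10 = 2) (c 11 = 2) (c 12 = 2)
    (c 13 = 2) (c 14 = 2) (c 15 = 2) (c 16 = 2) (c 17 = 2) (c 18 = 2) (c 19 = 2) (c 20 = 2)
    (c 21 = 2) (c 22 = 2) (c 23 = 2) (c 24 = 2) (c 25 = 2) (c 26 = 2) (c 27 = 2) (c 28 = 2)
    (c 29 = 2) (c 30 = 2) (c 31 = 2) (c 32 = 2) (c 33 = 2) (c 34 = 2) (c 35 = 2) (c 36 = 2)
    (c 37 = 2) (c 38 = 2) (c 39 = 2) (c 40 = 2) (c 41 = 2) (c 42 = 2) (c 43 = 2) (c 44 = 2)
    (c 45 = 2) (c 46 = 2) (c 47 = 2) (c 48 = 2) (c 49 = 2) (c 50 = 2) (c 51 = 2) (c 52 = 2)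
    (c 53 = 2) (c 54 = 2) (c 55 = 2) (c 56 = 2) (c 57 = 2) (c 58 = 2) (c 59 = 2) (c 60 = 2)
    (c 61 = 2) (c 62 = 2) (c 63 = 2) (c 64 = 2) (c 65 = 2) (c 66 = 2) (c 67 = 2) (c 68 = 2)
    (c 69 = 2) (c 70 = 2) (c 71 = 2) (c 72 = 2) (c 73 = 2) (c 74 = 2) (c 75 = 2) (c 76 = 2)
    (c 77 = 2) (c 78 = 2) (c 79 = 2) (c 80 = 2) (c 81 = 2) (c 82 = 2) (c 83 = 2) (c 84 = 2)
    (c 85 = 2) (c 86 = 2) (c 87 = 2) (c 88 = 2) (c 89 = 2) (c 90 = 2) (c 91 = 2) (c 92 = 2)
    (c 93 = 2) (c 94 = 2) (c 95 = 2) (c 96 = 2) (c 97 = 2) (c 98 = 2) (c 99 = 2) (c 100 = 2)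
    (c 101 = 2) (c 102 = 2) (c 103 = 2) (c 104 = 2) (c 105 = 2) (c 106 = 2) (c 107 = 2)
    (c 108 = 2) (c 109 = 2) (c 110 = 2) (c 111 = 2) (c 112 = 2) (c 113 = 2) (c 114 = 2)
    (c 115 = 2) (c 116 = 2) (c 117 = 2) (c 118 = 2) (c 119 = 2) (c 120 = 2) (c 121 = 2)
    (c 122 = 2) (c 123 = 2) (c 124 = 2) (c 125 = 2) (c 126 = 2) (c 127 = 2) (c 128 = 2)
    (c 129 = 2) (c 130 = 2) (c 131 = 2) (c 132 = 2) (c 133 = 2) (c 134 = 2) (c 135 = 2)
    (c 136 = 2) (c 137 = 2) (c 138 = 2) (c 139 = 2) (c 140 = 2) (c 141 = 2) (c 142 = 2)
    (c 143 = 2) (c 144 = 2) (c 145 = 2) (c 146 = 2) (c 147 = 2) (c 148 = 2) (c 149 = 2)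
    (c 150 = 2) (c 151 = 2) (c 152 = 2) (c 153 = 2) (c 154 = 2) (c 155 = 2) (c 156 = 2)
    (c 157 = 2) (c 158 = 2) (c 159 = 2) (c 160 = 2) (c 161 = 2) (c 162 = 2) (c 163 = 2)
    (c 164 = 2) (c 165 = 2) (c 166 = 2) (c 167 = 2) (c 168 = 2) (c 169 = 2)"
proof -
  have colour: "c v = 0 \<or> c v = 1 \<or> c v = 2" if "v < 170" for v
  proof -
    have "c v < 3"
      using assms that by (simp add: proper3_def)
    then show ?thesis by linarith
  qed
  have edge: "\<not> c u = k \<or> \<not> c v = k" if "u < 170" "v \<in> set (nbs u)" for u v k
    using assms that unfolding proper3_def by metis
  show ?thesis
    \<comment> \<open>Each clause is an instance of \<open>colour\<close> or of \<open>edge\<close>;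
      for an edge the first \<open>simp\<close> bounds its end and the second looks up the
      adjacency.\<close>
    by (rule three_coloured.intro; ((rule colour, simp) | (rule edge, simp, simp add: nbs_table)))
qed

text \<open>With truth values as arguments instead of a number, rotation is a permutation of
  arguments and the quantifiers over all words can be expanded by
  \<open>all_bool_eq\<close>.\<close>

definition word :: "bool \<Rightarrow> bool \<Rightarrow> bool \<Rightarrow> bool \<Rightarrow> bool \<Rightarrow> bool \<Rightarrow> bool \<Rightarrow> bool \<Rightarrow> bool" where
  "word w0 w1 w2 w3 w4 w5 w6 w7 \<longleftrightarrow>
    (\<exists>c. proper3 c \<and> c 136 = 0 \<and> c 137 = 1 \<and>
      (c 0 = 2 \<longleftrightarrow> w0) \<and> (c 1 = 2 \<longleftrightarrow> w1) \<and> (c 2 = 2 \<longleftrightarrow> w2) \<and> (c 3 = 2 \<longleftrightarrow> w3) \<and>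
      (c 4 = 2 \<longleftrightarrow> w4) \<and> (c 5 = 2 \<longleftrightarrow> w5) \<and> (c 6 = 2 \<longleftrightarrow> w6) \<and> (c 7 = 2 \<longleftrightarrow> w7))"

text \<open>Composition with \<open>turn\<close> moves each leaf to the next one, but it also
  exchanges the centres and thus their colours. Swapping colours 0 and 1 repairs this and leaves
  colour 2, which alone is recorded in the word, in place.\<close>

lemma word_rotate:
  assumes "word w0 w1 w2 w3 w4 w5 w6 w7"
  shows "word w1 w2 w3 w4 w5 w6 w7 w0"
proof -
  obtain c where c: "proper3 c" "c 136 = 0" "c 137 = 1"
    "c 0 = 2 \<longleftrightarrow> w0" "c 1 = 2 \<longleftrightarrow> w1" "c 2 = 2 \<longleftrightarrow> w2" "c 3 = 2 \<longleftrightarrow> w3"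
    "c 4 = 2 \<longleftrightarrow> w4" "c 5 = 2 \<longleftrightarrow> w5" "c 6 = 2 \<longleftrightarrow> w6" "c 7 = 2 \<longleftrightarrow> w7"
    using assms unfolding word_def by blast
  define swap where "swap k = (if k = 0 then 1 else if k = 1 then 0 else k)" for k :: nat
  \<comment> \<open>\<open>swap\<close> is injective, preserves the bound and fixes 2: these three
    equivalences strip it from the goals.\<close>
  have swap: "swap k = swap l \<longleftrightarrow> k = l" "swap k < 3 \<longleftrightarrow> k < 3" "swap k = 2 \<longleftrightarrow> k = 2" for k l
    by (auto simp: swap_def)
  have "proper3 (swap \<circ> c \<circ> turn)"
    unfolding proper3_def o_apply swap
  proof (intro allI impI conjI ballI)
    fix u :: nat assume "u < 170"
    then have u: "turn u < 170" "set (map turn (nbs u)) \<subseteq> set (nbs (turn u))"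
      using local_automorphism_turn by (simp_all add: local_automorphism_def)
    show "c (turn u) < 3"
      using c(1) u(1) by (simp add: proper3_def)
    fix v assume "v \<in> set (nbs u)"
    then have "turn v \<in> set (nbs (turn u))"
      using u(2) by auto
    then show "c (turn u) \<noteq> c (turn v)"
      using c(1) u(1) by (simp add: proper3_def)
  qed
  moreover have "turn 0 = 1" "turn 1 = 2" "turn 2 = 3" "turn 3 = 4" "turn 4 = 5" "turn 5 = 6"
      "turn 6 = 7" "turn 7 = 0" "turn 136 = 137" "turn 137 = 136"
    by (simp_all add: turn_def)
  moreover have "swap 0 = 1" "swap 1 = 0"
    by (simp_all add: swap_def)
  ultimately show ?thesis
    \<comment> \<open>The new colour of leaf \<open>i\<close> is 2 exactly if the old colour of leaf
      \<open>i + 1\<close> was, with 7 followed by 0.\<close>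
    unfolding word_def using c(2-) by (intro exI[of _ "swap \<circ> c \<circ> turn"]) (simp only: o_apply swap simp_thms)
qed

text \<open>Outside the locale each refutation speaks of an arbitrary \<open>c\<close> with
  \<open>proper3 c\<close>; the clauses have been discharged by the bridge lemma.\<close>

lemmas no_pattern =
  three_coloured.pattern0[OF three_coloured_proper3]
  three_coloured.pattern1[OF three_coloured_proper3]
  three_coloured.pattern3[OF three_coloured_proper3]
  three_coloured.pattern5[OF three_coloured_proper3]
  three_coloured.pattern7[OF three_coloured_proper3]
  three_coloured.pattern9[OF three_coloured_proper3]
  three_coloured.pattern11[OF three_coloured_proper3]
  three_coloured.pattern13[OF three_coloured_proper3]
  three_coloured.pattern15[OF three_coloured_proper3]
  three_coloured.pattern17[OF three_coloured_proper3]
  three_coloured.pattern19[OF three_coloured_proper3]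
  three_coloured.pattern21[OF three_coloured_proper3]
  three_coloured.pattern23[OF three_coloured_proper3]
  three_coloured.pattern25[OF three_coloured_proper3]
  three_coloured.pattern27[OF three_coloured_proper3]
  three_coloured.pattern29[OF three_coloured_proper3]
  three_coloured.pattern31[OF three_coloured_proper3]
  three_coloured.pattern37[OF three_coloured_proper3]
  three_coloured.pattern39[OF three_coloured_proper3]
  three_coloured.pattern43[OF three_coloured_proper3]
  three_coloured.pattern45[OF three_coloured_proper3]
  three_coloured.pattern47[OF three_coloured_proper3]
  three_coloured.pattern51[OF three_coloured_proper3]
  three_coloured.pattern53[OF three_coloured_proper3]
  three_coloured.pattern55[OF three_coloured_proper3]
  three_coloured.pattern59[OF three_coloured_proper3]
  three_coloured.pattern61[OF three_coloured_proper3]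
  three_coloured.pattern63[OF three_coloured_proper3]
  three_coloured.pattern85[OF three_coloured_proper3]
  three_coloured.pattern87[OF three_coloured_proper3]
  three_coloured.pattern91[OF three_coloured_proper3]
  three_coloured.pattern95[OF three_coloured_proper3]
  three_coloured.pattern111[OF three_coloured_proper3]
  three_coloured.pattern119[OF three_coloured_proper3]
  three_coloured.pattern127[OF three_coloured_proper3]
  three_coloured.pattern255[OF three_coloured_proper3]

text \<open>Burnside's lemma counts (256 + 16 + 2 * 4 + 4 * 2) / 8 = 36 binary words of length 8 up
  to rotation. The bit of leaf 0 comes first, so a row is the binary numeral of its pattern read
  backwards.\<close>

lemma no_word_representative:
  "\<not> word False False False False False False False False"
  "\<not> word True False False False False False False False"
  "\<not> word True True False False False False False False"
  "\<not> word True False True False False False False False"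
  "\<not> word True True True False False False False False"
  "\<not> word True False False True False False False False"
  "\<not> word True True False True False False False False"
  "\<not> word True False True True False False False False"
  "\<not> word True True True True False False False False"
  "\<not> word True False False False True False False False"
  "\<not> word True True False False True False False False"
  "\<not> word True False True False True False False False"
  "\<not> word True True True False True False False False"
  "\<not> word True False False True True False False False"
  "\<not> word True True False True True False False False"
  "\<not> word True False True True True False False False"
  "\<not> word True True True True True False False False"
  "\<not> word True False True False False True False False"
  "\<not> word True True True False False True False False"
  "\<not> word True True False True False True False False"
  "\<not> word True False True True False True False False"
  "\<not> word True True True True False True False False"
  "\<not> word True True False False True True False False"
  "\<not> word True False True False True True False False"
  "\<not> word True True True False True True False False"
  "\<not> word True True False True True True False False"
  "\<not> word True False True True True True False False"
  "\<not> word True True True True True True False False"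
  "\<not> word True False True False True False True False"
  "\<not> word True True True False True False True False"
  "\<not> word True True False True True False True False"
  "\<not> word True True True True True False True False"
  "\<not> word True True True True False True True False"
  "\<not> word True True True False True True True False"
  "\<not> word True True True True True True True False"
  "\<not> word True True True True True True True True"
  \<comment> \<open>Equivalences with \<open>True\<close> and \<open>False\<close> turn into
    literals, the shape of the hypotheses in the patterns.\<close>
  unfolding word_def simp_thms
  \<comment> \<open>All members of \<open>no_pattern\<close> conclude \<open>False\<close>;
    backtracking finds the one whose hypotheses are all among the assumptions.\<close>
  by (intro notI, elim exE conjE, rule no_pattern, assumption+)+

text \<open>The classes exhaust all words: two constant words, one class of two words, three of four
  and thirty of eight give 2 + 2 + 12 + 240 = 256.\<close>

lemma no_word: "\<not> word w0 w1 w2 w3 w4 w5 w6 w7"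
proof -
  have rotate: "\<not> word w1 w2 w3 w4 w5 w6 w7 w0 \<Longrightarrow> \<not> word w0 w1 w2 w3 w4 w5 w6 w7"
    for w0 w1 w2 w3 w4 w5 w6 w7
    using word_rotate by blast
  have "\<forall>w0 w1 w2 w3 w4 w5 w6 w7. \<not> word w0 w1 w2 w3 w4 w5 w6 w7"
    \<comment> \<open>For each of the 256 words a representative is tried before every rotation, so
      at most seven rotations occur.\<close>
    unfolding all_bool_eq by (intro conjI; (rule no_word_representative | rule rotate)+)
  then show ?thesis by blast
qed

text \<open>Any colouring with colours below 3 can be renamed so that the adjacent centres 136 and
  137 get colours 0 and 1; reading off its word contradicts \<open>no_word\<close>.\<close>

lemma not_proper3: "\<not> proper3 c"
proof
  assume c: "proper3 c"
  \<comment> \<open>The renaming: the third colour goes to 2, so \<open>p\<close> is injective on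
    the colours below 3, though not on all numbers.\<close>
  define p where "p k = (if k = c 136 then 0 else if k = c 137 then 1 else 2 :: nat)" for k
  have *: "c 136 < 3" "c 137 < 3" "c 136 \<noteq> c 137"
    using c by (auto simp: proper3_def nbs_table)
  have inj: "p k \<noteq> p l" if "k < 3" "l < 3" "k \<noteq> l" for k l
    using that * by (auto simp: p_def)
  have "proper3 (p \<circ> c)"
    unfolding proper3_def o_apply
  proof (intro allI impI conjI ballI)
    fix u :: nat assume u: "u < 170"
    show "p (c u) < 3" by (simp add: p_def)
    fix v assume v: "v \<in> set (nbs u)"
    then have "v < 170"
      using nbs_props u by blast
    with c u v show "p (c u) \<noteq> p (c v)"
      by (intro inj) (auto simp: proper3_def)
  qed
  moreover have "(p \<circ> c) 136 = 0" "(p \<circ> c) 137 = 1"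
    using * by (simp_all add: p_def)
  \<comment> \<open>The word is the one whose bits are the truth values of colour 2 at the leaves 0
    to 7.\<close>
  ultimately have "\<exists>w0 w1 w2 w3 w4 w5 w6 w7. word w0 w1 w2 w3 w4 w5 w6 w7"
    unfolding word_def by blast
  then show False
    using no_word by blast
qed

section \<open>The chromatic number and the bound\<close>

lemma chromatic_number_star_graph: "chromatic_number star_graph = 4"
  unfolding chromatic_number_def
proof (rule Least_equality)
  \<comment> \<open>The list has 170 entries, so the isolated vertex gets a default colour; any
    colour below 4 would do.\<close>
  let ?c = "\<lambda>v. if v < 170 then colouring4 ! v else 0"
  have "proper_colouring star_graph 4 ?c"
    unfolding proper_colouring_def
  proof (intro conjI ballI)
    show "?c v < 4" for v
      using colouring4_proper by simp
    fix e assume e: "e \<in> parcs star_graph"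
    obtain u v where uv: "e = (u, v)" by (cases e)
    note arc = arc_star_graph[OF e[unfolded uv]]
    have "colouring4 ! u \<noteq> colouring4 ! v"
      using colouring4_proper arc by blast
    then show "case e of (u, v) \<Rightarrow> ?c u \<noteq> ?c v"
      using arc uv by simp
  qed
  then show "\<exists>c. proper_colouring star_graph 4 c" by blast
next
  fix k assume "\<exists>c. proper_colouring star_graph k c"
  then obtain c where c: "proper_colouring star_graph k c" ..
  show "4 \<le> k"
  proof (rule ccontr)
    \<comment> \<open>All \<open>k\<close> up to 3 are treated at once, since colours below
      \<open>k\<close> are then below 3.\<close>
    assume "\<not> 4 \<le> k"
    have "proper3 c"
      unfolding proper3_def
    proof (intro allI impI conjI ballI)
      fix u :: nat assume u: "u < 170"
      then have "c u < k"
        using c by (simp add: proper_colouring_def pverts_star_graph)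
      with \<open>\<not> 4 \<le> k\<close> show "c u < 3" by simp
      fix v assume "v \<in> set (nbs u)"
      with u have "(u, v) \<in> parcs star_graph"
        by (simp add: star_graph_def)
      with c show "c u \<noteq> c v"
        unfolding proper_colouring_def by blast
    qed
    then show False
      using not_proper3 by blast
  qed
qed

theorem theorem7:
  shows "min_order 7 4 \<le> 171 \<and>
    (\<exists>G :: nat pair_pre_digraph.
       pair_graph G \<and> card (pverts G) = 171 \<and> chromatic_number G = 4 \<and> 7 \<le> girth G)"
proof -
  \<comment> \<open>\<open>min_order\<close> states the girth condition with \<open>enat 7\<close>,
    not with the numeral of type \<open>enat\<close>.\<close>
  have "enat 7 \<le> girth star_graph"
    using girth_star_graph by (simp add: numeral_eq_enat)
  then have "min_order 7 4 \<le> enat (card (pverts star_graph))"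
    unfolding min_order_def
    by (intro INF_lower) (simp add: pair_graph_star_graph chromatic_number_star_graph)
  moreover have card: "card (pverts star_graph) = 171"
    by (simp add: pverts_star_graph)
  ultimately have "min_order 7 4 \<le> 171"
    by (simp add: numeral_eq_enat)
  with card show ?thesis
    using pair_graph_star_graph chromatic_number_star_graph girth_star_graph by blast
qed

end
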